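(* Let $n\geq 1$, let $T$ be an $n$-dependent theory with monster model $\mathbb{M}$, let $A\subseteq\mathbb{M}$ be a small set of parameters and let $G=G(\mathbb{M})$ be a group type-definable over $A$. Let $\mathcal{M}\supseteq A$ be a small model (a small elementary submodel of $\mathbb{M}$) and $\bar b_1,\ldots,\bar b_{n-1}$ finite tuples in $\mathbb{M}$ such that $(\mathcal{M},A,\bar b_1,\ldots,\bar b_{n-1})$ are in a generic position. Then there is some $C\subseteq\mathcal{M}$ with $|C|\leq\beth_2(|T|+|A|)$ such that $$G^{00}_{\mathcal{M}\cup\bar b_1\cup\ldots\cup\bar b_{n-1}}=\bigcap_{i=1,\ldots,n-1}G^{00}_{\mathcal{M}\cup\bar b_1\cup\ldots\cup\bar b_{i-1}\cup\bar b_{i+1}\cup\ldots\cup\bar b_{n-1}}\cap G^{00}_{C\cup\bar b_1\cup\ldots\cup\bar b_{n-1}}.$$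
   Context: Monster model: $\mathbb{M}\models T$ is $\kappa(\mathbb M)$-saturated and $\kappa(\mathbb M)$-homogeneous for some sufficiently large strongly inaccessible cardinal $\kappa(\mathbb{M})$; "small" means of cardinality $<\kappa(\mathbb{M})$, and a subgroup has bounded index if its index is small. $T$ is complete. $n$-dependence: a partitioned formula $\varphi(x;y_1,\ldots,y_n)$ (variables are finite tuples) has the $n$-independence property with respect to $T$ if in some model of $T$ there is a sequence of tuples $(a_{1,i},\ldots,a_{n,i})_{i\in\omega}$ such that for every $s\subseteq\omega^n$ there is a tuple $b_s$ with $\models\varphi(b_s;a_{1,i_1},\ldots,a_{n,i_n})\Leftrightarrow(i_1,\ldots,i_n)\in s$; otherwise it is $n$-dependent. $T$ is $n$-dependent if every formula is. For a small set $B$, $G^{00}_B$ is the intersection of all subgroups of $G$ that are type-definable over $B$ and of bounded index. An empty intersection of subgroups of $G$ is $G$. $\beth_0(\kappa)=\kappa$ and $\beth_{m+1}(\kappa)=2^{\beth_m(\kappa)}$. $\kappa$-coheirs: for a cardinal $\kappa$, a model $\mathcal{N}$, a tuple $a$ and a set $B$, write $a\perp^{u,\kappa}_{\mathcal{N}}B$ if for any set $C\subseteq B\cup\mathcal{N}$ of size $<\kappa$, $\mathrm{tp}(a/C)$ is realized in $\mathcal{N}$. Generic position: for a small model $\mathcal{M}$, a subset $A$ of $\mathcal M$ and finite tuples $\bar b_1,\ldots,\bar b_{n-1}$ in $\mathbb{M}$, $(\mathcal{M},A,\bar b_1,\ldots,\bar b_{n-1})$ are in a generic position if there exist regular cardinals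 $\kappa_1<\kappa_2<\ldots<\kappa_{n-1}$ and models $\mathcal{M}_0\preceq\mathcal{M}_1\preceq\ldots\preceq\mathcal{M}_{n-1}=\mathcal{M}$ such that $A\subseteq\mathcal{M}_0$, $\beth_2(|\mathcal{M}_i|)^+\leq\kappa_{i+1}$ for $i=0,\ldots,n-2$, and $\bar b_i\perp^{u,\kappa_i}_{\mathcal{M}_i}\bar b_{<i}\mathcal{M}_{n-1}$ for all $1\leq i\leq n-1$ (where $\bar b_{<i}=\bar b_1\ldots\bar b_{i-1}$). *)

theory Defs
  imports "HOL-Algebra.Coset"
begin

unbundle cardinal_syntax

section \<open>Cardinals\<close>

definition infinite_regular :: "'k rel \<Rightarrow> bool" where
  "infinite_regular \<kappa> \<longleftrightarrow> Card_order \<kappa> \<and> cinfinite \<kappa> \<and> regularCard \<kappa>"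

text \<open>Every cardinal below \<open>\<kappa>\<close> is the cardinality of a subset of \<open>Field \<kappa>\<close>, so the last
  conjunct says that \<open>\<kappa>\<close> is a strong limit.\<close>

definition strongly_inaccessible :: "'k rel \<Rightarrow> bool" where
  "strongly_inaccessible \<kappa> \<longleftrightarrow>
     infinite_regular \<kappa> \<and> natLeq <o \<kappa> \<and> (\<forall>X :: 'k set. |X| <o \<kappa> \<longrightarrow> ctwo ^c |X| <o \<kappa>)"

definition beth2 where
  "beth2 r = ctwo ^c (ctwo ^c r)"

section \<open>First-order logic\<close>

record ('f, 'r) lang =
  Funs :: "'f set"
  Rels :: "'r set"
  farity :: "'f \<Rightarrow> nat"
  rarity :: "'r \<Rightarrow> nat"

datatype 'f trm = Var nat | App 'f "'f trm list"

datatype ('f, 'r) fm =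
    Equal "'f trm" "'f trm"
  | Rel 'r "'f trm list"
  | Neg "('f, 'r) fm"
  | Conj "('f, 'r) fm" "('f, 'r) fm"
  | Ex nat "('f, 'r) fm"

fun wf_trm :: "('f, 'r) lang \<Rightarrow> 'f trm \<Rightarrow> bool" where
  "wf_trm L (Var x) = True"
| "wf_trm L (App f ts) = (f \<in> Funs L \<and> length ts = farity L f \<and> (\<forall>t\<in>set ts. wf_trm L t))"

fun wf_fm :: "('f, 'r) lang \<Rightarrow> ('f, 'r) fm \<Rightarrow> bool" where
  "wf_fm L (Equal s t) = (wf_trm L s \<and> wf_trm L t)"
| "wf_fm L (Rel R ts) = (R \<in> Rels L \<and> length ts = rarity L R \<and> (\<forall>t\<in>set ts. wf_trm L t))"
| "wf_fm L (Neg p) = wf_fm L p"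
| "wf_fm L (Conj p q) = (wf_fm L p \<and> wf_fm L q)"
| "wf_fm L (Ex x p) = wf_fm L p"

fun fv_trm :: "'f trm \<Rightarrow> nat set" where
  "fv_trm (Var x) = {x}"
| "fv_trm (App f ts) = (\<Union>t\<in>set ts. fv_trm t)"

fun fv :: "('f, 'r) fm \<Rightarrow> nat set" where
  "fv (Equal s t) = fv_trm s \<union> fv_trm t"
| "fv (Rel R ts) = (\<Union>t\<in>set ts. fv_trm t)"
| "fv (Neg p) = fv p"
| "fv (Conj p q) = fv p \<union> fv q"
| "fv (Ex x p) = fv p - {x}"

text \<open>The \<open>L\<close>-formulas whose free variables are among \<open>x\<^sub>0, \<dots>, x\<^sub>k\<^sub>-\<^sub>1\<close>.\<close>

definition fmls :: "('f, 'r) lang \<Rightarrow> nat \<Rightarrow> ('f, 'r) fm set" where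
  "fmls L k = {p. wf_fm L p \<and> fv p \<subseteq> {..<k}}"

record ('a, 'f, 'r) struct = "'a partial_object" +
  fun_interp :: "'f \<Rightarrow> 'a list \<Rightarrow> 'a"
  rel_interp :: "'r \<Rightarrow> 'a list set"

definition tuples :: "'a set \<Rightarrow> nat \<Rightarrow> 'a list set" where
  "tuples S k = {xs. set xs \<subseteq> S \<and> length xs = k}"

definition is_struct :: "('f, 'r) lang \<Rightarrow> ('a, 'f, 'r) struct \<Rightarrow> bool" where
  "is_struct L M \<longleftrightarrow> carrier M \<noteq> {} \<and>
     (\<forall>f\<in>Funs L. \<forall>xs\<in>tuples (carrier M) (farity L f). fun_interp M f xs \<in> carrier M)"

fun val :: "('a, 'f, 'r) struct \<Rightarrow> (nat \<Rightarrow> 'a) \<Rightarrow> 'f trm \<Rightarrow> 'a" where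
  "val M v (Var x) = v x"
| "val M v (App f ts) = fun_interp M f (map (val M v) ts)"

fun sat :: "('a, 'f, 'r) struct \<Rightarrow> (nat \<Rightarrow> 'a) \<Rightarrow> ('f, 'r) fm \<Rightarrow> bool" where
  "sat M v (Equal s t) = (val M v s = val M v t)"
| "sat M v (Rel R ts) = (map (val M v) ts \<in> rel_interp M R)"
| "sat M v (Neg p) = (\<not> sat M v p)"
| "sat M v (Conj p q) = (sat M v p \<and> sat M v q)"
| "sat M v (Ex x p) = (\<exists>a\<in>carrier M. sat M (v(x := a)) p)"

text \<open>\<open>M \<Turnstile> p(xs)\<close>, with \<open>xs\<close> assigned to the first variables. It is only used for
  \<open>p \<in> fmls L (length xs)\<close>, so the unspecified values of \<open>(!) xs\<close> beyond the list are irrelevant.\<close>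

definition holds :: "('a, 'f, 'r) struct \<Rightarrow> ('f, 'r) fm \<Rightarrow> 'a list \<Rightarrow> bool" where
  "holds M p xs = sat M ((!) xs) p"

definition models :: "('f, 'r) lang \<Rightarrow> ('a, 'f, 'r) struct \<Rightarrow> ('f, 'r) fm set \<Rightarrow> bool" where
  "models L M T \<longleftrightarrow> is_struct L M \<and> (\<forall>p\<in>T. holds M p [])"

text \<open>A complete theory is taken to be deductively closed, i.e. to consist of all sentences true in
  its models (consistency comes from having a model). Hence \<open>|T|\<close> is the number of
  \<open>L\<close>-sentences, which is \<open>|L| + \<aleph>\<^sub>0\<close>, the usual meaning of the cardinality of a theory.\<close>

definition complete_theory :: "('f, 'r) lang \<Rightarrow> ('f, 'r) fm set \<Rightarrow> bool" where
  "complete_theory L T \<longleftrightarrow> T \<subseteq> fmls L 0 \<and> (\<forall>p\<in>fmls L 0. p \<in> T \<longleftrightarrow> Neg p \<notin> T)"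

definition elem_substruct ::
    "('f, 'r) lang \<Rightarrow> ('a, 'f, 'r) struct \<Rightarrow> ('a, 'f, 'r) struct \<Rightarrow> bool" where
  "elem_substruct L N M \<longleftrightarrow> is_struct L N \<and> is_struct L M \<and> carrier N \<subseteq> carrier M \<and>
     (\<forall>xs\<in>lists (carrier N). \<forall>p\<in>fmls L (length xs). holds N p xs \<longleftrightarrow> holds M p xs)"

text \<open>Substructures of a fixed structure are given by their underlying sets.\<close>

definition induced :: "('a, 'f, 'r) struct \<Rightarrow> 'a set \<Rightarrow> ('a, 'f, 'r) struct" where
  "induced M S = M\<lparr>carrier := S\<rparr>"

section \<open>Types and the monster model\<close>

text \<open>The pair \<open>(p, c)\<close> stands for the formula \<open>p(x\<^sub>0, \<dots>, x\<^sub>k\<^sub>-\<^sub>1; c)\<close> with parameters \<open>c\<close> from \<open>B\<close>.\<close>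

definition param_fmls :: "('f, 'r) lang \<Rightarrow> nat \<Rightarrow> 'a set \<Rightarrow> (('f, 'r) fm \<times> 'a list) set" where
  "param_fmls L k B = {(p, c). c \<in> lists B \<and> p \<in> fmls L (k + length c)}"

definition realizes :: "('a, 'f, 'r) struct \<Rightarrow> 'a list \<Rightarrow> (('f, 'r) fm \<times> 'a list) set \<Rightarrow> bool" where
  "realizes M a \<pi> \<longleftrightarrow> (\<forall>(p, c)\<in>\<pi>. holds M p (a @ c))"

definition tp :: "('f, 'r) lang \<Rightarrow> ('a, 'f, 'r) struct \<Rightarrow> 'a list \<Rightarrow> 'a set
    \<Rightarrow> (('f, 'r) fm \<times> 'a list) set" where
  "tp L M a C = {(p, c)\<in>param_fmls L (length a) C. holds M p (a @ c)}"

definition type_definable ::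
    "('f, 'r) lang \<Rightarrow> ('a, 'f, 'r) struct \<Rightarrow> 'a set \<Rightarrow> nat \<Rightarrow> 'a list set \<Rightarrow> bool" where
  "type_definable L M B k X \<longleftrightarrow>
     (\<exists>\<pi> \<subseteq> param_fmls L k B. X = {a\<in>tuples (carrier M) k. realizes M a \<pi>})"

definition saturated :: "('f, 'r) lang \<Rightarrow> ('a, 'f, 'r) struct \<Rightarrow> 'k rel \<Rightarrow> bool" where
  "saturated L M \<kappa> \<longleftrightarrow>
     (\<forall>B k \<pi>. B \<subseteq> carrier M \<longrightarrow> |B| <o \<kappa> \<longrightarrow> \<pi> \<subseteq> param_fmls L k B \<longrightarrow>
        (\<forall>\<pi>0 \<subseteq> \<pi>. finite \<pi>0 \<longrightarrow> (\<exists>a\<in>tuples (carrier M) k. realizes M a \<pi>0)) \<longrightarrow>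
        (\<exists>a\<in>tuples (carrier M) k. realizes M a \<pi>))"

definition elementary_map ::
    "('f, 'r) lang \<Rightarrow> ('a, 'f, 'r) struct \<Rightarrow> 'a set \<Rightarrow> ('a \<Rightarrow> 'a) \<Rightarrow> bool" where
  "elementary_map L M B g \<longleftrightarrow> B \<subseteq> carrier M \<and> g ` B \<subseteq> carrier M \<and>
     (\<forall>xs\<in>lists B. \<forall>p\<in>fmls L (length xs). holds M p xs \<longleftrightarrow> holds M p (map g xs))"

definition automorphism ::
    "('f, 'r) lang \<Rightarrow> ('a, 'f, 'r) struct \<Rightarrow> ('a \<Rightarrow> 'a) \<Rightarrow> bool" where
  "automorphism L M \<sigma> \<longleftrightarrow> bij_betw \<sigma> (carrier M) (carrier M) \<and>
     (\<forall>f\<in>Funs L. \<forall>xs\<in>tuples (carrier M) (farity L f).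
        \<sigma> (fun_interp M f xs) = fun_interp M f (map \<sigma> xs)) \<and>
     (\<forall>R\<in>Rels L. \<forall>xs\<in>tuples (carrier M) (rarity L R).
        xs \<in> rel_interp M R \<longleftrightarrow> map \<sigma> xs \<in> rel_interp M R)"

definition homogeneous :: "('f, 'r) lang \<Rightarrow> ('a, 'f, 'r) struct \<Rightarrow> 'k rel \<Rightarrow> bool" where
  "homogeneous L M \<kappa> \<longleftrightarrow>
     (\<forall>B g. |B| <o \<kappa> \<longrightarrow> elementary_map L M B g \<longrightarrow>
        (\<exists>\<sigma>. automorphism L M \<sigma> \<and> (\<forall>x\<in>B. \<sigma> x = g x)))"

text \<open>The only largeness of \<open>\<kappa>\<close> required beyond inaccessibility is \<open>|T| < \<kappa>\<close>.\<close>

definition monster_model ::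
    "('f, 'r) lang \<Rightarrow> ('f, 'r) fm set \<Rightarrow> ('a, 'f, 'r) struct \<Rightarrow> 'k rel \<Rightarrow> bool" where
  "monster_model L T M \<kappa> \<longleftrightarrow> models L M T \<and> strongly_inaccessible \<kappa> \<and> |T| <o \<kappa> \<and>
     saturated L M \<kappa> \<and> homogeneous L M \<kappa>"

section \<open>n-dependence\<close>

text \<open>\<open>p(x; y\<^sub>0, \<dots>, y\<^sub>n\<^sub>-\<^sub>1)\<close> with \<open>x\<close> of length \<open>l\<close> and \<open>y\<^sub>j\<close> of length \<open>m j\<close>, the variables being
  numbered consecutively in this order; every partitioned formula has this form after renaming
  variables. Models are those with universe inside the type \<open>'u\<close>, since HOL cannot quantify over types
  in a formula. If \<open>'u\<close> is the type carrying a monster model of the complete theory \<open>T\<close>, this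
  loses nothing: the \<open>2\<^sup>\<aleph>\<^sup>0\<close> tuples witnessing the property lie in a model of \<open>T\<close> of cardinality at most
  \<open>|T| + 2\<^sup>\<aleph>\<^sup>0\<close> by Loewenheim-Skolem, and \<open>'u\<close> has at least as many elements unless \<open>T\<close> has
  a finite model, which is then its only one.\<close>

definition n_independence_property ::
    "'u itself \<Rightarrow> ('f, 'r) lang \<Rightarrow> nat \<Rightarrow> ('f, 'r) fm set \<Rightarrow> ('f, 'r) fm \<Rightarrow> nat \<Rightarrow> (nat \<Rightarrow> nat) \<Rightarrow> bool" where
  "n_independence_property (u :: 'u itself) L n T p l m \<longleftrightarrow>
     (\<exists>(N :: ('u, 'f, 'r) struct) (a :: nat \<Rightarrow> nat \<Rightarrow> 'u list). models L N T \<and>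
        (\<forall>j<n. \<forall>i. a j i \<in> tuples (carrier N) (m j)) \<and>
        (\<forall>s \<subseteq> {is. length is = n}. \<exists>b\<in>tuples (carrier N) l. \<forall>is. length is = n \<longrightarrow>
           (holds N p (b @ concat (map (\<lambda>j. a j (is ! j)) [0..<n])) \<longleftrightarrow> is \<in> s)))"

definition n_dependent ::
    "'u itself \<Rightarrow> ('f, 'r) lang \<Rightarrow> nat \<Rightarrow> ('f, 'r) fm set \<Rightarrow> bool" where
  "n_dependent u L n T \<longleftrightarrow>
     (\<forall>l m. \<forall>p\<in>fmls L (l + (\<Sum>j<n. m j)). \<not> n_independence_property u L n T p l m)"

section \<open>Type-definable groups\<close>

text \<open>The graph of the multiplication is only required to be type-definable. In a saturated model
  it is then relatively definable in the cube of the carrier, by compactness.\<close>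

definition type_definable_group ::
    "('f, 'r) lang \<Rightarrow> ('a, 'f, 'r) struct \<Rightarrow> 'a set \<Rightarrow> nat \<Rightarrow> ('a list, 'z) monoid_scheme \<Rightarrow> bool" where
  "type_definable_group L M A k G \<longleftrightarrow> group G \<and> type_definable L M A k (carrier G) \<and>
     type_definable L M A (3 * k) {x @ y @ (x \<otimes>\<^bsub>G\<^esub> y) | x y. x \<in> carrier G \<and> y \<in> carrier G}"

definition bounded_index :: "'k rel \<Rightarrow> ('b, 'z) monoid_scheme \<Rightarrow> 'b set \<Rightarrow> bool" where
  "bounded_index \<kappa> G H \<longleftrightarrow> |rcosets\<^bsub>G\<^esub> H| <o \<kappa>"

text \<open>Intersecting with \<open>carrier G\<close> makes the empty intersection equal to \<open>G\<close>.\<close>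

definition G00 :: "('f, 'r) lang \<Rightarrow> ('a, 'f, 'r) struct \<Rightarrow> 'k rel \<Rightarrow> nat
    \<Rightarrow> ('a list, 'z) monoid_scheme \<Rightarrow> 'a set \<Rightarrow> 'a list set" where
  "G00 L M \<kappa> k G B = carrier G \<inter>
     \<Inter> {H. subgroup H G \<and> type_definable L M B k H \<and> bounded_index \<kappa> G H}"

section \<open>Generic position\<close>

text \<open>In the next two definitions \<open>M\<close> is the monster model, in which all types are computed.\<close>

definition coheir :: "('f, 'r) lang \<Rightarrow> ('a, 'f, 'r) struct \<Rightarrow> 'c rel \<Rightarrow> 'a set \<Rightarrow> 'a list \<Rightarrow> 'a set \<Rightarrow> bool" where
  "coheir L M \<kappa> N a B \<longleftrightarrow>
     (\<forall>C \<subseteq> B \<union> N. |C| <o \<kappa> \<longrightarrow> (\<exists>a'\<in>tuples N (length a). realizes M a' (tp L M a C)))"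

text \<open>The cardinals \<open>\<kappa>\<^sub>i\<close> are taken on the type \<open>'c\<close>. A theorem assuming
  \<open>generic_position TYPE('c)\<close> with a type variable \<open>'c\<close> covers all choices of cardinals.
  Indices follow the informal convention: \<open>\<kappa> i\<close> and \<open>b i\<close> are used for \<open>1 \<le> i \<le> n - 1\<close> and
  \<open>Ms i\<close> for \<open>0 \<le> i \<le> n - 1\<close>.\<close>

definition generic_position :: "'c itself \<Rightarrow> ('f, 'r) lang \<Rightarrow> ('a, 'f, 'r) struct \<Rightarrow> nat
    \<Rightarrow> 'a set \<Rightarrow> 'a set \<Rightarrow> (nat \<Rightarrow> 'a list) \<Rightarrow> bool" where
  "generic_position (t :: 'c itself) L M n N A b \<longleftrightarrow>
     (\<exists>(\<kappa> :: nat \<Rightarrow> 'c rel) (Ms :: nat \<Rightarrow> 'a set).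
        (\<forall>i\<in>{1..n-1}. infinite_regular (\<kappa> i)) \<and>
        (\<forall>i\<in>{1..<n-1}. \<kappa> i <o \<kappa> (Suc i)) \<and>
        (\<forall>i<n-1. elem_substruct L (induced M (Ms i)) (induced M (Ms (Suc i)))) \<and>
        Ms (n - 1) = N \<and> elem_substruct L (induced M N) M \<and> A \<subseteq> Ms 0 \<and>
        (\<forall>i<n-1. cardSuc (beth2 |Ms i| ) \<le>o \<kappa> (Suc i)) \<and>
        (\<forall>i\<in>{1..n-1}. coheir L M (\<kappa> i) (Ms i) (b i) ((\<Union>j\<in>{1..<i}. set (b j)) \<union> N)))"

end

theory Submission
  imports Defs "HOL-Library.Ramsey"
begin

text \<open>
  Suppose that \<open>g\<close> lies in the connected components over \<open>M\<close> and all but one of the tuples \<open>b i\<close>, and in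
  that over \<open>C\<close> and \<open>b\<close>, but outside some subgroup \<open>H\<close> of bounded index that is type-definable over \<open>M\<close>
  and \<open>b\<close>. By compactness \<open>H\<close> may be replaced by a filtration of definable sets with parameters from a
  sequence in \<open>M\<close> and from \<open>b\<close>. Call its formulas, without the parameters from \<open>M\<close>, a scheme. A chain of a
  scheme consists of such subgroups \<open>H 0, \<dots>, H l\<close> and elements \<open>g j\<close> with \<open>g j \<in> H i\<close> for \<open>i < j\<close> and
  \<open>g j \<notin> H j\<close>. If \<open>C\<close> contains the parameters of a longest chain of every scheme, then \<open>g\<close> would lengthen
  one of them. So it suffices that the chains of each scheme are of bounded length.

  Generic position turns a chain into an \<open>n\<close>-dimensional grid: for \<open>i = n - 1, \<dots>, 1\<close> choose tuples \<open>B i j\<close>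
  in the \<open>i\<close>-th model that realize the type of \<open>b i\<close> over the \<open>(i - 1)\<close>-st model, over \<open>b 1, \<dots>, b (i - 1)\<close> and
  over all tuples chosen before. For a point \<open>p\<close> of the grid there is an automorphism that carries every
  \<open>b i\<close> to \<open>B i (p i)\<close> and fixes \<open>B i j\<close> for \<open>j < p i\<close>. The image \<open>h p\<close> of an element of the chain therefore
  lies in the groups at all points below \<open>p\<close> in the product order, but not in the group at \<open>p\<close>. Since the
  index is bounded, Ramsey's theorem, applied to one coordinate at a time, gives quotients \<open>h p \<otimes> inv (h p')\<close>
  that lie in the groups at the points above as well. Products of the resulting elements show that a
  formula of the scheme shatters arbitrarily large finite grids, contradicting \<open>n\<close>-dependence.
\<close>

section \<open>Formulas and substitution\<close>

text \<open>The obstacle is that a subgroup of bounded index is only type-definable, whereas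
  shattering must be done by one formula and Ramsey's theorem needs finite bounds. Hence the
  subgroup is replaced by descending layers: a quotient of two elements of layer
  \<open>r + 1\<close> lies in layer \<open>r\<close>, and among any \<open>N r\<close> elements of
  G two have a quotient in layer \<open>r\<close>, a finite shadow of bounded index. Group
  operations now cost levels: cleaning the n coordinates raises the level of failure from 0 to n,
  and isolating one factor of a product takes four more, hence the formula of level
  \<open>n + 4\<close>. The numbers \<open>N r\<close> belong to the scheme because Ramsey's theorem
  must apply with the same bounds to all groups of a chain. Since a scheme consists of three
  sequences indexed by the natural numbers, there are at most 2^|T| of them, and each contributes
  countably many parameters to C. The n - 1 tuples give an n-dimensional grid because the position
  in the chain serves as coordinate 0.\<close>

lemma val_cong: "(\<And>x. x \<in> fv_trm t \<Longrightarrow> v x = w x) \<Longrightarrow> val M v t = val M w t"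
proof (induction t)
  case (App f ts)
  have "val M v t = val M w t" if "t \<in> set ts" for t
    by (rule App.IH[OF that]) (use App.prems that in auto)
  then have "map (val M v) ts = map (val M w) ts" by simp
  then show ?case by (simp only: val.simps)
qed simp

lemma sat_cong: "(\<And>x. x \<in> fv p \<Longrightarrow> v x = w x) \<Longrightarrow> sat M v p \<longleftrightarrow> sat M w p"
proof (induction p arbitrary: v w)
  case (Equal s t)
  then have "val M v s = val M w s" "val M v t = val M w t"
    by (auto intro!: val_cong)
  then show ?case by simp
next
  case (Rel R ts)
  then have "map (val M v) ts = map (val M w) ts"
    by (auto intro!: val_cong)
  then show ?case by (simp del: map_eq_conv)
next
  case (Neg p)
  have "sat M v p \<longleftrightarrow> sat M w p"
    by (rule Neg.IH) (use Neg.prems in simp)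
  then show ?case by simp
next
  case (Conj p q)
  have "sat M v p \<longleftrightarrow> sat M w p"
    by (rule Conj.IH(1)) (use Conj.prems in simp)
  moreover have "sat M v q \<longleftrightarrow> sat M w q"
    by (rule Conj.IH(2)) (use Conj.prems in simp)
  ultimately show ?case by simp
next
  case (Ex x p)
  have "sat M (v(x := a)) p \<longleftrightarrow> sat M (w(x := a)) p" for a
    by (rule Ex.IH) (use Ex.prems in auto)
  then show ?case by simp
qed

lemma finite_fv_trm: "finite (fv_trm t)"
  by (induction t) auto

lemma finite_fv: "finite (fv p)"
  by (induction p) (auto simp: finite_fv_trm)

fun ren_trm :: "(nat \<Rightarrow> nat) \<Rightarrow> 'f trm \<Rightarrow> 'f trm" where
  "ren_trm f (Var x) = Var (f x)"
| "ren_trm f (App g ts) = App g (map (ren_trm f) ts)"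

text \<open>The bound variable is renamed to a fresh one, so that \<open>f\<close> may be an arbitrary function.\<close>

fun ren :: "(nat \<Rightarrow> nat) \<Rightarrow> ('f, 'r) fm \<Rightarrow> ('f, 'r) fm" where
  "ren f (Equal s t) = Equal (ren_trm f s) (ren_trm f t)"
| "ren f (Rel R ts) = Rel R (map (ren_trm f) ts)"
| "ren f (Neg p) = Neg (ren f p)"
| "ren f (Conj p q) = Conj (ren f p) (ren f q)"
| "ren f (Ex x p) = (let y = Suc (Max (insert 0 (f ` fv p))) in Ex y (ren (f(x := y)) p))"

lemma fv_ren_trm: "fv_trm (ren_trm f t) = f ` fv_trm t"
  by (induction t) auto

lemma wf_ren_trm: "wf_trm L t \<Longrightarrow> wf_trm L (ren_trm f t)"
  by (induction t) auto

lemma val_ren_trm: "val M v (ren_trm f t) = val M (v \<circ> f) t"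
  by (induction t) (auto intro!: arg_cong[where f = "fun_interp M _"])

lemma wf_ren: "wf_fm L p \<Longrightarrow> wf_fm L (ren f p)"
  by (induction p arbitrary: f) (auto simp: wf_ren_trm Let_def)

lemma fresh_less: "x \<in> fv p \<Longrightarrow> f x < Suc (Max (insert 0 (f ` fv p)))"
  using finite_fv[of p] by (simp add: le_imp_less_Suc)

lemma fv_ren: "fv (ren f p) = f ` fv p"
proof (induction p arbitrary: f)
  case (Ex x p)
  let ?y = "Suc (Max (insert 0 (f ` fv p)))"
  have "?y \<notin> f ` fv p"
  proof
    assume "?y \<in> f ` fv p"
    then obtain x where "x \<in> fv p" "?y = f x" by (rule imageE)
    then show False using fresh_less[of x p f] by simp
  qed
  moreover have "fv (ren (f(x := ?y)) p) = f(x := ?y) ` fv p" by (rule Ex)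
  moreover have "f(x := ?y) ` fv p - {?y} = f ` (fv p - {x})"
    using \<open>?y \<notin> f ` fv p\<close> by (fastforce simp: image_iff split: if_splits)
  ultimately show ?case by (simp only: ren.simps Let_def fv.simps)
qed (auto simp: fv_ren_trm)

lemma sat_ren: "sat M v (ren f p) \<longleftrightarrow> sat M (v \<circ> f) p"
proof (induction p arbitrary: v f)
  case (Rel R ts)
  have "map (val M v) (map (ren_trm f) ts) = map (val M (v \<circ> f)) ts"
    by (simp add: val_ren_trm)
  then show ?case by (simp only: ren.simps sat.simps)
next
  case (Ex x p)
  let ?y = "Suc (Max (insert 0 (f ` fv p)))"
  have "sat M (v(?y := a)) (ren (f(x := ?y)) p) \<longleftrightarrow> sat M ((v \<circ> f)(x := a)) p" for a
  proof -
    have "sat M (v(?y := a)) (ren (f(x := ?y)) p) \<longleftrightarrow> sat M (v(?y := a) \<circ> f(x := ?y)) p"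
      by (rule Ex.IH)
    also have "\<dots> \<longleftrightarrow> sat M ((v \<circ> f)(x := a)) p"
      by (rule sat_cong) (use fresh_less[of _ p f] in force)
    finally show ?thesis .
  qed
  then show ?case by (simp add: Let_def comp_def)
qed (simp_all add: val_ren_trm)

text \<open>All manipulation of variables goes through this lemma: permuting, repeating and
  inserting coordinates are choices of \<open>f\<close>. The values of \<open>f\<close> from
  \<open>N\<close> on do not matter, since these variables are not free in p.\<close>

lemma holds_ren:
  assumes "p \<in> fmls L N" and "\<And>i. i < N \<Longrightarrow> f i < N'"
  shows "ren f p \<in> fmls L N'"
    and "holds M (ren f p) xs \<longleftrightarrow> holds M p (map (\<lambda>i. xs ! f i) [0..<N])"
proof -
  show "ren f p \<in> fmls L N'"
    using assms by (auto simp: fmls_def wf_ren fv_ren)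
  show "holds M (ren f p) xs \<longleftrightarrow> holds M p (map (\<lambda>i. xs ! f i) [0..<N])"
    unfolding holds_def sat_ren by (rule sat_cong) (use assms(1) in \<open>auto simp: fmls_def\<close>)
qed

lemma Neg_fmls [simp]: "Neg p \<in> fmls L k \<longleftrightarrow> p \<in> fmls L k"
  by (auto simp: fmls_def)

lemma Conj_fmls [simp]: "Conj p q \<in> fmls L k \<longleftrightarrow> p \<in> fmls L k \<and> q \<in> fmls L k"
  by (auto simp: fmls_def)

lemma holds_Neg [simp]: "holds M (Neg p) xs \<longleftrightarrow> \<not> holds M p xs"
  by (simp add: holds_def)

lemma holds_Conj [simp]: "holds M (Conj p q) xs \<longleftrightarrow> holds M p xs \<and> holds M q xs"
  by (simp add: holds_def)

lemma map_nth_offset: "map (\<lambda>i. xs ! (s + i)) [0..<k] = take k (drop s xs)" if "s + k \<le> length xs"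
  using that by (intro nth_equalityI) auto

lemma tuples_append:
  "xs \<in> tuples S (j + k) \<longleftrightarrow> (\<exists>ys\<in>tuples S j. \<exists>zs\<in>tuples S k. xs = ys @ zs)"
proof
  assume "xs \<in> tuples S (j + k)"
  then have "take j xs \<in> tuples S j" "drop j xs \<in> tuples S k" "xs = take j xs @ drop j xs"
    by (auto simp: tuples_def dest: in_set_takeD in_set_dropD)
  then show "\<exists>ys\<in>tuples S j. \<exists>zs\<in>tuples S k. xs = ys @ zs" by blast
qed (auto simp: tuples_def)

section \<open>Definable sets\<close>

text \<open>A set rather than a formula, so that Boolean operations, projections and pullbacks are
  closure properties and a type-definable set is the intersection of a family of sets.\<close>

definition definable ::
    "('f, 'r) lang \<Rightarrow> ('a, 'f, 'r) struct \<Rightarrow> 'a set \<Rightarrow> nat \<Rightarrow> 'a list set \<Rightarrow> bool" where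
  "definable L M B k X \<longleftrightarrow>
     (\<exists>c\<in>lists B. \<exists>p\<in>fmls L (k + length c). X = {a\<in>tuples (carrier M) k. holds M p (a @ c)})"

lemma definableI:
  "c \<in> lists B \<Longrightarrow> p \<in> fmls L (k + length c) \<Longrightarrow>
    definable L M B k {a\<in>tuples (carrier M) k. holds M p (a @ c)}"
  by (auto simp: definable_def)

lemma definable_subset: "definable L M B k X \<Longrightarrow> X \<subseteq> tuples (carrier M) k"
  by (auto simp: definable_def)

lemma definable_mono: "definable L M B k X \<Longrightarrow> B \<subseteq> B' \<Longrightarrow> definable L M B' k X"
  unfolding definable_def by (meson lists_mono subsetD)

lemma definable_compl:
  assumes "definable L M B k X"
  shows "definable L M B k (tuples (carrier M) k - X)"
proof -
  obtain c p where "c \<in> lists B" "p \<in> fmls L (k + length c)"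
    and X: "X = {a\<in>tuples (carrier M) k. holds M p (a @ c)}"
    using assms by (auto simp: definable_def)
  then have "definable L M B k {a\<in>tuples (carrier M) k. holds M (Neg p) (a @ c)}"
    by (intro definableI) auto
  also have "{a\<in>tuples (carrier M) k. holds M (Neg p) (a @ c)} = tuples (carrier M) k - X"
    by (auto simp: X)
  finally show ?thesis .
qed

text \<open>Each entry of c occurs somewhere in d, so p can be renamed along a choice of positions.
  This lets two formulas share one parameter list, and later moves the parameters of a formula into
  the uniform list \<open>params\<close>.\<close>

lemma definable_reparam:
  assumes p: "p \<in> fmls L (k + length c)" and cd: "set c \<subseteq> set d"
  obtains q where "q \<in> fmls L (k + length d)"
    and "\<And>a. length a = k \<Longrightarrow> holds M q (a @ d) \<longleftrightarrow> holds M p (a @ c)"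
proof -
  have "\<forall>i<length c. \<exists>j<length d. d ! j = c ! i"
    using cd by (metis in_set_conv_nth subsetD)
  then obtain g where g: "\<And>i. i < length c \<Longrightarrow> g i < length d \<and> d ! g i = c ! i" by metis
  define f where "f i = (if i < k then i else k + g (i - k))" for i
  have f: "i < k + length c \<Longrightarrow> f i < k + length d" for i
    using g[of "i - k"] by (auto simp: f_def)
  have "holds M (ren f p) (a @ d) \<longleftrightarrow> holds M p (a @ c)" if "length a = k" for a
  proof -
    have "map (\<lambda>i. (a @ d) ! f i) [0..<k + length c] = a @ c"
      using that g by (intro nth_equalityI) (auto simp: f_def nth_append)
    then show ?thesis by (simp add: holds_ren(2)[OF p f])
  qed
  with holds_ren(1)[OF p f] show thesis by (rule that)
qed

lemma definable_Int:
  assumes "definable L M B k X" and "definable L M B k Y"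
  shows "definable L M B k (X \<inter> Y)"
proof -
  obtain c p where c: "c \<in> lists B" "p \<in> fmls L (k + length c)"
    and X: "X = {a\<in>tuples (carrier M) k. holds M p (a @ c)}"
    using assms(1) by (auto simp: definable_def)
  obtain d q where d: "d \<in> lists B" "q \<in> fmls L (k + length d)"
    and Y: "Y = {a\<in>tuples (carrier M) k. holds M q (a @ d)}"
    using assms(2) by (auto simp: definable_def)
  obtain p' where p': "p' \<in> fmls L (k + length (c @ d))"
      "\<And>a. length a = k \<Longrightarrow> holds M p' (a @ c @ d) \<longleftrightarrow> holds M p (a @ c)"
    using definable_reparam[OF c(2), of "c @ d" M] by auto
  obtain q' where q': "q' \<in> fmls L (k + length (c @ d))"
      "\<And>a. length a = k \<Longrightarrow> holds M q' (a @ c @ d) \<longleftrightarrow> holds M q (a @ d)"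
    using definable_reparam[OF d(2), of "c @ d" M] by auto
  have "definable L M B k {a\<in>tuples (carrier M) k. holds M (Conj p' q') (a @ c @ d)}"
    using c d p' q' by (intro definableI) auto
  also have "{a\<in>tuples (carrier M) k. holds M (Conj p' q') (a @ c @ d)} = X \<inter> Y"
    using p'(2) q'(2) by (auto simp: X Y tuples_def)
  finally show ?thesis .
qed

definition verum :: "('f, 'r) fm" where "verum = Ex 0 (Equal (Var 0) (Var 0))"

lemma verum_fmls [simp]: "verum \<in> fmls L k"
  by (simp add: verum_def fmls_def)

lemma holds_verum: "carrier M \<noteq> {} \<Longrightarrow> holds M verum xs"
  by (auto simp: verum_def holds_def)

lemma definable_tuples:
  assumes "carrier M \<noteq> {}"
  shows "definable L M B k (tuples (carrier M) k)"
  using definableI[of "[]" B verum L k M] by (simp add: holds_verum[OF assms])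

lemma definable_empty:
  assumes "carrier M \<noteq> {}"
  shows "definable L M B k {}"
  using definable_compl[OF definable_tuples[OF assms]] by simp

lemma definable_INT:
  assumes "carrier M \<noteq> {}" and "finite I" and "\<And>i. i \<in> I \<Longrightarrow> definable L M B k (X i)"
  shows "definable L M B k {a\<in>tuples (carrier M) k. \<forall>i\<in>I. a \<in> X i}"
  using assms(2,3)
proof (induction I rule: finite_induct)
  case empty
  then show ?case using definable_tuples[OF assms(1)] by simp
next
  case (insert i I)
  then have "definable L M B k (X i \<inter> {a\<in>tuples (carrier M) k. \<forall>i\<in>I. a \<in> X i})"
    by (intro definable_Int) auto
  also have "X i \<inter> {a\<in>tuples (carrier M) k. \<forall>i\<in>I. a \<in> X i}
      = {a\<in>tuples (carrier M) k. \<forall>j\<in>insert i I. a \<in> X j}"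
    by auto
  finally show ?case .
qed

text \<open>Renaming acts on the coordinates by \<open>f\<close> and shifts the parameters behind
  the K coordinates. As \<open>f\<close> may omit or repeat coordinates, blocks and permutations are
  special cases.\<close>

lemma definable_pullback:
  assumes X: "definable L M B k X" and f: "\<And>i. i < k \<Longrightarrow> f i < K"
  shows "definable L M B K {a\<in>tuples (carrier M) K. map (\<lambda>i. a ! f i) [0..<k] \<in> X}"
proof -
  obtain c p where c: "c \<in> lists B" and p: "p \<in> fmls L (k + length c)"
    and X: "X = {a\<in>tuples (carrier M) k. holds M p (a @ c)}"
    using X by (auto simp: definable_def)
  define g where "g i = (if i < k then f i else K + (i - k))" for i
  have g: "i < k + length c \<Longrightarrow> g i < K + length c" for i
    using f by (auto simp: g_def intro: trans_less_add1)
  have "definable L M B K {a\<in>tuples (carrier M) K. holds M (ren g p) (a @ c)}"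
    by (intro definableI c holds_ren(1)[OF p g])
  also have "{a\<in>tuples (carrier M) K. holds M (ren g p) (a @ c)}
      = {a\<in>tuples (carrier M) K. map (\<lambda>i. a ! f i) [0..<k] \<in> X}"
  proof -
    have "holds M (ren g p) (a @ c) \<longleftrightarrow> map (\<lambda>i. a ! f i) [0..<k] \<in> X"
      if a: "a \<in> tuples (carrier M) K" for a
    proof -
      have "map (\<lambda>i. (a @ c) ! g i) [0..<k + length c] = map (\<lambda>i. a ! f i) [0..<k] @ c"
        using a f by (intro nth_equalityI) (auto simp: g_def nth_append tuples_def)
      moreover have "map (\<lambda>i. a ! f i) [0..<k] \<in> tuples (carrier M) k"
        using a f by (auto simp: tuples_def)
      ultimately show ?thesis by (simp add: holds_ren(2)[OF p g] X)
    qed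
    then show ?thesis by blast
  qed
  finally show ?thesis .
qed

lemma definable_block:
  assumes "definable L M B k X" and "s + k \<le> K"
  shows "definable L M B K {a\<in>tuples (carrier M) K. take k (drop s a) \<in> X}"
proof -
  have "definable L M B K {a\<in>tuples (carrier M) K. map (\<lambda>i. a ! (s + i)) [0..<k] \<in> X}"
    using assms by (intro definable_pullback) auto
  also have "{a\<in>tuples (carrier M) K. map (\<lambda>i. a ! (s + i)) [0..<k] \<in> X}
      = {a\<in>tuples (carrier M) K. take k (drop s a) \<in> X}"
    using assms by (auto simp: tuples_def map_nth_offset)
  finally show ?thesis .
qed

lemma definable_ex1:
  assumes "definable L M B (Suc k) X"
  shows "definable L M B k {a\<in>tuples (carrier M) k. \<exists>z\<in>carrier M. a @ [z] \<in> X}"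
proof -
  obtain c p where c: "c \<in> lists B" and p: "p \<in> fmls L (Suc k + length c)"
    and X: "X = {a\<in>tuples (carrier M) (Suc k). holds M p (a @ c)}"
    using assms by (auto simp: definable_def)
  define y where "y = k + length c"
  \<comment> \<open>The quantified coordinate, number k, stands before the parameters. It is moved
    to the end, number y, so that everything else is numbered as in \<open>a @ c\<close>.\<close>
  define f where "f i = (if i < k then i else if i = k then y else i - 1)" for i
  have f: "i < Suc k + length c \<Longrightarrow> f i < Suc y" for i
    by (auto simp: f_def y_def)
  have "Ex y (ren f p) \<in> fmls L (k + length c)"
    using holds_ren(1)[where f = f, OF p f] by (force simp: fmls_def y_def)
  with c have "definable L M B k {a\<in>tuples (carrier M) k. holds M (Ex y (ren f p)) (a @ c)}"
    by (intro definableI)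
  also have "{a\<in>tuples (carrier M) k. holds M (Ex y (ren f p)) (a @ c)}
      = {a\<in>tuples (carrier M) k. \<exists>z\<in>carrier M. a @ [z] \<in> X}"
  proof -
    have "sat M (((!) (a @ c))(y := z)) (ren f p) \<longleftrightarrow> a @ [z] \<in> X"
      if a: "a \<in> tuples (carrier M) k" and z: "z \<in> carrier M" for a z
    proof -
      have "sat M (((!) (a @ c))(y := z)) (ren f p) \<longleftrightarrow> sat M (((!) (a @ c))(y := z) \<circ> f) p"
        by (rule sat_ren)
      also have "\<dots> \<longleftrightarrow> sat M ((!) ((a @ [z]) @ c)) p"
      proof (rule sat_cong)
        fix x assume "x \<in> fv p"
        then have "x < Suc k + length c" using p by (auto simp: fmls_def)
        then show "(((!) (a @ c))(y := z) \<circ> f) x = ((a @ [z]) @ c) ! x"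
          using a by (auto simp: f_def y_def nth_append tuples_def nth_Cons')
      qed
      also have "\<dots> \<longleftrightarrow> a @ [z] \<in> X"
        using a z by (auto simp: X holds_def tuples_def)
      finally show ?thesis .
    qed
    then show ?thesis by (auto simp: holds_def)
  qed
  finally show ?thesis .
qed

lemma definable_ex:
  assumes "definable L M B (k + j) X"
  shows "definable L M B k {a\<in>tuples (carrier M) k. \<exists>z\<in>tuples (carrier M) j. a @ z \<in> X}"
  using assms
proof (induction j arbitrary: X)
  case 0
  then have "{a\<in>tuples (carrier M) k. \<exists>z\<in>tuples (carrier M) 0. a @ z \<in> X} = X"
    using definable_subset[OF 0] by (auto simp: tuples_def)
  with 0 show ?case by simp
next
  case (Suc j)
  then have "definable L M B (k + j)
      {a\<in>tuples (carrier M) (k + j). \<exists>z\<in>carrier M. a @ [z] \<in> X}"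
    by (intro definable_ex1) simp
  from Suc.IH[OF this] have "definable L M B k {a\<in>tuples (carrier M) k. \<exists>z\<in>tuples (carrier M) j.
      a @ z \<in> {a\<in>tuples (carrier M) (k + j). \<exists>z\<in>carrier M. a @ [z] \<in> X}}" .
  also have "{a\<in>tuples (carrier M) k. \<exists>z\<in>tuples (carrier M) j.
      a @ z \<in> {a\<in>tuples (carrier M) (k + j). \<exists>z\<in>carrier M. a @ [z] \<in> X}} =
      {a\<in>tuples (carrier M) k. \<exists>z\<in>tuples (carrier M) (Suc j). a @ z \<in> X}" (is "?l = ?r")
  proof (intro equalityI subsetI)
    fix a assume "a \<in> ?l"
    then obtain z y where "a \<in> tuples (carrier M) k" "z \<in> tuples (carrier M) j"
      "y \<in> carrier M" "a @ z @ [y] \<in> X" by auto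
    moreover from this have "z @ [y] \<in> tuples (carrier M) (Suc j)" by (auto simp: tuples_def)
    ultimately show "a \<in> ?r" by blast
  next
    fix a assume "a \<in> ?r"
    then obtain z where a: "a \<in> tuples (carrier M) k" and z: "z \<in> tuples (carrier M) (Suc j)"
      and "a @ z \<in> X" by auto
    moreover from z obtain z' y where zy: "z = z' @ [y]" by (cases z rule: rev_cases) (auto simp: tuples_def)
    moreover from a z zy have "a @ z' \<in> tuples (carrier M) (k + j)" "y \<in> carrier M"
        "z' \<in> tuples (carrier M) j"
      by (auto simp: tuples_def)
    ultimately show "a \<in> ?l" by auto
  qed
  finally show ?case .
qed

lemma definable_inst:
  assumes "definable L M B (k + j) X" and c: "c \<in> tuples (carrier M \<inter> B') j"
  shows "definable L M (B \<union> B') k {a\<in>tuples (carrier M) k. a @ c \<in> X}"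
proof -
  obtain d p where d: "d \<in> lists B" and p: "p \<in> fmls L (k + j + length d)"
    and X: "X = {a\<in>tuples (carrier M) (k + j). holds M p (a @ d)}"
    using assms by (auto simp: definable_def)
  have "definable L M (B \<union> B') k {a\<in>tuples (carrier M) k. holds M p (a @ c @ d)}"
    using c d p by (intro definableI) (auto simp: tuples_def add.assoc)
  also have "{a\<in>tuples (carrier M) k. holds M p (a @ c @ d)} = {a\<in>tuples (carrier M) k. a @ c \<in> X}"
    using c by (auto simp: X tuples_def)
  finally show ?thesis .
qed

lemma definable_type_definable:
  assumes "definable L M B k X"
  shows "type_definable L M B k X"
proof -
  obtain c p where "c \<in> lists B" "p \<in> fmls L (k + length c)"
    "X = {a\<in>tuples (carrier M) k. holds M p (a @ c)}"
    using assms by (auto simp: definable_def)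
  then show ?thesis
    by (auto simp: type_definable_def param_fmls_def realizes_def intro!: exI[of _ "{(p, c)}"])
qed

section \<open>Type-definable sets as intersections of definable sets\<close>

lemma type_definable_iff:
  "type_definable L M B k X \<longleftrightarrow>
    (\<exists>\<X>. (\<forall>Z\<in>\<X>. definable L M B k Z) \<and> X = {a\<in>tuples (carrier M) k. \<forall>Z\<in>\<X>. a \<in> Z})"
proof
  assume "type_definable L M B k X"
  then obtain \<pi> where \<pi>: "\<pi> \<subseteq> param_fmls L k B" "X = {a\<in>tuples (carrier M) k. realizes M a \<pi>}"
    by (auto simp: type_definable_def)
  let ?X = "(\<lambda>(p, c). {a\<in>tuples (carrier M) k. holds M p (a @ c)}) ` \<pi>"
  have "\<forall>Z\<in>?X. definable L M B k Z"
    using \<pi>(1) by (auto simp: param_fmls_def definable_def)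
  moreover have "X = {a\<in>tuples (carrier M) k. \<forall>Z\<in>?X. a \<in> Z}"
    by (force simp: \<pi>(2) realizes_def)
  ultimately show "\<exists>\<X>. (\<forall>Z\<in>\<X>. definable L M B k Z) \<and> X = {a\<in>tuples (carrier M) k. \<forall>Z\<in>\<X>. a \<in> Z}"
    by blast
next
  assume "\<exists>\<X>. (\<forall>Z\<in>\<X>. definable L M B k Z) \<and> X = {a\<in>tuples (carrier M) k. \<forall>Z\<in>\<X>. a \<in> Z}"
  then obtain \<X> where def: "\<forall>Z\<in>\<X>. definable L M B k Z"
    and X: "X = {a\<in>tuples (carrier M) k. \<forall>Z\<in>\<X>. a \<in> Z}" by blast
  \<comment> \<open>All formulas that define a member of the family are taken, which avoids choosing
    one for each member.\<close>
  let ?P = "{(p, c). (p, c) \<in> param_fmls L k B \<and> {a\<in>tuples (carrier M) k. holds M p (a @ c)} \<in> \<X>}"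
  have "X = {a\<in>tuples (carrier M) k. realizes M a ?P}"
  proof (intro equalityI subsetI)
    fix a assume "a \<in> X"
    then show "a \<in> {a\<in>tuples (carrier M) k. realizes M a ?P}"
      by (auto simp: X realizes_def)
  next
    fix a assume a: "a \<in> {a\<in>tuples (carrier M) k. realizes M a ?P}"
    have "a \<in> Z" if "Z \<in> \<X>" for Z
    proof -
      obtain c p where "c \<in> lists B" "p \<in> fmls L (k + length c)"
        and Z: "Z = {a\<in>tuples (carrier M) k. holds M p (a @ c)}"
        using bspec[OF def \<open>Z \<in> \<X>\<close>] by (auto simp: definable_def)
      then have "(p, c) \<in> ?P" using that by (auto simp: param_fmls_def)
      with a show ?thesis by (auto simp: Z realizes_def)
    qed
    with a show "a \<in> X" by (auto simp: X)
  qed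
  then show "type_definable L M B k X"
    unfolding type_definable_def by (intro exI[of _ ?P]) auto
qed

lemma type_definable_subset: "type_definable L M B k X \<Longrightarrow> X \<subseteq> tuples (carrier M) k"
  by (auto simp: type_definable_def)

lemma type_definable_mono:
  assumes "type_definable L M B k X" and "B \<subseteq> B'"
  shows "type_definable L M B' k X"
proof -
  have "param_fmls L k B \<subseteq> param_fmls L k B'"
    using lists_mono[OF assms(2)] by (auto simp: param_fmls_def)
  with assms(1) show ?thesis
    unfolding type_definable_def by (elim exE conjE, intro exI conjI) (erule order_trans)
qed

lemma type_definable_INT:
  assumes "\<And>i. i \<in> I \<Longrightarrow> type_definable L M B k (X i)"
  shows "type_definable L M B k {a\<in>tuples (carrier M) k. \<forall>i\<in>I. a \<in> X i}"
proof -
  have "\<forall>i\<in>I. \<exists>\<X>. (\<forall>Z\<in>\<X>. definable L M B k Z) \<and> X i = {a\<in>tuples (carrier M) k. \<forall>Z\<in>\<X>. a \<in> Z}"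
    using assms by (simp add: type_definable_iff)
  from bchoice[OF this] obtain \<X> where \<X>: "\<forall>i\<in>I. (\<forall>Z\<in>\<X> i. definable L M B k Z) \<and> X i = {a\<in>tuples (carrier M) k. \<forall>Z\<in>\<X> i. a \<in> Z}"
    by (elim exE)
  have "a \<in> X i \<longleftrightarrow> (\<forall>Z\<in>\<X> i. a \<in> Z)" if "i \<in> I" "a \<in> tuples (carrier M) k" for i a
    using bspec[OF \<X> that(1)] that(2) by simp
  then have "{a\<in>tuples (carrier M) k. \<forall>i\<in>I. a \<in> X i}
      = {a\<in>tuples (carrier M) k. \<forall>Z\<in>(\<Union>i\<in>I. \<X> i). a \<in> Z}"
    by auto
  moreover have "\<forall>Z\<in>(\<Union>i\<in>I. \<X> i). definable L M B k Z"
    using \<X> by simp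
  ultimately show ?thesis
    unfolding type_definable_iff by blast
qed

lemma type_definable_Int:
  assumes "type_definable L M B k X" and "type_definable L M B k Y"
  shows "type_definable L M B k (X \<inter> Y)"
proof -
  have "type_definable L M B k {a\<in>tuples (carrier M) k. \<forall>i\<in>{X, Y}. a \<in> i}"
    using assms by (intro type_definable_INT) auto
  also have "{a\<in>tuples (carrier M) k. \<forall>i\<in>{X, Y}. a \<in> i} = X \<inter> Y"
    using assms[THEN type_definable_subset] by auto
  finally show ?thesis .
qed

lemma type_definable_pullback:
  assumes "type_definable L M B k X" and f: "\<And>i. i < k \<Longrightarrow> f i < K"
  shows "type_definable L M B K {a\<in>tuples (carrier M) K. map (\<lambda>i. a ! f i) [0..<k] \<in> X}"
proof -
  obtain \<X> where \<X>: "\<forall>Z\<in>\<X>. definable L M B k Z" and X: "X = {a\<in>tuples (carrier M) k. \<forall>Z\<in>\<X>. a \<in> Z}"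
    using assms(1) by (auto simp: type_definable_iff)
  have "type_definable L M B K {a\<in>tuples (carrier M) K. \<forall>Z\<in>\<X>.
      a \<in> {a\<in>tuples (carrier M) K. map (\<lambda>i. a ! f i) [0..<k] \<in> Z}}"
    using \<X> f by (intro type_definable_INT definable_type_definable definable_pullback) auto
  also have "{a\<in>tuples (carrier M) K. \<forall>Z\<in>\<X>. a \<in> {a\<in>tuples (carrier M) K. map (\<lambda>i. a ! f i) [0..<k] \<in> Z}}
      = {a\<in>tuples (carrier M) K. map (\<lambda>i. a ! f i) [0..<k] \<in> X}"
    using f by (auto simp: X tuples_def)
  finally show ?thesis .
qed

lemma type_definable_block:
  assumes "type_definable L M B k X" and "s + k \<le> K"
  shows "type_definable L M B K {a\<in>tuples (carrier M) K. take k (drop s a) \<in> X}"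
proof -
  have "type_definable L M B K {a\<in>tuples (carrier M) K. map (\<lambda>i. a ! (s + i)) [0..<k] \<in> X}"
    using assms by (intro type_definable_pullback) auto
  also have "{a\<in>tuples (carrier M) K. map (\<lambda>i. a ! (s + i)) [0..<k] \<in> X}
      = {a\<in>tuples (carrier M) K. take k (drop s a) \<in> X}"
    using assms by (auto simp: tuples_def map_nth_offset)
  finally show ?thesis .
qed

text \<open>The three blocks may be picked in any order, which is how the graph of multiplication is
  read as a statement about quotients.\<close>

lemma type_definable_block3:
  assumes "type_definable L M B (3 * k) X" and "r + k \<le> K" "s + k \<le> K" "t + k \<le> K"
  shows "type_definable L M B K
    {a\<in>tuples (carrier M) K. take k (drop r a) @ take k (drop s a) @ take k (drop t a) \<in> X}"
proof -
  define f where "f i = (if i < k then r + i else if i < 2 * k then s + (i - k) else t + (i - 2 * k))"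
    for i
  have "type_definable L M B K {a\<in>tuples (carrier M) K. map (\<lambda>i. a ! f i) [0..<3 * k] \<in> X}"
    using assms by (intro type_definable_pullback) (auto simp: f_def)
  moreover have "map (\<lambda>i. a ! f i) [0..<3 * k]
      = take k (drop r a) @ take k (drop s a) @ take k (drop t a)"
    if "a \<in> tuples (carrier M) K" for a
    using that assms by (intro nth_equalityI) (auto simp: f_def tuples_def nth_append mult_2)
  ultimately show ?thesis by (simp cong: conj_cong)
qed

text \<open>The compactness argument below needs a family directed downwards, so finite
  intersections are added; the empty one contributes the set of all tuples.\<close>

lemma type_definable_directed:
  assumes "type_definable L M B k X" and "carrier M \<noteq> {}"
  obtains \<X> where "\<And>Z. Z \<in> \<X> \<Longrightarrow> definable L M B k Z"
    and "tuples (carrier M) k \<in> \<X>" and "\<And>Y Z. Y \<in> \<X> \<Longrightarrow> Z \<in> \<X> \<Longrightarrow> Y \<inter> Z \<in> \<X>"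
    and "X = {a\<in>tuples (carrier M) k. \<forall>Z\<in>\<X>. a \<in> Z}"
proof -
  obtain \<X> where \<X>: "\<forall>Z\<in>\<X>. definable L M B k Z" and X: "X = {a\<in>tuples (carrier M) k. \<forall>Z\<in>\<X>. a \<in> Z}"
    using assms(1) by (auto simp: type_definable_iff)
  let ?g = "\<lambda>F. {a\<in>tuples (carrier M) k. \<forall>Z\<in>F. a \<in> Z}"
  let ?Y = "?g ` {F. finite F \<and> F \<subseteq> \<X>}"
  have 1: "definable L M B k Z" if Z: "Z \<in> ?Y" for Z
    using Z \<X> assms(2) by (auto intro!: definable_INT)
  have 2: "tuples (carrier M) k \<in> ?Y"
    by (rule image_eqI[of _ _ "{}"]) auto
  have 3: "Y \<inter> Z \<in> ?Y" if YZ: "Y \<in> ?Y" "Z \<in> ?Y" for Y Z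
  proof -
    from YZ obtain F E where "Y = ?g F" "Z = ?g E" "finite F" "F \<subseteq> \<X>" "finite E" "E \<subseteq> \<X>"
      by blast
    then have "finite (F \<union> E)" "F \<union> E \<subseteq> \<X>" "Y \<inter> Z = ?g (F \<union> E)" by auto
    then show ?thesis by blast
  qed
  have 4: "X = {a\<in>tuples (carrier M) k. \<forall>Z\<in>?Y. a \<in> Z}"
  proof (intro equalityI subsetI)
    fix a assume a: "a \<in> {a\<in>tuples (carrier M) k. \<forall>Z\<in>?Y. a \<in> Z}"
    have "a \<in> Z" if "Z \<in> \<X>" for Z
    proof -
      have "?g {Z} \<in> ?Y" using that by blast
      with a have "a \<in> ?g {Z}" by blast
      then show ?thesis by simp
    qed
    with a show "a \<in> X" by (auto simp: X)
  qed (auto simp: X)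
  from 1 2 3 4 show thesis by (rule that)
qed

lemma finite_ordLess_Card_order: "finite X \<Longrightarrow> Card_order r \<Longrightarrow> \<not> finite (Field r) \<Longrightarrow> |X| <o r"
  by (rule finite_ordLess_infinite)
    (simp_all add: card_order_on_well_order_on Field_card_of card_of_Well_order[unfolded Field_card_of])

lemma tuplesD: "a \<in> tuples S k \<Longrightarrow> length a = k" "a \<in> tuples S k \<Longrightarrow> set a \<subseteq> S"
  by (auto simp: tuples_def)

lemma tuples3: "a \<in> tuples S (3 * k) \<longleftrightarrow> (\<exists>x\<in>tuples S k. \<exists>y\<in>tuples S k. \<exists>z\<in>tuples S k. a = x @ y @ z)"
proof -
  have "a \<in> tuples S (k + (k + k)) \<longleftrightarrow> (\<exists>x\<in>tuples S k. \<exists>b\<in>tuples S (k + k). a = x @ b)"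
    by (rule tuples_append)
  also have "\<dots> \<longleftrightarrow> (\<exists>x\<in>tuples S k. \<exists>y\<in>tuples S k. \<exists>z\<in>tuples S k. a = x @ y @ z)"
  proof
    assume "\<exists>x\<in>tuples S k. \<exists>b\<in>tuples S (k + k). a = x @ b"
    then obtain x b where xb: "x \<in> tuples S k" "b \<in> tuples S (k + k)" "a = x @ b"
      by (elim bexE)
    from xb(2) obtain y z where "y \<in> tuples S k" "z \<in> tuples S k" "b = y @ z"
      unfolding tuples_append by (elim bexE)
    with xb show "\<exists>x\<in>tuples S k. \<exists>y\<in>tuples S k. \<exists>z\<in>tuples S k. a = x @ y @ z"
      by simp blast
  next
    assume "\<exists>x\<in>tuples S k. \<exists>y\<in>tuples S k. \<exists>z\<in>tuples S k. a = x @ y @ z"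
    then obtain x y z where "x \<in> tuples S k" "y \<in> tuples S k" "z \<in> tuples S k" "a = x @ y @ z"
      by (elim bexE)
    then show "\<exists>x\<in>tuples S k. \<exists>b\<in>tuples S (k + k). a = x @ b"
      by (intro bexI[of _ x] bexI[of _ "y @ z"]) (auto simp: tuples_def)
  qed
  finally show ?thesis by (simp add: numeral_3_eq_3)
qed

section \<open>Small sets, saturation and compactness in the monster model\<close>

locale monster =
  fixes L :: "('f, 'r) lang" and T :: "('f, 'r) fm set"
    and MM :: "('a, 'f, 'r) struct" and \<kappa> :: "'k rel"
  assumes complete: "complete_theory L T"
    and monster: "monster_model L T MM \<kappa>"
begin

abbreviation tup :: "nat \<Rightarrow> 'a list set" where "tup \<equiv> tuples (carrier MM)"

definition small :: "'a set \<Rightarrow> bool" where "small B \<longleftrightarrow> B \<subseteq> carrier MM \<and> |B| <o \<kappa>"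

lemma carrier_nonempty: "carrier MM \<noteq> {}"
  using monster by (auto simp: monster_model_def models_def is_struct_def)

lemma Card_order_kappa: "Card_order \<kappa>" and infinite_kappa: "\<not> finite (Field \<kappa>)"
  using monster
  by (auto simp: monster_model_def strongly_inaccessible_def infinite_regular_def cinfinite_def)

lemma finite_less_kappa: "finite X \<Longrightarrow> |X| <o \<kappa>"
  using Card_order_kappa infinite_kappa by (rule finite_ordLess_Card_order[rotated])

lemma Un_less_kappa: "|X| <o \<kappa> \<Longrightarrow> |Y| <o \<kappa> \<Longrightarrow> |X \<union> Y| <o \<kappa>"
  using card_of_Un_ordLess_infinite_Field[OF infinite_kappa Card_order_kappa] by blast

lemma small_Un: "small X \<Longrightarrow> small Y \<Longrightarrow> small (X \<union> Y)"
  by (simp add: small_def Un_less_kappa)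

lemma small_finite: "finite X \<Longrightarrow> X \<subseteq> carrier MM \<Longrightarrow> small X"
  by (simp add: small_def finite_less_kappa)

lemma small_mono: "small X \<Longrightarrow> Y \<subseteq> X \<Longrightarrow> small Y"
  unfolding small_def by (meson card_of_mono1 ordLeq_ordLess_trans subset_trans)

lemma small_UN_sets:
  assumes "|X| <o \<kappa>" and "X \<subseteq> tup k"
  shows "small (\<Union>x\<in>X. set x)"
proof -
  have "|\<Union>x\<in>X. set x| <o \<kappa>"
  proof (cases "finite X")
    case True
    then show ?thesis by (intro finite_less_kappa) auto
  next
    case False
    then have "\<forall>x\<in>X. |set x| \<le>o |X|"
      by (intro ballI ordLess_imp_ordLeq finite_ordLess_Card_order card_of_Card_order)
        (auto simp: Field_card_of)
    with False have "|\<Union>x\<in>X. set x| \<le>o |X|"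
      by (intro card_of_UNION_ordLeq_infinite ordLeq_refl card_of_Card_order)
    then show ?thesis using assms(1) by (rule ordLeq_ordLess_trans)
  qed
  then show ?thesis using assms(2) by (auto simp: small_def tuples_def)
qed

lemma saturation:
  assumes "small B" and def: "\<And>Z. Z \<in> \<X> \<Longrightarrow> definable L MM B k Z"
    and fip: "\<And>F. finite F \<Longrightarrow> F \<subseteq> \<X> \<Longrightarrow> \<exists>a\<in>tup k. \<forall>Z\<in>F. a \<in> Z"
  shows "\<exists>a\<in>tup k. \<forall>Z\<in>\<X>. a \<in> Z"
proof -
  let ?g = "\<lambda>(p, c). {a\<in>tup k. holds MM p (a @ c)}"
  define \<pi> where "\<pi> = {q \<in> param_fmls L k B. ?g q \<in> \<X>}"
  have "\<exists>a\<in>tup k. realizes MM a \<pi>0" if \<pi>0: "\<pi>0 \<subseteq> \<pi>" "finite \<pi>0" for \<pi>0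
  proof -
    have "finite (?g ` \<pi>0)" "?g ` \<pi>0 \<subseteq> \<X>"
      using \<pi>0 by (auto simp: \<pi>_def)
    from fip[OF this] obtain a where a: "a \<in> tup k" "\<forall>Z\<in>?g ` \<pi>0. a \<in> Z" by (rule bexE)
    then have "realizes MM a \<pi>0" by (auto simp: realizes_def)
    with a show ?thesis by blast
  qed
  moreover have "\<pi> \<subseteq> param_fmls L k B" by (auto simp: \<pi>_def)
  moreover have "saturated L MM \<kappa>" using monster by (simp add: monster_model_def)
  ultimately have "\<exists>a\<in>tup k. realizes MM a \<pi>"
    using \<open>small B\<close> saturated_def[THEN iffD1, rule_format, of L MM \<kappa> B \<pi> k]
    by (simp add: small_def)
  then obtain a where a: "a \<in> tup k" "realizes MM a \<pi>" by (rule bexE)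
  have "a \<in> Z" if Z: "Z \<in> \<X>" for Z
  proof -
    obtain c p where "c \<in> lists B" "p \<in> fmls L (k + length c)" "Z = ?g (p, c)"
      using def[OF Z] unfolding definable_def by (elim bexE) simp
    then have "(p, c) \<in> \<pi>" using Z by (auto simp: \<pi>_def param_fmls_def)
    with a \<open>Z = ?g (p, c)\<close> show ?thesis by (auto simp: realizes_def)
  qed
  with a show ?thesis by blast
qed

text \<open>If no single \<open>Z i\<close> worked, then P, all the \<open>Z i\<close> and the
  complement of Y would have the finite intersection property, because by directedness any finitely
  many \<open>Z i\<close> contain a further one. Saturation would give a point contradicting the
  implication.\<close>

lemma compactness:
  assumes "small B" and P: "type_definable L MM B k P" and "I \<noteq> {}"
    and Z: "\<And>i. i \<in> I \<Longrightarrow> definable L MM B k (Z i)"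
    and dir: "\<And>i j. i \<in> I \<Longrightarrow> j \<in> I \<Longrightarrow> \<exists>l\<in>I. Z l \<subseteq> Z i \<inter> Z j"
    and Y: "definable L MM B k Y"
    and imp: "\<And>a. a \<in> P \<Longrightarrow> (\<And>i. i \<in> I \<Longrightarrow> a \<in> Z i) \<Longrightarrow> a \<in> Y"
  obtains i where "i \<in> I" and "\<And>a. a \<in> P \<Longrightarrow> a \<in> Z i \<Longrightarrow> a \<in> Y"
proof (rule ccontr)
  assume "\<not> thesis"
  with that have no: "\<exists>a\<in>P. a \<in> Z i \<and> a \<notin> Y" if "i \<in> I" for i
    using \<open>i \<in> I\<close> by blast
  obtain \<P> where \<P>: "\<forall>Z\<in>\<P>. definable L MM B k Z" and P_eq: "P = {a\<in>tup k. \<forall>Z\<in>\<P>. a \<in> Z}"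
    using P by (auto simp: type_definable_iff)
  have low: "\<exists>l\<in>I. \<forall>j\<in>J. Z l \<subseteq> Z j" if "finite J" "J \<subseteq> I" for J
    using that
  proof (induction J rule: finite_induct)
    case empty
    then show ?case using \<open>I \<noteq> {}\<close> by blast
  next
    case (insert j J)
    then obtain l where l: "l \<in> I" "\<forall>j\<in>J. Z l \<subseteq> Z j" by auto
    from insert dir[of j l] l obtain m where "m \<in> I" "Z m \<subseteq> Z j \<inter> Z l" by auto
    with l show ?case by (intro bexI[of _ m]) auto
  qed
  have "\<exists>a\<in>tup k. \<forall>W\<in>\<P> \<union> Z ` I \<union> {tup k - Y}. a \<in> W"
  proof (rule saturation[OF \<open>small B\<close>])
    fix W assume "W \<in> \<P> \<union> Z ` I \<union> {tup k - Y}"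
    then show "definable L MM B k W"
      using \<P> Z definable_compl[OF Y] by blast
  next
    fix F assume F: "finite F" "F \<subseteq> \<P> \<union> Z ` I \<union> {tup k - Y}"
    then have "finite (F \<inter> Z ` I)" "F \<inter> Z ` I \<subseteq> Z ` I" by auto
    from finite_subset_image[OF this] obtain J where J: "J \<subseteq> I" "finite J" "F \<inter> Z ` I = Z ` J"
      by (elim exE conjE)
    from low[OF J(2,1)] obtain l where l: "l \<in> I" "\<forall>j\<in>J. Z l \<subseteq> Z j" by (elim bexE)
    from no[OF l(1)] obtain a where a: "a \<in> P" "a \<in> Z l" "a \<notin> Y" by blast
    have "a \<in> W" if "W \<in> F" for W
    proof -
      have "W \<in> \<P> \<or> W \<in> F \<inter> Z ` I \<or> W = tup k - Y" using that F(2) by auto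
      then consider "W \<in> \<P>" | "W \<in> Z ` J" | "W = tup k - Y" unfolding J(3) by (elim disjE)
      then show ?thesis using a l by cases (auto simp: P_eq)
    qed
    with a show "\<exists>a\<in>tup k. \<forall>W\<in>F. a \<in> W" by (auto simp: P_eq)
  qed
  then obtain a where "a \<in> P" "\<forall>i\<in>I. a \<in> Z i" "a \<notin> Y"
    by (auto simp: P_eq)
  with imp show False by blast
qed

end

section \<open>Type-definable groups\<close>

text \<open>A set X of representatives replaces the set of cosets. In this form the condition is
  transported by automorphisms and turned into a finite cover by compactness.\<close>

lemma (in group) bounded_index_iff:
  assumes "subgroup H G"
  shows "bounded_index \<kappa> G H \<longleftrightarrow> (\<exists>X\<subseteq>carrier G. |X| <o \<kappa> \<and> (\<forall>g\<in>carrier G. \<exists>x\<in>X. g \<otimes> inv x \<in> H))"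
proof
  interpret H: subgroup H G by fact
  assume b: "bounded_index \<kappa> G H"
  let ?r = "\<lambda>K. SOME x. x \<in> K"
  have r: "?r (H #> g) \<in> H #> g" if "g \<in> carrier G" for g
    using rcos_self[OF that assms] by (rule someI)
  have sub: "H #> g \<subseteq> carrier G" if "g \<in> carrier G" for g
    using r_coset_subset_G[OF H.subset that] .
  show "\<exists>X\<subseteq>carrier G. |X| <o \<kappa> \<and> (\<forall>g\<in>carrier G. \<exists>x\<in>X. g \<otimes> inv x \<in> H)"
  proof (intro exI conjI ballI)
    show "?r ` (rcosets H) \<subseteq> carrier G"
      using r sub by (auto simp: RCOSETS_def)
    show "|?r ` (rcosets H)| <o \<kappa>"
      using b card_of_image ordLeq_ordLess_trans unfolding bounded_index_def by blast
  next
    fix g assume g: "g \<in> carrier G"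
    from r[OF g] obtain h where h: "h \<in> H" "?r (H #> g) = h \<otimes> g"
      by (auto simp: r_coset_def)
    then have "g \<otimes> inv (?r (H #> g)) = inv h"
      using g by (simp add: inv_mult_group m_assoc[symmetric])
    then have "g \<otimes> inv (?r (H #> g)) \<in> H" using h by simp
    moreover have "H #> g \<in> rcosets H" using g by (auto simp: RCOSETS_def)
    ultimately show "\<exists>x\<in>?r ` (rcosets H). g \<otimes> inv x \<in> H" by blast
  qed
next
  interpret H: subgroup H G by fact
  assume "\<exists>X\<subseteq>carrier G. |X| <o \<kappa> \<and> (\<forall>g\<in>carrier G. \<exists>x\<in>X. g \<otimes> inv x \<in> H)"
  then obtain X where X: "X \<subseteq> carrier G" "|X| <o \<kappa>" "\<forall>g\<in>carrier G. \<exists>x\<in>X. g \<otimes> inv x \<in> H"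
    by blast
  have "rcosets H \<subseteq> (\<lambda>x. H #> x) ` X"
  proof
    fix K assume "K \<in> rcosets H"
    then obtain g where g: "g \<in> carrier G" "K = H #> g" by (auto simp: RCOSETS_def)
    with X obtain x where x: "x \<in> X" "g \<otimes> inv x \<in> H" by blast
    have "g = (g \<otimes> inv x) \<otimes> x" using g x X(1) by (auto simp: m_assoc)
    then have "g \<in> H #> x" using x by (auto simp: r_coset_def)
    then have "H #> x = H #> g"
      using repr_independence[OF _ _ assms] x X(1) by blast
    with g x show "K \<in> (\<lambda>x. H #> x) ` X" by blast
  qed
  then have "|rcosets H| \<le>o |X|"
    by (meson card_of_image card_of_mono1 ordLeq_transitive)
  with X(2) show "bounded_index \<kappa> G H"
    unfolding bounded_index_def by (rule ordLeq_ordLess_trans[rotated])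
qed

lemma (in group) bounded_index_mono:
  assumes "subgroup H G" "subgroup K G" "H \<subseteq> K" "bounded_index \<kappa> G H"
  shows "bounded_index \<kappa> G K"
proof -
  obtain X where "X \<subseteq> carrier G" "|X| <o \<kappa>" "\<forall>g\<in>carrier G. \<exists>x\<in>X. g \<otimes> inv x \<in> H"
    using assms(4) unfolding bounded_index_iff[OF assms(1)] by (elim exE conjE)
  with assms(3) have "\<forall>g\<in>carrier G. \<exists>x\<in>X. g \<otimes> inv x \<in> K" by fast
  with \<open>X \<subseteq> carrier G\<close> \<open>|X| <o \<kappa>\<close> show ?thesis
    unfolding bounded_index_iff[OF assms(2)] by (intro exI conjI)
qed

locale monster_group = monster L T MM \<kappa>
  for L :: "('f, 'r) lang" and T :: "('f, 'r) fm set"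
    and MM :: "('a, 'f, 'r) struct" and \<kappa> :: "'k rel" +
  fixes A :: "'a set" and k :: nat and G :: "('a list, 'z) monoid_scheme" (structure)
  assumes small_A: "small A" and tdg: "type_definable_group L MM A k G"
begin

sublocale group G
  using tdg by (simp add: type_definable_group_def)

lemma type_definable_carrier: "A \<subseteq> B \<Longrightarrow> type_definable L MM B k (carrier G)"
  using tdg type_definable_mono by (auto simp: type_definable_group_def)

lemma carrier_tup: "carrier G \<subseteq> tup k"
  using type_definable_carrier[OF subset_refl] by (rule type_definable_subset)

lemma carrier_length: "x \<in> carrier G \<Longrightarrow> length x = k"
  using carrier_tup by (auto simp: tuples_def)

definition graph :: "'a list set" where
  "graph = {x @ y @ (x \<otimes> y) | x y. x \<in> carrier G \<and> y \<in> carrier G}"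

lemma type_definable_graph: "A \<subseteq> B \<Longrightarrow> type_definable L MM B (3 * k) graph"
  using tdg type_definable_mono by (auto simp: type_definable_group_def graph_def)

lemma graph_iff:
  assumes "x \<in> tup k" "y \<in> tup k" "z \<in> tup k"
  shows "x @ y @ z \<in> graph \<longleftrightarrow> x \<in> carrier G \<and> y \<in> carrier G \<and> z = x \<otimes> y"
  using assms by (auto simp: graph_def tuples_def carrier_length)

text \<open>The group is given through the graph of its multiplication, so a quotient is expressed
  as z times y being x. Here z is an arbitrary tuple; the graph forces it into G.\<close>

lemma graph_div_iff:
  assumes "z \<in> tup k" "y \<in> carrier G" "x \<in> carrier G"
  shows "z @ y @ x \<in> graph \<longleftrightarrow> z = x \<otimes> inv y"
  using assms carrier_tup
  by (subst graph_iff) (auto simp: m_assoc)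

text \<open>Quotients of elements of H lie in H, hence in V, and compactness finds one member of the
  directed family that can take the place of H. As multiplication is only type-definable, the
  quotient is carried along as a third block and the graph becomes part of the type-definable set
  P.\<close>

lemma division_refinement:
  assumes B: "small B" "A \<subseteq> B" and H: "subgroup H G"
    and \<H>: "\<And>Z. Z \<in> \<H> \<Longrightarrow> definable L MM B k Z" "\<H> \<noteq> {}"
      "\<And>Y Z. Y \<in> \<H> \<Longrightarrow> Z \<in> \<H> \<Longrightarrow> Y \<inter> Z \<in> \<H>" "H = {a\<in>tup k. \<forall>Z\<in>\<H>. a \<in> Z}"
    and V: "definable L MM B k V" "H \<subseteq> V"
  obtains W where "W \<in> \<H>" and "\<And>x y. x \<in> carrier G \<Longrightarrow> y \<in> carrier G \<Longrightarrow> x \<in> W \<Longrightarrow> y \<in> W \<Longrightarrow> x \<otimes> inv y \<in> V"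
proof -
  \<comment> \<open>\<open>?b i a\<close> is the i-th block of length k; the blocks of a are x, y
    and their quotient.\<close>
  let ?b = "\<lambda>i a. take k (drop (i * k) a)"
  define P where "P = {a\<in>tup (3 * k). ?b 0 a \<in> carrier G} \<inter> {a\<in>tup (3 * k). ?b 1 a \<in> carrier G} \<inter>
    {a\<in>tup (3 * k). ?b 2 a @ ?b 1 a @ ?b 0 a \<in> graph}"
  define Z where "Z W = {a\<in>tup (3 * k). ?b 0 a \<in> W} \<inter> {a\<in>tup (3 * k). ?b 1 a \<in> W}" for W
  define Y where "Y = {a\<in>tup (3 * k). ?b 2 a \<in> V}"
  obtain W where W: "W \<in> \<H>" "\<And>a. a \<in> P \<Longrightarrow> a \<in> Z W \<Longrightarrow> a \<in> Y"
  proof (rule compactness[OF B(1)])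
    show "type_definable L MM B (3 * k) P"
      unfolding P_def using type_definable_carrier[OF B(2)] type_definable_graph[OF B(2)]
      by (intro type_definable_Int type_definable_block type_definable_block3) auto
    show "definable L MM B (3 * k) (Z W)" if "W \<in> \<H>" for W
      unfolding Z_def using that \<H> by (intro definable_Int definable_block) auto
    show "definable L MM B (3 * k) Y"
      unfolding Y_def using V by (intro definable_block) auto
    show "\<exists>l\<in>\<H>. Z l \<subseteq> Z i \<inter> Z j" if "i \<in> \<H>" "j \<in> \<H>" for i j
      using \<H>(3)[OF that] by (intro bexI[of _ "i \<inter> j"]) (auto simp: Z_def)
    show "a \<in> Y" if aP: "a \<in> P" and aZ: "\<And>i. i \<in> \<H> \<Longrightarrow> a \<in> Z i" for a
    proof -
      from aP have "a \<in> tup (3 * k)" by (simp add: P_def)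
      then obtain x y z where xyz: "x \<in> tup k" "y \<in> tup k" "z \<in> tup k" and a: "a = x @ y @ z"
        unfolding tuples3 by blast
      note len = xyz[THEN tuplesD(1)]
      have xy: "x \<in> carrier G" "y \<in> carrier G" and g: "z @ y @ x \<in> graph"
        using aP len by (simp_all add: P_def a)
      have "x \<in> W \<and> y \<in> W" if "W \<in> \<H>" for W
        using aZ[OF that] len by (simp add: Z_def a)
      then have "x \<in> H" "y \<in> H" using xyz \<H>(4) by auto
      then have "x \<otimes> inv y \<in> V"
        using subgroup.m_closed[OF H] subgroup.m_inv_closed[OF H] V(2) by blast
      moreover have "z = x \<otimes> inv y" using g graph_div_iff xyz xy by blast
      ultimately show ?thesis using \<open>a \<in> tup (3 * k)\<close> len by (simp add: Y_def a)
    qed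
  qed (use \<H> in auto)
  moreover have "x \<otimes> inv y \<in> V"
    if xy: "x \<in> carrier G" "y \<in> carrier G" "x \<in> W" "y \<in> W" for x y
  proof -
    define z where "z = x \<otimes> inv y"
    have z: "z \<in> carrier G" using xy by (simp add: z_def)
    have t: "x @ y @ z \<in> tup (3 * k)"
      unfolding tuples3 using xy z carrier_tup by blast
    have "z @ y @ x \<in> graph" using graph_div_iff xy z carrier_tup z_def by blast
    then have "x @ y @ z \<in> P" "x @ y @ z \<in> Z W"
      using t xy z by (simp_all add: P_def Z_def carrier_length)
    then have "x @ y @ z \<in> Y" by (rule W(2))
    then show ?thesis using xy z by (simp add: Y_def carrier_length z_def)
  qed
  ultimately show thesis using that by blast
qed

text \<open>Were \<open>g \<otimes> inv x \<in> V\<close> a definable relation, compactness applied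
  to a small set of representatives for H would finish at once. It need not be definable, so a
  definable relation \<open>\<theta>\<close> is interpolated: on G it holds whenever the quotient
  lies in H, and it implies that the quotient lies in V.\<close>

lemma finite_cover:
  assumes B: "small B" "A \<subseteq> B" and H: "subgroup H G" "type_definable L MM B k H" "bounded_index \<kappa> G H"
    and V: "definable L MM B k V" "H \<subseteq> V"
  obtains X where "finite X" "X \<subseteq> carrier G" "\<And>g. g \<in> carrier G \<Longrightarrow> \<exists>x\<in>X. g \<otimes> inv x \<in> V"
proof -
  let ?b = "\<lambda>i a. take k (drop (i * k) a)"
  \<comment> \<open>Triples g, x, z such that z is the quotient of g by x and lies in H.\<close>
  define Q where "Q = {a\<in>tup (3 * k). ?b 2 a @ ?b 1 a @ ?b 0 a \<in> graph} \<inter> {a\<in>tup (3 * k). ?b 2 a \<in> H}"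
  have "type_definable L MM B (3 * k) Q"
    unfolding Q_def using type_definable_graph[OF B(2)] H
    by (intro type_definable_Int type_definable_block type_definable_block3) auto
  then obtain \<R> where \<R>: "\<And>Z. Z \<in> \<R> \<Longrightarrow> definable L MM B (3 * k) Z" "tup (3 * k) \<in> \<R>"
      "\<And>Y Z. Y \<in> \<R> \<Longrightarrow> Z \<in> \<R> \<Longrightarrow> Y \<inter> Z \<in> \<R>" "Q = {a\<in>tup (3 * k). \<forall>Z\<in>\<R>. a \<in> Z}"
    by (rule type_definable_directed[OF _ carrier_nonempty]) (rule that, simp_all)
  \<comment> \<open>The fourth block w is the true quotient. It is kept apart from the third block z
    so that the conclusion about w does not depend on z, which can then be quantified away.\<close>
  define P where "P = {a\<in>tup (4 * k). ?b 0 a \<in> carrier G} \<inter> {a\<in>tup (4 * k). ?b 1 a \<in> carrier G} \<inter>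
    {a\<in>tup (4 * k). ?b 3 a @ ?b 1 a @ ?b 0 a \<in> graph}"
  define Z where "Z R = {a\<in>tup (4 * k). take (3 * k) (drop 0 a) \<in> R}" for R
  define Y where "Y = {a\<in>tup (4 * k). ?b 3 a \<in> V}"
  have tup4: "a \<in> tup (4 * k) \<longleftrightarrow> (\<exists>c\<in>tup (3 * k). \<exists>w\<in>tup k. a = c @ w)" for a
    using tuples_append[of a "carrier MM" "3 * k" k] by simp
  obtain R where R: "R \<in> \<R>" "\<And>a. a \<in> P \<Longrightarrow> a \<in> Z R \<Longrightarrow> a \<in> Y"
  proof (rule compactness[OF B(1)])
    show "type_definable L MM B (4 * k) P"
      unfolding P_def using type_definable_carrier[OF B(2)] type_definable_graph[OF B(2)]
      by (intro type_definable_Int type_definable_block type_definable_block3) auto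
    show "definable L MM B (4 * k) (Z W)" if "W \<in> \<R>" for W
      unfolding Z_def using that \<R> by (intro definable_block) auto
    show "definable L MM B (4 * k) Y"
      unfolding Y_def using V by (intro definable_block) auto
    show "\<exists>l\<in>\<R>. Z l \<subseteq> Z i \<inter> Z j" if "i \<in> \<R>" "j \<in> \<R>" for i j
      using \<R>(3)[OF that] by (intro bexI[of _ "i \<inter> j"]) (auto simp: Z_def)
    show "a \<in> Y" if aP: "a \<in> P" and aZ: "\<And>i. i \<in> \<R> \<Longrightarrow> a \<in> Z i" for a
    proof -
      from aP have a4: "a \<in> tup (4 * k)" by (simp add: P_def)
      then obtain c w where w': "w \<in> tup k" and c: "c \<in> tup (3 * k)" and acw: "a = c @ w"
        unfolding tup4 by (elim bexE)
      from c obtain g x z where c_eq: "g \<in> tup k" "x \<in> tup k" "z \<in> tup k" "c = g @ x @ z"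
        unfolding tuples3 by (elim bexE)
      note xyz = c_eq(1-3) w' and a = acw[unfolded c_eq(4)]
      note len = xyz[THEN tuplesD(1)]
      have xy: "g \<in> carrier G" "x \<in> carrier G" and w: "w @ x @ g \<in> graph"
        using aP len by (simp_all add: P_def a)
      have "g @ x @ z \<in> R" if "R \<in> \<R>" for R
        using aZ[OF that] len by (simp add: Z_def a)
      moreover have "g @ x @ z \<in> tup (3 * k)" unfolding tuples3 using xyz by blast
      ultimately have "g @ x @ z \<in> Q" using \<R>(4) by blast
      then have "z \<in> H" "z @ x @ g \<in> graph" using len by (simp_all add: Q_def)
      moreover have "w = g \<otimes> inv x" using w graph_div_iff xyz xy by blast
      moreover have "z = g \<otimes> inv x"
        using \<open>z @ x @ g \<in> graph\<close> graph_div_iff xyz xy by blast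
      ultimately have "w \<in> V" using V by blast
      then show ?thesis using a4 len by (simp add: Y_def a)
    qed
  qed (use \<R> in auto)
  have RV: "g \<otimes> inv x \<in> V"
    if "g \<in> carrier G" "x \<in> carrier G" "z \<in> tup k" "g @ x @ z \<in> R" for g x z
  proof -
    define w where "w = g \<otimes> inv x"
    have w: "w \<in> carrier G" using that by (simp add: w_def)
    have "g @ x @ z \<in> tup (3 * k)"
      unfolding tuples3 using that carrier_tup by blast
    then have t: "(g @ x @ z) @ w \<in> tup (4 * k)"
      unfolding tup4 using w carrier_tup by blast
    have "w @ x @ g \<in> graph" using graph_div_iff that w carrier_tup w_def by blast
    then have "(g @ x @ z) @ w \<in> P" "(g @ x @ z) @ w \<in> Z R"
      using t that w by (simp_all add: P_def Z_def carrier_length tuplesD)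
    then have "(g @ x @ z) @ w \<in> Y" by (rule R(2))
    then show ?thesis using that w by (simp add: Y_def carrier_length w_def tuplesD)
  qed
  have HR: "g @ x @ (g \<otimes> inv x) \<in> R"
    if "g \<in> carrier G" "x \<in> carrier G" "g \<otimes> inv x \<in> H" for g x
  proof -
    define z where "z = g \<otimes> inv x"
    have z: "z \<in> carrier G" using that by (simp add: z_def)
    have "g @ x @ z \<in> tup (3 * k)"
      unfolding tuples3 using that z carrier_tup by blast
    moreover have "z @ x @ g \<in> graph" using graph_div_iff that z carrier_tup z_def by blast
    ultimately have "g @ x @ z \<in> Q" using that z by (simp add: Q_def carrier_length z_def)
    then show ?thesis using \<R>(4) R(1) by (auto simp: z_def)
  qed
  define \<theta> where "\<theta> = {a\<in>tup (k + k). \<exists>z\<in>tup k. a @ z \<in> R}"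
  have \<theta>: "definable L MM B (k + k) \<theta>"
    unfolding \<theta>_def using \<R>(1)[OF R(1)] by (intro definable_ex) (simp add: numeral_3_eq_3 add.assoc)
  obtain X where X: "X \<subseteq> carrier G" "|X| <o \<kappa>" "\<forall>g\<in>carrier G. \<exists>x\<in>X. g \<otimes> inv x \<in> H"
    using H(3) bounded_index_iff[OF H(1)] by blast
  define B' where "B' = B \<union> (\<Union>x\<in>X. set x)"
  have X_tup: "X \<subseteq> tup k" using X(1) carrier_tup by blast
  have B': "small B'" "A \<subseteq> B'"
    unfolding B'_def using B small_Un small_UN_sets[OF X(2) X_tup] by auto
  \<comment> \<open>The elements that \<open>\<theta>\<close> relates to no member of F. Compactness
    with conclusion \<open>{}\<close> gives a finite F that leaves nothing of G uncovered.\<close>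
  define Z' where "Z' F = {g\<in>tup k. \<forall>x\<in>F. g \<in> tup k - {g\<in>tup k. g @ x \<in> \<theta>}}" for F
  obtain F where F: "F \<in> {F. finite F \<and> F \<subseteq> X}" "\<And>g. g \<in> carrier G \<Longrightarrow> g \<in> Z' F \<Longrightarrow> g \<in> {}"
  proof (rule compactness[OF B'(1) type_definable_carrier[OF B'(2)]])
    show "definable L MM B' k (Z' F)" if "F \<in> {F. finite F \<and> F \<subseteq> X}" for F
      unfolding Z'_def
    proof (intro definable_INT definable_compl)
      fix x assume "x \<in> F"
      then have x: "x \<in> X" using that by auto
      then have "x \<in> tuples (carrier MM \<inter> set x) k" using X_tup by (auto simp: tuples_def)
      from definable_mono[OF definable_inst[OF \<theta> this], of B'] x
      show "definable L MM B' k {g\<in>tup k. g @ x \<in> \<theta>}" by (auto simp: B'_def)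
    qed (use that carrier_nonempty in auto)
    show "definable L MM B' k {}" by (rule definable_empty[OF carrier_nonempty])
    show "\<exists>l\<in>{F. finite F \<and> F \<subseteq> X}. Z' l \<subseteq> Z' i \<inter> Z' j"
      if "i \<in> {F. finite F \<and> F \<subseteq> X}" "j \<in> {F. finite F \<and> F \<subseteq> X}" for i j
      using that by (intro bexI[of _ "i \<union> j"]) (auto simp: Z'_def)
    show "g \<in> {}" if g: "g \<in> carrier G" and all: "\<And>i. i \<in> {F. finite F \<and> F \<subseteq> X} \<Longrightarrow> g \<in> Z' i" for g
    proof -
      from X(3) g obtain x where x: "x \<in> X" "g \<otimes> inv x \<in> H" by blast
      have "g @ x \<in> tup (k + k)" using g x X_tup carrier_tup unfolding tuples_append by blast
      moreover have "(g @ x) @ (g \<otimes> inv x) \<in> R" using HR[OF g _ x(2)] X(1) x(1) by auto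
      moreover have "g \<otimes> inv x \<in> tup k" using x(2) subgroup.subset[OF H(1)] carrier_tup by blast
      ultimately have "g @ x \<in> \<theta>" by (auto simp: \<theta>_def)
      with all[of "{x}"] x g show ?thesis by (auto simp: Z'_def)
    qed
  qed auto
  have "\<exists>x\<in>F. g \<otimes> inv x \<in> V" if g: "g \<in> carrier G" for g
  proof -
    have "g \<notin> Z' F" using F(2)[OF g] by blast
    then obtain x where x: "x \<in> F" "g @ x \<in> \<theta>" using g carrier_tup by (auto simp: Z'_def)
    then obtain z where "z \<in> tup k" "g @ x @ z \<in> R" by (auto simp: \<theta>_def)
    with RV[OF g] x F(1) X(1) show ?thesis by blast
  qed
  with F(1) X(1) show thesis by (intro that[of F]) auto
qed

text \<open>\<open>V\<close> replaces \<open>H\<close> by a larger subgroup that is cut out of \<open>G\<close> by countably many definable sets.\<close>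

lemma filtration:
  assumes B: "small B" "A \<subseteq> B" and H: "subgroup H G" "type_definable L MM B k H" "bounded_index \<kappa> G H"
    and g: "g \<in> carrier G" "g \<notin> H"
  obtains V N where "\<And>r. definable L MM B k (V r)" "\<And>r. H \<subseteq> V r" "g \<notin> V 0"
    "\<And>r x y. x \<in> carrier G \<Longrightarrow> y \<in> carrier G \<Longrightarrow> x \<in> V (Suc r) \<Longrightarrow> y \<in> V (Suc r) \<Longrightarrow> x \<otimes> inv y \<in> V r"
    "\<And>r f. (\<And>i. i < N r \<Longrightarrow> f i \<in> carrier G) \<Longrightarrow> \<exists>i j. i < j \<and> j < (N r :: nat) \<and> f i \<otimes> inv (f j) \<in> V r"
proof -
  obtain \<H> where \<H>: "\<And>Z. Z \<in> \<H> \<Longrightarrow> definable L MM B k Z" "tup k \<in> \<H>"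
      "\<And>Y Z. Y \<in> \<H> \<Longrightarrow> Z \<in> \<H> \<Longrightarrow> Y \<inter> Z \<in> \<H>" "H = {a\<in>tup k. \<forall>Z\<in>\<H>. a \<in> Z}"
    by (rule type_definable_directed[OF H(2) carrier_nonempty]) (rule that, simp_all)
  have HZ: "H \<subseteq> Z" if "Z \<in> \<H>" for Z using that \<H>(4) by auto
  obtain V0 where V0: "V0 \<in> \<H>" "g \<notin> V0" using g \<H>(4) carrier_tup by auto
  \<comment> \<open>The sequence starts with a member that omits g and is refined by
    \<open>division_refinement\<close>. All terms come from the directed family, so they contain
    H.\<close>
  have "\<exists>V. \<forall>r. (V r \<in> \<H> \<and> (r = 0 \<longrightarrow> g \<notin> V r)) \<and>
      (\<forall>x\<in>carrier G. \<forall>y\<in>carrier G. x \<in> V (Suc r) \<longrightarrow> y \<in> V (Suc r) \<longrightarrow> x \<otimes> inv y \<in> V r)"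
  proof (rule dependent_nat_choice)
    show "\<exists>x. x \<in> \<H> \<and> (0 = 0 \<longrightarrow> g \<notin> x)" using V0 by blast
    fix V and r :: nat assume "V \<in> \<H> \<and> (r = 0 \<longrightarrow> g \<notin> V)"
    then have "V \<in> \<H>" by blast
    obtain W where "W \<in> \<H>" "\<And>x y. x \<in> carrier G \<Longrightarrow> y \<in> carrier G \<Longrightarrow> x \<in> W \<Longrightarrow> y \<in> W \<Longrightarrow> x \<otimes> inv y \<in> V"
      using division_refinement[OF B H(1) \<H>(1) _ \<H>(3,4) \<H>(1)[OF \<open>V \<in> \<H>\<close>] HZ[OF \<open>V \<in> \<H>\<close>]] \<H>(2) by blast
    then show "\<exists>y. (y \<in> \<H> \<and> (Suc r = 0 \<longrightarrow> g \<notin> y)) \<and>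
        (\<forall>xa\<in>carrier G. \<forall>ya\<in>carrier G. xa \<in> y \<longrightarrow> ya \<in> y \<longrightarrow> xa \<otimes> inv ya \<in> V)" by blast
  qed
  then obtain V where V: "\<And>r. V r \<in> \<H>" "g \<notin> V 0"
    "\<And>r x y. x \<in> carrier G \<Longrightarrow> y \<in> carrier G \<Longrightarrow> x \<in> V (Suc r) \<Longrightarrow> y \<in> V (Suc r) \<Longrightarrow> x \<otimes> inv y \<in> V r"
    by blast
  have "\<exists>N :: nat. \<forall>f. (\<forall>i<N. f i \<in> carrier G) \<longrightarrow> (\<exists>i j. i < j \<and> j < N \<and> f i \<otimes> inv (f j) \<in> V r)" for r
  proof -
    \<comment> \<open>The cover is taken one level deeper, so that two elements close to the same x
      have a quotient at level r. The pigeonhole principle then needs \<open>Suc (card X)\<close>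
      elements.\<close>
    obtain X where X: "finite X" "X \<subseteq> carrier G" "\<And>g. g \<in> carrier G \<Longrightarrow> \<exists>x\<in>X. g \<otimes> inv x \<in> V (Suc r)"
      using finite_cover[OF B H \<H>(1)[OF V(1)] HZ[OF V(1)]] by metis
    have "\<exists>i j. i < j \<and> j < Suc (card X) \<and> f i \<otimes> inv (f j) \<in> V r"
      if f: "\<forall>i<Suc (card X). f i \<in> carrier G" for f
    proof -
      from f X(3) have "\<forall>i\<in>{..<Suc (card X)}. \<exists>x. x \<in> X \<and> f i \<otimes> inv x \<in> V (Suc r)" by blast
      then obtain c where c: "\<And>i. i < Suc (card X) \<Longrightarrow> c i \<in> X \<and> f i \<otimes> inv (c i) \<in> V (Suc r)"
        by (metis lessThan_iff)
      have "card (c ` {..<Suc (card X)}) \<le> card X"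
        using c by (intro card_mono X(1)) auto
      then have "\<not> inj_on c {..<Suc (card X)}"
        using card_image[of c "{..<Suc (card X)}"] by auto
      then obtain i j where ij: "i < j" "j < Suc (card X)" "c i = c j"
        by (metis inj_onI lessThan_iff linorder_neqE_nat)
      then have fi: "f i \<in> carrier G" "f j \<in> carrier G" "c j \<in> carrier G"
        using f c[of j] X(2) by auto
      have "f i \<otimes> inv (f j) = (f i \<otimes> inv (c j)) \<otimes> inv (f j \<otimes> inv (c j))"
        using fi by (simp add: inv_mult_group m_assoc) (simp add: m_assoc[symmetric])
      moreover have "\<dots> \<in> V r"
        by (rule V(3)) (use c[of i] c[of j] ij fi in auto)
      ultimately have "f i \<otimes> inv (f j) \<in> V r" by (simp only:)
      with ij show ?thesis by blast
    qed
    then have "\<forall>f. (\<forall>i<Suc (card X). f i \<in> carrier G) \<longrightarrow>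
        (\<exists>i j. i < j \<and> j < Suc (card X) \<and> f i \<otimes> inv (f j) \<in> V r)" by (intro allI impI)
    then show ?thesis by (rule exI)
  qed
  note N_ex = this
  define N where "N r = (SOME N :: nat. \<forall>f. (\<forall>i<N. f i \<in> carrier G) \<longrightarrow>
      (\<exists>i j. i < j \<and> j < N \<and> f i \<otimes> inv (f j) \<in> V r))" for r
  have N: "\<forall>f. (\<forall>i<N r. f i \<in> carrier G) \<longrightarrow>
      (\<exists>i j. i < j \<and> j < N r \<and> f i \<otimes> inv (f j) \<in> V r)" for r
    unfolding N_def by (rule someI_ex[OF N_ex])
  show thesis
    by (rule that[of V N, OF \<H>(1)[OF V(1)] HZ[OF V(1)] V(2,3) N[rule_format]])
qed

end

section \<open>Ramsey-type reduction of grids\<close>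

text \<open>A triple is coloured by some p for which \<open>\<chi> p\<close> fails, or by an extra
  colour if there is none. A homogeneous set in the colour of p would contain N elements, among
  which the hypothesis provides a triple satisfying \<open>\<chi> p\<close>; hence the extra colour
  wins.\<close>

lemma ramsey_family:
  fixes P :: "'p set" and N :: nat
  assumes "finite P"
  shows "\<exists>l :: nat. \<forall>\<chi> :: 'p \<Rightarrow> nat \<Rightarrow> nat \<Rightarrow> nat \<Rightarrow> bool.
    (\<forall>p\<in>P. \<forall>Y\<subseteq>{..<l}. card Y = N \<longrightarrow> (\<exists>i\<in>Y. \<exists>j\<in>Y. \<exists>k\<in>Y. i < j \<and> j < k \<and> \<chi> p i j k)) \<longrightarrow>
    (\<exists>Z \<subseteq> {..<l}. card Z = m \<and> (\<forall>p\<in>P. \<forall>i\<in>Z. \<forall>j\<in>Z. \<forall>k\<in>Z. i < j \<longrightarrow> j < k \<longrightarrow> \<chi> p i j k))"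
proof -
  obtain e where e: "bij_betw e P {..<card P}"
    using ex_bij_betw_finite_nat[OF assms] by (auto simp: atLeast0LessThan)
  \<comment> \<open>One entry for each p, numbered by e, and then m for the extra colour
    \<open>card P\<close>.\<close>
  define qs where "qs = replicate (card P) (max N 3) @ [m]"
  obtain l :: nat where l: "partn_lst {..<l} qs 3" using ramsey_full by blast
  have "\<exists>Z \<subseteq> {..<l}. card Z = m \<and> (\<forall>p\<in>P. \<forall>i\<in>Z. \<forall>j\<in>Z. \<forall>k\<in>Z. i < j \<longrightarrow> j < k \<longrightarrow> \<chi> p i j k)"
    if \<chi>: "\<forall>p\<in>P. \<forall>Y\<subseteq>{..<l}. card Y = N \<longrightarrow> (\<exists>i\<in>Y. \<exists>j\<in>Y. \<exists>k\<in>Y. i < j \<and> j < k \<and> \<chi> p i j k)"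
    for \<chi> :: "'p \<Rightarrow> nat \<Rightarrow> nat \<Rightarrow> nat \<Rightarrow> bool"
  proof -
    define bad where "bad X p \<longleftrightarrow> p \<in> P \<and> (\<exists>i\<in>X. \<exists>j\<in>X. \<exists>k\<in>X. i < j \<and> j < k \<and> \<not> \<chi> p i j k)" for X p
    define f where "f X = (if \<exists>p. bad X p then e (SOME p. bad X p) else card P)" for X
    have f_lt: "e (SOME p. bad X p) < card P" "bad X (SOME p. bad X p)" if "\<exists>p. bad X p" for X
    proof -
      show "bad X (SOME p. bad X p)" using that by (rule someI_ex)
      then have "(SOME p. bad X p) \<in> P" by (simp add: bad_def)
      then show "e (SOME p. bad X p) < card P" using e by (auto simp: bij_betw_def)
    qed
    have "f \<in> nsets {..<l} 3 \<rightarrow> {..<length qs}"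
      using f_lt(1) by (auto simp: f_def qs_def less_SucI)
    then obtain i where i: "i < length qs" "monochromatic {..<l} (qs ! i) 3 f i"
      using l unfolding partn_lst_def by blast
    from i(2) obtain H where H0: "H \<in> nsets {..<l} (qs ! i)" "f ` nsets H 3 \<subseteq> {i}"
      unfolding monochromatic_def by (elim bexE)
    have H: "H \<subseteq> {..<l}" "finite H" "card H = qs ! i" and fH: "\<And>X. X \<in> nsets H 3 \<Longrightarrow> f X = i"
      using H0(1) imageI[THEN subsetD[OF H0(2)]] by (auto simp: nsets_def)
    have triple: "{a, b, c} \<in> nsets H 3" if "a \<in> H" "b \<in> H" "c \<in> H" "a < b" "b < c" for a b c
      using that by (auto simp: nsets_def card_insert_if)
    have in_triple: "a = a' \<and> b = b' \<and> c = c'"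
      if "a' \<in> {a, b, c}" "b' \<in> {a, b, c}" "c' \<in> {a, b, c}" "a < b" "b < c" "a' < b'" "b' < c'"
      for a b c a' b' c' :: nat
      using that by auto
    show ?thesis
    proof (cases "i < card P")
      case True
      then have "card H = max N 3" using H(3) by (simp add: qs_def nth_append)
      then obtain Y where Y: "Y \<subseteq> H" "card Y = N"
        by (metis max.cobounded1 obtain_subset_with_card_n)
      obtain p where p: "p \<in> P" "e p = i"
        using True e by (metis bij_betw_iff_bijections lessThan_iff)
      from \<chi>[rule_format, OF p(1) _ Y(2)] Y(1) H(1) obtain a b c where
        abc: "a \<in> Y" "b \<in> Y" "c \<in> Y" "a < b" "b < c" "\<chi> p a b c" by blast
      then have "f {a, b, c} = i" using triple fH Y(1) by blast
      then have ex: "\<exists>p. bad {a, b, c} p" and "e (SOME p. bad {a, b, c} p) = e p"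
        using True p by (auto simp: f_def split: if_splits)
      then have "(SOME p. bad {a, b, c} p) = p"
        using e p(1) f_lt(2)[OF ex] by (auto simp: bij_betw_def inj_on_def bad_def)
      with f_lt(2)[OF ex] have "bad {a, b, c} p" by simp
      then have "\<not> \<chi> p a b c" using in_triple abc(4,5) unfolding bad_def by blast
      with abc(6) show ?thesis by blast
    next
      case False
      then have "card H = m" using i(1) H(3) by (simp add: qs_def nth_append)
      moreover have "\<chi> p a b c" if "p \<in> P" "a \<in> H" "b \<in> H" "c \<in> H" "a < b" "b < c" for p a b c
      proof (rule ccontr)
        assume "\<not> \<chi> p a b c"
        then have ex: "\<exists>p. bad {a, b, c} p" using that by (auto simp: bad_def)
        have "f {a, b, c} = i" using triple fH that by blast
        with f_lt(1)[OF ex] ex False show False by (simp add: f_def)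
      qed
      ultimately show ?thesis using H(1) by (intro exI[of _ H]) auto
    qed
  qed
  then show ?thesis by (intro exI[of _ l] allI impI)
qed

section \<open>Grids of points and groups filtered by layers\<close>

definition grid :: "nat \<Rightarrow> nat \<Rightarrow> nat list set" where
  "grid n l = {p. length p = n \<and> set p \<subseteq> {..<l}}"

definition point :: "nat \<Rightarrow> (nat \<Rightarrow> nat \<Rightarrow> 'e) \<Rightarrow> nat list \<Rightarrow> 'e list" where
  "point n a p = map (\<lambda>j. a j (p ! j)) [0..<n]"

lemma finite_grid: "finite (grid n l)"
  using finite_lists_length_eq[of "{..<l}" n] by (simp add: grid_def conj_commute)

lemma gridD: "p \<in> grid n l \<Longrightarrow> length p = n" "p \<in> grid n l \<Longrightarrow> j < n \<Longrightarrow> p ! j < l"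
  by (auto simp: grid_def dest: nth_mem)

lemma grid_update: "p \<in> grid n m \<Longrightarrow> m \<le> l \<Longrightarrow> i < l \<Longrightarrow> p[t := i] \<in> grid n l"
  by (auto simp: grid_def dest!: set_update_subset_insert[THEN subsetD])

text \<open>What the combinatorial argument has to know about the layers, free of model theory: x
  stands for the parameters of a group, r for the level, Q for the admissible parameters.
  \<open>U_div\<close> and \<open>U_cover\<close> replace being a subgroup and having bounded
  index.\<close>

locale filtered_group = group G for G :: "('g, 'z) monoid_scheme" (structure) +
  fixes U :: "nat \<Rightarrow> 'e list \<Rightarrow> 'g set" and N :: "nat \<Rightarrow> nat" and Q :: "'e list set"
  assumes U_closed: "x \<in> Q \<Longrightarrow> U r x \<subseteq> carrier G"
    and U_one: "x \<in> Q \<Longrightarrow> \<one> \<in> U r x"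
    and U_div: "x \<in> Q \<Longrightarrow> g \<in> U (Suc r) x \<Longrightarrow> h \<in> U (Suc r) x \<Longrightarrow> g \<otimes> inv h \<in> U r x"
    and U_cover: "x \<in> Q \<Longrightarrow> (\<And>i. i < N r \<Longrightarrow> f i \<in> carrier G) \<Longrightarrow>
      \<exists>i j. i < j \<and> j < N r \<and> f i \<otimes> inv (f j) \<in> U r x"
begin

lemma U_Suc: "x \<in> Q \<Longrightarrow> g \<in> U (Suc r) x \<Longrightarrow> g \<in> U r x"
  using U_div[of x g r \<one>] U_one[of x "Suc r"] U_closed[of x "Suc r"] by auto

lemma U_antimono:
  assumes "x \<in> Q" "r \<le> s" "g \<in> U s x"
  shows "g \<in> U r x"
  using assms(2,3) by (induction s rule: dec_induct) (use U_Suc[OF assms(1)] in auto)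

lemma U_inv: "x \<in> Q \<Longrightarrow> g \<in> U (Suc r) x \<Longrightarrow> inv g \<in> U r x"
  using U_div[of x \<one> r g] U_one[of x "Suc r"] U_closed[of x "Suc r"] by auto

text \<open>Two levels are lost: one for inverting h, one for the quotient.\<close>

lemma U_mult:
  assumes "x \<in> Q" "g \<in> U (Suc (Suc r)) x" "h \<in> U (Suc (Suc r)) x"
  shows "g \<otimes> h \<in> U r x"
  using U_div[OF assms(1) U_Suc[OF assms(1,2)] U_inv[OF assms(1,3)]]
    U_closed[OF assms(1)] assms(3) by (simp add: subset_iff)

text \<open>\<open>cleaned n t l s R a h\<close>: the element at \<open>p\<close> lies in the group at \<open>q\<close> unless \<open>p = q\<close>, provided
  that \<open>q\<close> exceeds \<open>p\<close> in one of the first \<open>t\<close> coordinates, or in none of the others. Membership is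
  up to level \<open>R\<close>, failure of membership already at level \<open>s\<close>.\<close>

definition cleaned ::
    "nat \<Rightarrow> nat \<Rightarrow> nat \<Rightarrow> nat \<Rightarrow> nat \<Rightarrow> (nat \<Rightarrow> nat \<Rightarrow> 'e) \<Rightarrow> (nat list \<Rightarrow> 'g) \<Rightarrow> bool" where
  "cleaned n t l s R a h \<longleftrightarrow>
    (\<forall>p\<in>grid n l. point n a p \<in> Q \<and> h p \<in> carrier G \<and> h p \<notin> U s (point n a p)) \<and>
    (\<forall>p\<in>grid n l. \<forall>q\<in>grid n l. p \<noteq> q \<longrightarrow>
      (\<exists>i<t. p ! i < q ! i) \<or> (\<forall>i\<in>{t..<n}. q ! i \<le> p ! i) \<longrightarrow> h p \<in> U R (point n a q))"

text \<open>Along coordinate t each new index stands for two consecutive selected old ones, reached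
  by \<open>lo\<close> and \<open>hi\<close>. The new element is the quotient of the old elements at
  these two places, and the new point is the old one at \<open>lo\<close>. If \<open>q ! t\<close>
  exceeds \<open>p ! t\<close>, the quotient lies in the group at q by Ramsey's theorem. If not,
  both factors lie there by the cleaning done before, and the quotient costs one level. At its own
  point only the factor at \<open>lo\<close> fails, so the quotient fails as well.\<close>

lemma cleaned_Suc:
  assumes t: "t < n" and R: "Suc s \<le> R"
  shows "\<exists>l. \<forall>a h. cleaned n t l s (Suc R) a h \<longrightarrow> (\<exists>a' h'. cleaned n (Suc t) m (Suc s) R a' h')"
proof -
  let ?P = "grid n m \<times> grid n m"
  have "finite ?P" by (simp add: finite_grid)
  \<comment> \<open>\<open>N R\<close> indices serve the pigeonhole property of layer R, and one
    larger index serves the point at which it is applied. The size \<open>2 * m\<close> reflects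
    that every new index uses up two old ones.\<close>
  from ramsey_family[OF this, of "Suc (N R)" "2 * m"]
  obtain l0 :: nat where l0: "\<forall>\<chi> :: nat list \<times> nat list \<Rightarrow> nat \<Rightarrow> nat \<Rightarrow> nat \<Rightarrow> bool.
    (\<forall>p\<in>?P. \<forall>Y\<subseteq>{..<l0}. card Y = Suc (N R) \<longrightarrow>
      (\<exists>i\<in>Y. \<exists>j\<in>Y. \<exists>k\<in>Y. i < j \<and> j < k \<and> \<chi> p i j k)) \<longrightarrow>
    (\<exists>Z \<subseteq> {..<l0}. card Z = 2 * m \<and>
      (\<forall>p\<in>?P. \<forall>i\<in>Z. \<forall>j\<in>Z. \<forall>k\<in>Z. i < j \<longrightarrow> j < k \<longrightarrow> \<chi> p i j k))"
    by (rule exE)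
  \<comment> \<open>The maximum with m makes the coordinates other than t fit into the old
    grid.\<close>
  define l where "l = max l0 m"
  have "\<exists>a' h'. cleaned n (Suc t) m (Suc s) R a' h'" if C: "cleaned n t l s (Suc R) a h"
    for a :: "nat \<Rightarrow> nat \<Rightarrow> 'e" and h
  proof -
    have Q: "point n a p \<in> Q" and hG: "h p \<in> carrier G" and bad: "h p \<notin> U s (point n a p)"
      if "p \<in> grid n l" for p
      using C that by (auto simp: cleaned_def)
    have good: "h p \<in> U (Suc R) (point n a q)"
      if "p \<in> grid n l" "q \<in> grid n l" "p \<noteq> q" "(\<exists>i<t. p ! i < q ! i) \<or> (\<forall>i\<in>{t..<n}. q ! i \<le> p ! i)"
      for p q
      using C that unfolding cleaned_def by blast
    have upd: "p[t := i] \<in> grid n l" if "p \<in> grid n m" "i < l" for p i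
      using grid_update[OF that(1) _ that(2)] by (simp add: l_def)
    define \<chi> where "\<chi> = (\<lambda>(p, q) i j k. h (p[t := i]) \<otimes> inv h (p[t := j]) \<in> U R (point n a (q[t := k])))"
    have "\<exists>Z \<subseteq> {..<l0}. card Z = 2 * m \<and>
      (\<forall>p\<in>grid n m \<times> grid n m. \<forall>i\<in>Z. \<forall>j\<in>Z. \<forall>k\<in>Z. i < j \<longrightarrow> j < k \<longrightarrow> \<chi> p i j k)"
    proof (rule l0[rule_format])
      fix pq Y
      assume pq: "pq \<in> grid n m \<times> grid n m" and Y: "Y \<subseteq> {..<l0}" "card Y = Suc (N R)"
      obtain p q where pq_eq: "pq = (p, q)" and p: "p \<in> grid n m" and q: "q \<in> grid n m"
        using pq by auto
      have "finite Y" using Y(1) finite_subset by blast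
      then obtain e where e: "bij_betw e {..<Suc (N R)} Y" "strict_mono_on {..<Suc (N R)} e"
        using ex_bij_betw_strict_mono_card[of Y] Y(2) by metis
      have eY: "e i \<in> Y" "e i < l" if "i < Suc (N R)" for i
        using e(1) that Y(1) by (auto simp: bij_betw_def l_def less_max_iff_disj)
      have "\<exists>i j. i < j \<and> j < N R \<and> h (p[t := e i]) \<otimes> inv h (p[t := e j]) \<in> U R (point n a (q[t := e (N R)]))"
        by (rule U_cover) (use p q eY upd Q hG in auto)
      then obtain i j where ij: "i < j" "j < N R" "\<chi> pq (e i) (e j) (e (N R))"
        by (auto simp: \<chi>_def pq_eq)
      moreover have "e i < e j" "e j < e (N R)"
        using ij(1,2) by (auto intro!: strict_mono_onD[OF e(2)])
      ultimately show "\<exists>i\<in>Y. \<exists>j\<in>Y. \<exists>k\<in>Y. i < j \<and> j < k \<and> \<chi> pq i j k"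
        using eY(1)[of i] eY(1)[of j] eY(1)[of "N R"] by force
    qed
    then obtain Z where Z: "Z \<subseteq> {..<l0}" "card Z = 2 * m" and
      hom: "\<forall>p\<in>grid n m \<times> grid n m. \<forall>i\<in>Z. \<forall>j\<in>Z. \<forall>k\<in>Z. i < j \<longrightarrow> j < k \<longrightarrow> \<chi> p i j k"
      by blast
    have "finite Z" using Z(1) finite_subset by blast
    then obtain c where c: "bij_betw c {..<2 * m} Z" "strict_mono_on {..<2 * m} c"
      using ex_bij_betw_strict_mono_card[of Z] Z(2) by metis
    have cZ: "c i \<in> Z" "c i < l" if "i < 2 * m" for i
      using c(1) that Z(1) by (auto simp: bij_betw_def l_def less_max_iff_disj)
    have c_less: "c i < c j" if "i < j" "j < 2 * m" for i j
      using that by (auto intro!: strict_mono_onD[OF c(2)])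
    have c_le: "c i \<le> c j" if "i \<le> j" "j < 2 * m" for i j
      using c_less[of i j] that by (cases "i = j") auto
    define lo where "lo p = p[t := c (2 * (p ! t))]" for p :: "nat list"
    define hi where "hi p = p[t := c (2 * (p ! t) + 1)]" for p :: "nat list"
    define a' where "a' j i = (if j = t then a t (c (2 * i)) else a j i)" for j i
    define h' where "h' p = h (lo p) \<otimes> inv h (hi p)" for p
    have idx: "2 * (p ! t) + 1 < 2 * m" "length p = n" if "p \<in> grid n m" for p
      using gridD[OF that] t by force+
    have lo: "lo p \<in> grid n l" if "p \<in> grid n m" for p
      unfolding lo_def by (rule upd[OF that cZ(2)]) (use idx(1)[OF that] in linarith)
    have hi: "hi p \<in> grid n l" if "p \<in> grid n m" for p
      unfolding hi_def by (rule upd[OF that cZ(2)]) (use idx(1)[OF that] in linarith)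
    have pt: "point n a' p = point n a (lo p)" if "p \<in> grid n m" for p
      using idx[OF that] by (auto simp: point_def a'_def lo_def nth_list_update)
    have "h' p \<in> U R (point n a' q)"
      if p: "p \<in> grid n m" and q: "q \<in> grid n m" and "p \<noteq> q"
        and pq: "(\<exists>i<Suc t. p ! i < q ! i) \<or> (\<forall>i\<in>{Suc t..<n}. q ! i \<le> p ! i)" for p q
    proof (cases "p ! t < q ! t")
      case True
      have "\<chi> (p, q) (c (2 * (p ! t))) (c (2 * (p ! t) + 1)) (c (2 * (q ! t)))"
      proof (rule hom[rule_format])
        show "(p, q) \<in> ?P" using p q by simp
        show "c (2 * (p ! t)) \<in> Z" "c (2 * (p ! t) + 1) \<in> Z" "c (2 * (q ! t)) \<in> Z"
          using idx(1)[OF p] idx(1)[OF q] by (auto intro!: cZ(1))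
        show "c (2 * (p ! t)) < c (2 * (p ! t) + 1)" "c (2 * (p ! t) + 1) < c (2 * (q ! t))"
          using idx(1)[OF p] idx(1)[OF q] True by (auto intro!: c_less)
      qed
      then show ?thesis by (simp add: \<chi>_def h'_def pt[OF q] lo_def hi_def)
    next
      case False
      have neq: "lo p \<noteq> lo q" "hi p \<noteq> lo q"
      proof -
        show "hi p \<noteq> lo q"
        proof
          assume "hi p = lo q"
          then have "c (2 * (p ! t) + 1) = c (2 * (q ! t))"
            using idx[OF p] idx[OF q] t unfolding hi_def lo_def by (metis nth_list_update_eq)
          then show False
            using c_less[of "2 * (q ! t)" "2 * (p ! t) + 1"] False idx[OF p] by simp
        qed
        obtain i where i: "i < n" "p ! i \<noteq> q ! i"
          using \<open>p \<noteq> q\<close> idx[OF p] idx[OF q] by (metis nth_equalityI)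
        show "lo p \<noteq> lo q"
        proof
          assume eq: "lo p = lo q"
          show False
          proof (cases "i = t")
            case True
            have "c (2 * (p ! t)) = c (2 * (q ! t))"
              using eq idx[OF p] idx[OF q] t unfolding lo_def by (metis nth_list_update_eq)
            moreover have "c (2 * (q ! t)) < c (2 * (p ! t))"
              using i True False idx[OF p] by (intro c_less) auto
            ultimately show False by simp
          next
            case False
            then show False using eq i unfolding lo_def by (metis nth_list_update_neq)
          qed
        qed
      qed
      \<comment> \<open>Both \<open>lo p\<close> and \<open>hi p\<close> have the form of r.
        Coordinate t is harmless: \<open>q ! t \<le> p ! t\<close> in this case, and
        \<open>lo q\<close> takes the smaller of the two indices that stand for
        \<open>q ! t\<close>.\<close>
      have cond: "(\<exists>i<t. r ! i < lo q ! i) \<or> (\<forall>i\<in>{t..<n}. lo q ! i \<le> r ! i)"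
        if r: "r = p[t := c i]" and i: "i = 2 * (p ! t) \<or> i = 2 * (p ! t) + 1" for r i
      proof (cases "\<exists>i<t. p ! i < q ! i")
        case True
        then show ?thesis using t by (auto simp: r lo_def)
      next
        case nex: False
        have *: "q ! j \<le> p ! j" if "j \<in> {Suc t..<n}" for j
          using pq False nex that by (auto simp: less_Suc_eq)
        have "lo q ! j \<le> r ! j" if j: "j \<in> {t..<n}" for j
        proof (cases "j = t")
          case True
          have "c (2 * (q ! t)) \<le> c i"
            using False i idx[OF p] by (intro c_le) auto
          then show ?thesis using idx[OF p] idx[OF q] t True by (simp add: r lo_def)
        next
          case False
          then show ?thesis using *[of j] j by (simp add: r lo_def)
        qed
        then show ?thesis by blast
      qed
      have "h (lo p) \<in> U (Suc R) (point n a (lo q))"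
        by (rule good[OF lo[OF p] lo[OF q] neq(1)]) (rule cond, auto simp: lo_def)
      moreover have "h (hi p) \<in> U (Suc R) (point n a (lo q))"
        by (rule good[OF hi[OF p] lo[OF q] neq(2)]) (rule cond, auto simp: hi_def)
      ultimately show ?thesis
        using U_div[OF Q[OF lo[OF q]]] by (simp add: h'_def pt[OF q])
    qed
    moreover have "point n a' p \<in> Q \<and> h' p \<in> carrier G \<and> h' p \<notin> U (Suc s) (point n a' p)"
      if p: "p \<in> grid n m" for p
    proof (intro conjI notI)
      note lo = lo[OF p] and hi = hi[OF p]
      show "point n a' p \<in> Q" "h' p \<in> carrier G"
        using Q[OF lo] hG[OF lo] hG[OF hi] by (auto simp: pt[OF p] h'_def)
      assume "h' p \<in> U (Suc s) (point n a' p)"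
      then have 1: "h (lo p) \<otimes> inv h (hi p) \<in> U (Suc s) (point n a (lo p))"
        by (simp add: h'_def pt[OF p])
      have less: "c (2 * (p ! t)) < c (2 * (p ! t) + 1)" using idx[OF p] by (intro c_less) auto
      have lo_hi: "lo p ! t = c (2 * (p ! t))" "hi p ! t = c (2 * (p ! t) + 1)"
        "lo p ! j = (if j = t then c (2 * (p ! t)) else p ! j)"
        "hi p ! j = (if j = t then c (2 * (p ! t) + 1) else p ! j)" for j
        using idx[OF p] t by (auto simp: lo_def hi_def)
      \<comment> \<open>\<open>hi p\<close> lies above \<open>lo p\<close> in coordinate t and
        agrees with it elsewhere, so the second factor belongs to the group at \<open>lo p\<close>
        and can be cancelled.\<close>
      have "h (hi p) \<in> U (Suc R) (point n a (lo p))"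
      proof (rule good[OF hi lo])
        show "hi p \<noteq> lo p" using lo_hi(1,2) less by auto
        show "(\<exists>i<t. hi p ! i < lo p ! i) \<or> (\<forall>i\<in>{t..<n}. lo p ! i \<le> hi p ! i)"
          using less by (simp add: lo_hi(3,4))
      qed
      then have "inv h (hi p) \<in> U (Suc s) (point n a (lo p))"
        using U_antimono[OF Q[OF lo] R] U_inv[OF Q[OF lo]] by blast
      from U_div[OF Q[OF lo] 1 this] have "h (lo p) \<in> U s (point n a (lo p))"
        using hG[OF lo] hG[OF hi] by (simp add: m_assoc)
      with bad[OF lo] show False by blast
    qed
    ultimately have "cleaned n (Suc t) m (Suc s) R a' h'"
      unfolding cleaned_def by blast
    then show ?thesis by blast
  qed
  then show ?thesis by blast
qed

text \<open>Sizes are found backwards: the grid wanted after the last coordinate determines the one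
  needed before it. Each coordinate takes one level from membership and adds one to the level of
  failure; \<open>n \<le> R\<close> keeps the hypothesis of \<open>cleaned_Suc\<close> true
  throughout.\<close>

lemma cleaned_exists:
  assumes "n \<le> R" "t \<le> n"
  shows "\<exists>l. \<forall>a h. cleaned n 0 l 0 (R + t) a h \<longrightarrow> (\<exists>a' h'. cleaned n t m t R a' h')"
  using assms
proof (induction t arbitrary: m R)
  case 0
  then show ?case by auto
next
  case (Suc t)
  obtain l1 where l1: "\<forall>a h. cleaned n t l1 t (Suc R) a h \<longrightarrow> (\<exists>a' h'. cleaned n (Suc t) m (Suc t) R a' h')"
    using cleaned_Suc[of t n t R m] Suc.prems by auto
  obtain l where "\<forall>a h. cleaned n 0 l 0 (Suc R + t) a h \<longrightarrow> (\<exists>a' h'. cleaned n t l1 t (Suc R) a' h')"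
    using Suc.IH[of "Suc R" l1] Suc.prems by auto
  with l1 have "\<forall>a h. cleaned n 0 l 0 (R + Suc t) a h \<longrightarrow> (\<exists>a' h'. cleaned n (Suc t) m (Suc t) R a' h')"
    by (metis add_Suc_right add_Suc)
  then show ?case by blast
qed

text \<open>Every factor costs two levels, as in \<open>U_mult\<close>.\<close>

lemma prod_list_U:
  assumes "x \<in> Q" and "\<And>p. p \<in> set ps \<Longrightarrow> h p \<in> U (r + 2 * length ps) x"
  shows "foldr (\<lambda>p g. h p \<otimes> g) ps \<one> \<in> U r x"
  using assms(2)
proof (induction ps arbitrary: r)
  case Nil
  then show ?case using U_one[OF assms(1)] by simp
next
  case (Cons p ps)
  have "foldr (\<lambda>p g. h p \<otimes> g) ps \<one> \<in> U (Suc (Suc r)) x"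
    by (rule Cons.IH) (use Cons.prems in auto)
  moreover have "h p \<in> U (Suc (Suc r)) x"
    by (rule U_antimono[OF assms(1) _ Cons.prems]) auto
  ultimately show ?case using U_mult[OF assms(1)] by simp
qed

text \<open>The witness is the product of the elements at the points of S. At a point outside S all
  factors lie in the group. At a point q of S exactly one factor does not; since the group need not
  be commutative, the factors before and after it are cancelled from the two sides, which leaves the
  failure of \<open>h q\<close> at level n.\<close>

lemma cleaned_shatters:
  assumes C: "cleaned n n m n R a h" and R: "n + 6 + 2 * card (grid n m) \<le> R" and S: "S \<subseteq> grid n m"
  shows "\<exists>g\<in>carrier G. \<forall>q\<in>grid n m. g \<in> U (n + 4) (point n a q) \<longleftrightarrow> q \<notin> S"
proof -
  let ?prod = "\<lambda>ps. foldr (\<lambda>p g. h p \<otimes> g) ps \<one>"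
  have Q: "point n a p \<in> Q" and hG: "h p \<in> carrier G" and bad: "h p \<notin> U n (point n a p)"
    if "p \<in> grid n m" for p
    using C that by (auto simp: cleaned_def)
  have good: "h p \<in> U R (point n a q)" if "p \<in> grid n m" "q \<in> grid n m" "p \<noteq> q" for p q
  proof -
    have "\<forall>i\<in>{n..<n}. q ! i \<le> p ! i" by simp
    then show ?thesis using C that unfolding cleaned_def by blast
  qed
  obtain ps where ps: "set ps = S" "distinct ps"
    using finite_distinct_list[OF finite_subset[OF S finite_grid]] by blast
  then have len: "length ps \<le> card (grid n m)"
    using card_mono[OF finite_grid S] distinct_card by metis
  have prodG: "?prod qs \<in> carrier G" if "set qs \<subseteq> grid n m" for qs
    using that by (induction qs) (auto intro: hG)
  have prodU: "?prod qs \<in> U (n + 6) (point n a q)"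
    if "set qs \<subseteq> grid n m" "q \<in> grid n m" "q \<notin> set qs" "length qs \<le> length ps" for q qs
  proof (rule prod_list_U[OF Q[OF that(2)]])
    fix p assume p: "p \<in> set qs"
    show "h p \<in> U (n + 6 + 2 * length qs) (point n a q)"
      by (rule U_antimono[OF Q[OF that(2)] _ good]) (use that p len R in auto)
  qed
  have prod_append: "?prod (us @ q # vs) = ?prod us \<otimes> (h q \<otimes> ?prod vs)"
    if "set (us @ q # vs) \<subseteq> grid n m" for us q vs
    using that by (induction us) (auto simp: m_assoc hG prodG)
  have "?prod ps \<in> U (n + 4) (point n a q) \<longleftrightarrow> q \<notin> S" if q: "q \<in> grid n m" for q
  proof
    assume "q \<notin> S"
    then have "?prod ps \<in> U (n + 6) (point n a q)"
      using prodU[of ps q] S ps q by auto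
    then show "?prod ps \<in> U (n + 4) (point n a q)"
      by (rule U_antimono[OF Q[OF q], rotated]) simp
  next
    assume U: "?prod ps \<in> U (n + 4) (point n a q)"
    show "q \<notin> S"
    proof
      assume "q \<in> S"
      then obtain us vs where split: "ps = us @ q # vs" using ps split_list by metis
      let ?x = "point n a q"
      note x = Q[OF q]
      have sub: "set us \<subseteq> grid n m" "set vs \<subseteq> grid n m" "q \<notin> set us" "q \<notin> set vs"
        using S ps split by auto
      have u: "?prod us \<in> U (n + 6) ?x" and v: "?prod vs \<in> U (n + 6) ?x"
        using prodU[of us q] prodU[of vs q] sub q split by auto
      \<comment> \<open>Multiplying by the inverse of the prefix leads from level n + 4 to n + 2,
        and dividing by the product over vs leads from n + 1 to n, where \<open>h q\<close>
        fails.\<close>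
      have "inv (?prod us) \<in> U (n + 4) ?x"
        by (rule U_antimono[OF x _ U_inv[OF x, of _ "n + 5"]]) (use u in \<open>auto simp: add.commute\<close>)
      then have "inv (?prod us) \<otimes> ?prod ps \<in> U (n + 2) ?x"
        using U_mult[OF x, of _ "n + 2"] U by (simp add: numeral_eq_Suc)
      also have "inv (?prod us) \<otimes> ?prod ps = h q \<otimes> ?prod vs"
        using prod_append[of us q vs] sub q prodG[OF sub(1)] prodG[OF sub(2)] hG[OF q]
        by (simp add: split m_assoc[symmetric])
      finally have "h q \<otimes> ?prod vs \<in> U (Suc n) ?x"
        by (rule U_antimono[OF x, rotated]) simp
      moreover have "?prod vs \<in> U (Suc n) ?x"
        by (rule U_antimono[OF x _ v]) simp
      ultimately have "(h q \<otimes> ?prod vs) \<otimes> inv (?prod vs) \<in> U n ?x" by (rule U_div[OF x])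
      then have "h q \<in> U n ?x" using hG[OF q] prodG[OF sub(2)] by (simp add: m_assoc)
      with bad[OF q] show False by blast
    qed
  qed
  moreover have "?prod ps \<in> carrier G" using prodG S ps by blast
  ultimately show ?thesis by blast
qed

end

section \<open>Automorphisms\<close>

lemma automorphism_val:
  assumes "automorphism L M \<sigma>" "is_struct L M"
  shows "wf_trm L t \<Longrightarrow> (\<And>x. x \<in> fv_trm t \<Longrightarrow> v x \<in> carrier M) \<Longrightarrow>
    val M v t \<in> carrier M \<and> \<sigma> (val M v t) = val M (\<sigma> \<circ> v) t"
proof (induction t)
  case (App f ts)
  have IH: "val M v t \<in> carrier M \<and> \<sigma> (val M v t) = val M (\<sigma> \<circ> v) t" if "t \<in> set ts" for t
    by (rule App.IH[OF that]) (use App.prems that in auto)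
  then have "map (val M v) ts \<in> tuples (carrier M) (farity L f)"
    using App.prems(1) by (auto simp: tuples_def)
  moreover have "map \<sigma> (map (val M v) ts) = map (val M (\<sigma> \<circ> v)) ts"
    using IH by simp
  ultimately show ?case
    using assms App.prems(1) by (simp add: automorphism_def is_struct_def comp_def del: map_map)
qed simp

lemma automorphism_sat:
  assumes \<sigma>: "automorphism L M \<sigma>" and M: "is_struct L M"
  shows "wf_fm L p \<Longrightarrow> (\<And>x. x \<in> fv p \<Longrightarrow> v x \<in> carrier M) \<Longrightarrow> sat M v p \<longleftrightarrow> sat M (\<sigma> \<circ> v) p"
proof (induction p arbitrary: v)
  case (Equal s t)
  have "val M v s \<in> carrier M \<and> \<sigma> (val M v s) = val M (\<sigma> \<circ> v) s"
    by (rule automorphism_val[OF \<sigma> M]) (use Equal in auto)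
  moreover have "val M v t \<in> carrier M \<and> \<sigma> (val M v t) = val M (\<sigma> \<circ> v) t"
    by (rule automorphism_val[OF \<sigma> M]) (use Equal in auto)
  moreover have "inj_on \<sigma> (carrier M)" using \<sigma> by (auto simp: automorphism_def bij_betw_def)
  ultimately show ?case by (metis inj_on_eq_iff sat.simps(1))
next
  case (Rel R ts)
  have *: "val M v t \<in> carrier M \<and> \<sigma> (val M v t) = val M (\<sigma> \<circ> v) t" if "t \<in> set ts" for t
    by (rule automorphism_val[OF \<sigma> M]) (use Rel that in auto)
  then have "map (val M v) ts \<in> tuples (carrier M) (rarity L R)"
    using Rel.prems(1) by (auto simp: tuples_def)
  moreover have "map \<sigma> (map (val M v) ts) = map (val M (\<sigma> \<circ> v)) ts"
    using * by simp
  ultimately show ?case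
    using \<sigma> Rel.prems(1) by (simp add: automorphism_def comp_def del: map_map)
next
  case (Neg p)
  have "sat M v p \<longleftrightarrow> sat M (\<sigma> \<circ> v) p" by (rule Neg.IH) (use Neg.prems in auto)
  then show ?case by (simp add: comp_def)
next
  case (Conj p q)
  have "sat M v p \<longleftrightarrow> sat M (\<sigma> \<circ> v) p" by (rule Conj.IH(1)) (use Conj.prems in auto)
  moreover have "sat M v q \<longleftrightarrow> sat M (\<sigma> \<circ> v) q" by (rule Conj.IH(2)) (use Conj.prems in auto)
  ultimately show ?case by (simp add: comp_def)
next
  case (Ex x p)
  have *: "sat M (v(x := a)) p \<longleftrightarrow> sat M ((\<sigma> \<circ> v)(x := \<sigma> a)) p" if "a \<in> carrier M" for a
  proof -
    have "sat M (v(x := a)) p \<longleftrightarrow> sat M (\<sigma> \<circ> v(x := a)) p"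
      by (rule Ex.IH) (use Ex.prems that in auto)
    then show ?thesis by (simp add: fun_upd_comp)
  qed
  have "\<sigma> ` carrier M = carrier M" using \<sigma> by (auto simp: automorphism_def bij_betw_def)
  then have "(\<exists>a\<in>carrier M. sat M ((\<sigma> \<circ> v)(x := a)) p) \<longleftrightarrow> (\<exists>a\<in>carrier M. sat M ((\<sigma> \<circ> v)(x := \<sigma> a)) p)"
    by (metis (no_types, lifting) image_iff)
  with * show ?case by (simp del: comp_apply)
qed

lemma automorphism_holds:
  assumes "automorphism L M \<sigma>" "is_struct L M" "p \<in> fmls L (length xs)" "set xs \<subseteq> carrier M"
  shows "holds M p (map \<sigma> xs) \<longleftrightarrow> holds M p xs"
proof -
  have "sat M ((!) xs) p \<longleftrightarrow> sat M (\<sigma> \<circ> (!) xs) p"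
    by (rule automorphism_sat[OF assms(1,2)]) (use assms(3,4) in \<open>auto simp: fmls_def subset_iff\<close>)
  also have "\<dots> \<longleftrightarrow> sat M ((!) (map \<sigma> xs)) p"
    by (rule sat_cong) (use assms(3) in \<open>auto simp: fmls_def\<close>)
  finally show ?thesis by (simp add: holds_def)
qed

lemma automorphism_id: "automorphism L M id"
  by (simp add: automorphism_def)

lemma automorphism_closed: "automorphism L M \<sigma> \<Longrightarrow> x \<in> carrier M \<Longrightarrow> \<sigma> x \<in> carrier M"
  by (auto simp: automorphism_def bij_betw_def)

lemma automorphism_tuples: "automorphism L M \<sigma> \<Longrightarrow> xs \<in> tuples (carrier M) k \<Longrightarrow> map \<sigma> xs \<in> tuples (carrier M) k"
  by (auto simp: tuples_def dest: automorphism_closed)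

lemma automorphism_comp:
  assumes "automorphism L M \<sigma>" "automorphism L M \<tau>"
  shows "automorphism L M (\<sigma> \<circ> \<tau>)"
proof -
  have \<tau>: "map \<tau> xs \<in> tuples (carrier M) k" if "xs \<in> tuples (carrier M) k" for xs k
    using automorphism_tuples[OF assms(2) that] .
  have "(\<sigma> \<circ> \<tau>) (fun_interp M f xs) = fun_interp M f (map (\<sigma> \<circ> \<tau>) xs)"
    if "f \<in> Funs L" "xs \<in> tuples (carrier M) (farity L f)" for f xs
    using assms that \<tau>[OF that(2)] by (simp add: automorphism_def)
  moreover have "xs \<in> rel_interp M R \<longleftrightarrow> map (\<sigma> \<circ> \<tau>) xs \<in> rel_interp M R"
    if "R \<in> Rels L" "xs \<in> tuples (carrier M) (rarity L R)" for R xs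
  proof -
    have "xs \<in> rel_interp M R \<longleftrightarrow> map \<tau> xs \<in> rel_interp M R"
      using assms(2) that unfolding automorphism_def by blast
    also have "\<dots> \<longleftrightarrow> map \<sigma> (map \<tau> xs) \<in> rel_interp M R"
      using assms(1) that(1) \<tau>[OF that(2)] unfolding automorphism_def by blast
    finally show ?thesis by simp
  qed
  moreover have "bij_betw (\<sigma> \<circ> \<tau>) (carrier M) (carrier M)"
    using assms by (auto simp: automorphism_def intro: bij_betw_trans)
  ultimately show ?thesis unfolding automorphism_def by blast
qed

lemma automorphism_inv:
  assumes \<sigma>: "automorphism L M \<sigma>" and M: "is_struct L M"
  shows "automorphism L M (inv_into (carrier M) \<sigma>)"
proof -
  let ?\<tau> = "inv_into (carrier M) \<sigma>"
  have bij: "bij_betw \<sigma> (carrier M) (carrier M)" using \<sigma> by (simp add: automorphism_def)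
  have \<tau>: "?\<tau> x \<in> carrier M" "\<sigma> (?\<tau> x) = x" if "x \<in> carrier M" for x
    using bij that by (auto simp: bij_betw_def inv_into_into f_inv_into_f)
  have map: "map ?\<tau> xs \<in> tuples (carrier M) k" "map \<sigma> (map ?\<tau> xs) = xs"
    if "xs \<in> tuples (carrier M) k" for xs k
    using that \<tau> by (auto simp: tuples_def subset_iff intro!: map_idI)
  have "?\<tau> (fun_interp M f xs) = fun_interp M f (map ?\<tau> xs)"
    if f: "f \<in> Funs L" and xs: "xs \<in> tuples (carrier M) (farity L f)" for f xs
  proof -
    have "\<sigma> (fun_interp M f (map ?\<tau> xs)) = fun_interp M f xs"
      using \<sigma> f map[OF xs] unfolding automorphism_def by simp
    moreover have "fun_interp M f (map ?\<tau> xs) \<in> carrier M"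
      using M f map(1)[OF xs] by (simp add: is_struct_def)
    ultimately show ?thesis
      using bij by (metis bij_betw_inv_into_left)
  qed
  moreover have "xs \<in> rel_interp M R \<longleftrightarrow> map ?\<tau> xs \<in> rel_interp M R"
    if "R \<in> Rels L" and xs: "xs \<in> tuples (carrier M) (rarity L R)" for R xs
    using \<sigma> that map[OF xs] unfolding automorphism_def by metis
  ultimately show ?thesis
    using bij_betw_inv_into[OF bij] unfolding automorphism_def by blast
qed

lemma definable_automorphism:
  assumes "definable L M B k X" and \<sigma>: "automorphism L M \<sigma>" and M: "is_struct L M"
    and fixB: "\<forall>x\<in>B. \<sigma> x = x" and B: "B \<subseteq> carrier M" and a: "a \<in> tuples (carrier M) k"
  shows "map \<sigma> a \<in> X \<longleftrightarrow> a \<in> X"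
proof -
  obtain c p where c: "c \<in> lists B" and p: "p \<in> fmls L (k + length c)"
    and X: "X = {a\<in>tuples (carrier M) k. holds M p (a @ c)}"
    using assms(1) by (auto simp: definable_def)
  have "map \<sigma> c = c" using c fixB by (auto intro!: map_idI)
  moreover have "holds M p (map \<sigma> (a @ c)) \<longleftrightarrow> holds M p (a @ c)"
    by (rule automorphism_holds[OF \<sigma> M]) (use p a c B in \<open>auto simp: tuples_def\<close>)
  ultimately show ?thesis
    using a automorphism_tuples[OF \<sigma> a] by (simp add: X)
qed

lemma type_definable_automorphism:
  assumes "type_definable L M B k X" and \<sigma>: "automorphism L M \<sigma>" and M: "is_struct L M"
    and fixB: "\<forall>x\<in>B. \<sigma> x = x" and B: "B \<subseteq> carrier M" and a: "a \<in> tuples (carrier M) k"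
  shows "map \<sigma> a \<in> X \<longleftrightarrow> a \<in> X"
proof -
  obtain \<X> where \<X>: "\<forall>Z\<in>\<X>. definable L M B k Z" and X: "X = {a\<in>tuples (carrier M) k. \<forall>Z\<in>\<X>. a \<in> Z}"
    using assms(1) unfolding type_definable_iff by (elim exE conjE)
  have "map \<sigma> a \<in> Z \<longleftrightarrow> a \<in> Z" if "Z \<in> \<X>" for Z
    using definable_automorphism[OF bspec[OF \<X> that] \<sigma> M fixB B a] .
  then show ?thesis
    using a automorphism_tuples[OF \<sigma> a] by (simp add: X)
qed

section \<open>Conjugacy of tuples of the same type\<close>

context monster
begin

lemma is_struct: "is_struct L MM"
  using monster by (simp add: monster_model_def models_def)

text \<open>Homogeneity asks for an elementary map, here the identity on C together with
  \<open>a ! i\<close> going to \<open>a' ! i\<close>. It is well defined because equalities among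
  the entries of a, and between these and elements of C, belong to the type.\<close>

lemma conjugate_if_same_type:
  assumes C: "small C" and a: "a \<in> tup m" and a': "a' \<in> tup m"
    and tpa: "realizes MM a' (tp L MM a C)"
  obtains \<sigma> where "automorphism L MM \<sigma>" "\<forall>x\<in>C. \<sigma> x = x" "map \<sigma> a = a'"
proof -
  have len: "length a = m" "length a' = m" using a a' by (auto simp: tuples_def)
  have imp: "holds MM p (a' @ c)" if "c \<in> lists C" "p \<in> fmls L (m + length c)" "holds MM p (a @ c)" for p c
    using tpa that len by (auto simp: realizes_def tp_def param_fmls_def)
  \<comment> \<open>Realizing the type is one implication; the other one comes from the negated
    formula.\<close>
  have same: "holds MM p (a' @ c) \<longleftrightarrow> holds MM p (a @ c)"
    if "c \<in> lists C" "p \<in> fmls L (m + length c)" for p c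
    using imp[OF that] imp[of c "Neg p"] that by auto
  define g where "g x = (if x \<in> C then x else a' ! (LEAST i. i < m \<and> a ! i = x))" for x
  have g: "g ((a @ c) ! u) = (a' @ c) ! u" if c: "c \<in> lists C" and u: "u < m + length c" for c u
  proof (cases "u < m")
    case True
    show ?thesis
    proof (cases "a ! u \<in> C")
      case inC: True
      have "Equal (Var u) (Var m) \<in> fmls L (m + length [a ! u])"
        using True by (auto simp: fmls_def)
      from same[OF _ this] inC True len show ?thesis
        by (simp add: holds_def g_def nth_append)
    next
      case False
      define i where "i = (LEAST i. i < m \<and> a ! i = a ! u)"
      have i: "i < m \<and> a ! i = a ! u" unfolding i_def by (rule LeastI[of _ u]) (use True in simp)
      have "Equal (Var i) (Var u) \<in> fmls L (m + length [])"
        using True i by (auto simp: fmls_def)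
      from same[OF _ this] True len i False show ?thesis
        by (simp add: holds_def g_def nth_append i_def[symmetric])
    qed
  next
    case False
    then show ?thesis using c u len by (auto simp: g_def nth_append subset_iff)
  qed
  have "elementary_map L MM (C \<union> set a) g"
    unfolding elementary_map_def
  proof (intro conjI ballI)
    show "C \<union> set a \<subseteq> carrier MM" using C a by (auto simp: small_def tuples_def)
    show "g ` (C \<union> set a) \<subseteq> carrier MM"
    proof
      fix y assume "y \<in> g ` (C \<union> set a)"
      then obtain x where x: "x \<in> C \<union> set a" "y = g x" by blast
      show "y \<in> carrier MM"
      proof (cases "x \<in> C")
        case True
        then show ?thesis using C x by (auto simp: small_def g_def)
      next
        case False
        then obtain u where "u < m" "x = a ! u" using x len by (auto simp: in_set_conv_nth)
        then have "y = a' ! u" using g[of "[]" u] x by simp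
        then show ?thesis using a' \<open>u < m\<close> by (auto simp: tuples_def)
      qed
    qed
  next
    fix xs p assume xs: "xs \<in> lists (C \<union> set a)" and p: "p \<in> fmls L (length xs)"
    define c where "c = filter (\<lambda>x. x \<in> C) xs"
    have c: "c \<in> lists C" by (auto simp: c_def)
    \<comment> \<open>Every entry of xs occurs in \<open>a @ c\<close>, so p at xs is a renamed
      formula at \<open>a @ c\<close>, to which the type applies.\<close>
    have "\<forall>i<length xs. \<exists>u<m + length c. xs ! i = (a @ c) ! u"
    proof (intro allI impI)
      fix i assume "i < length xs"
      then have "xs ! i \<in> set xs" by simp
      then have "xs ! i \<in> set (a @ c)" using xs by (auto simp: c_def)
      then obtain u where "u < length (a @ c)" "(a @ c) ! u = xs ! i"
        unfolding in_set_conv_nth by blast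
      then show "\<exists>u<m + length c. xs ! i = (a @ c) ! u"
        using len by (intro exI[of _ u]) simp
    qed
    then obtain f where f: "\<And>i. i < length xs \<Longrightarrow> f i < m + length c" "\<And>i. i < length xs \<Longrightarrow> xs ! i = (a @ c) ! f i"
      by metis
    have 1: "map (\<lambda>i. (a @ c) ! f i) [0..<length xs] = xs"
      using f(2) by (intro nth_equalityI) auto
    have 2: "map (\<lambda>i. (a' @ c) ! f i) [0..<length xs] = map g xs"
      using f g[OF c] by (intro nth_equalityI) auto
    have "holds MM (ren f p) (a' @ c) \<longleftrightarrow> holds MM (ren f p) (a @ c)"
      using same[OF c] holds_ren(1)[OF p f(1)] by simp
    then show "holds MM p xs \<longleftrightarrow> holds MM p (map g xs)"
      by (simp add: holds_ren(2)[OF p f(1)] 1 2)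
  qed
  moreover have "|C \<union> set a| <o \<kappa>"
    using C by (simp add: small_def Un_less_kappa finite_less_kappa)
  moreover have "homogeneous L MM \<kappa>" using monster by (simp add: monster_model_def)
  ultimately obtain \<sigma> where \<sigma>: "automorphism L MM \<sigma>" "\<forall>x\<in>C \<union> set a. \<sigma> x = g x"
    unfolding homogeneous_def by blast
  have "map \<sigma> a = a'"
  proof (rule nth_equalityI)
    fix i assume "i < length (map \<sigma> a)"
    then show "map \<sigma> a ! i = a' ! i" using \<sigma>(2) g[of "[]" i] len by simp
  qed (use len in simp)
  moreover have "\<forall>x\<in>C. \<sigma> x = x" using \<sigma>(2) by (simp add: g_def)
  ultimately show thesis using \<sigma>(1) that by blast
qed

section \<open>Saturation for countably many variables\<close>

text \<open>\<open>saturated\<close> speaks of finitely many variables, but the array witnessing the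
  independence property needs infinitely many. Values are found one after the other:
  \<open>ext xs\<close> says that xs extends to an assignment satisfying any given finite part. The
  remaining variables of a finite part are quantified away, which makes the condition on the next
  value definable.\<close>

lemma countable_saturation:
  assumes wf: "\<And>p. p \<in> \<Phi> \<Longrightarrow> wf_fm L p"
    and fip: "\<And>\<Phi>0. finite \<Phi>0 \<Longrightarrow> \<Phi>0 \<subseteq> \<Phi> \<Longrightarrow> \<exists>v. range v \<subseteq> carrier MM \<and> (\<forall>p\<in>\<Phi>0. sat MM v p)"
  shows "\<exists>v. range v \<subseteq> carrier MM \<and> (\<forall>p\<in>\<Phi>. sat MM v p)"
proof -
  define E where "E \<Phi>0 xs \<longleftrightarrow> (\<exists>v. range v \<subseteq> carrier MM \<and> (\<forall>i<length xs. v i = xs ! i) \<and> (\<forall>p\<in>\<Phi>0. sat MM v p))"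
    for \<Phi>0 and xs :: "'a list"
  let ?I = "{\<Phi>0. finite \<Phi>0 \<and> \<Phi>0 \<subseteq> \<Phi>}"
  define ext where "ext xs \<longleftrightarrow> set xs \<subseteq> carrier MM \<and> (\<forall>\<Phi>0\<in>?I. E \<Phi>0 xs)" for xs
  have step: "\<exists>a. ext (xs @ [a])" if xs: "ext xs" for xs
  proof -
    define m where "m = length xs"
    define Z where "Z \<Phi>0 = {ys\<in>tup 1. E \<Phi>0 (xs @ ys)}" for \<Phi>0
    have def: "definable L MM (set xs) 1 (Z \<Phi>0)" if \<Phi>0: "\<Phi>0 \<in> ?I" for \<Phi>0
    proof -
      \<comment> \<open>There are \<open>Suc m\<close> values in question, the m old ones and the
        new one; j further variables cover all free ones.\<close>
      obtain j where j: "\<And>p. p \<in> \<Phi>0 \<Longrightarrow> fv p \<subseteq> {..<Suc m + j}"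
      proof -
        have "finite (\<Union>p\<in>\<Phi>0. fv p)" using \<Phi>0 finite_fv by blast
        then obtain K where K: "(\<Union>p\<in>\<Phi>0. fv p) \<subseteq> {..<K}"
          by (metis finite_nat_iff_bounded)
        show thesis by (rule that[of K]) (use K in force)
      qed
      define X where "X = {zs\<in>tup (Suc m + j). \<forall>p\<in>\<Phi>0. zs \<in> {zs\<in>tup (Suc m + j). holds MM p (zs @ [])}}"
      have "definable L MM (set xs) (Suc m + j) X"
        unfolding X_def using \<Phi>0 j wf carrier_nonempty
        by (intro definable_INT definableI) (auto simp: fmls_def)
      then have "definable L MM (set xs) (Suc m) {zs\<in>tup (Suc m). \<exists>z\<in>tup j. zs @ z \<in> X}" (is "definable _ _ _ _ ?Y")
        by (rule definable_ex)
      \<comment> \<open>The new value is moved to the front, because \<open>definable_inst\<close>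
        substitutes parameters for the last coordinates.\<close>
      then have "definable L MM (set xs) (1 + m)
          {ws\<in>tup (1 + m). map (\<lambda>i. ws ! (if i < m then Suc i else 0)) [0..<Suc m] \<in> ?Y}"
        by (rule definable_pullback) auto
      then have "definable L MM (set xs \<union> set xs) 1 {ys\<in>tup 1. ys @ xs \<in>
          {ws\<in>tup (1 + m). map (\<lambda>i. ws ! (if i < m then Suc i else 0)) [0..<Suc m] \<in> ?Y}}"
        by (rule definable_inst) (use xs in \<open>auto simp: tuples_def m_def ext_def\<close>)
      also have "{ys\<in>tup 1. ys @ xs \<in>
          {ws\<in>tup (1 + m). map (\<lambda>i. ws ! (if i < m then Suc i else 0)) [0..<Suc m] \<in> ?Y}} = Z \<Phi>0"
      proof -
        have "ys @ xs \<in> {ws\<in>tup (1 + m). map (\<lambda>i. ws ! (if i < m then Suc i else 0)) [0..<Suc m] \<in> ?Y}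
            \<longleftrightarrow> E \<Phi>0 (xs @ ys)" if ys: "ys \<in> tup 1" for ys
        proof -
          obtain y where y: "ys = [y]" "y \<in> carrier MM" using ys
            by (cases ys) (auto simp: tuples_def)
          have 1: "map (\<lambda>i. (ys @ xs) ! (if i < m then Suc i else 0)) [0..<Suc m] = xs @ ys"
            by (rule nth_equalityI) (auto simp: y m_def nth_append less_Suc_eq)
          have 2: "ys @ xs \<in> tup (1 + m)" "xs @ ys \<in> tup (Suc m)"
            using xs y by (auto simp: tuples_def m_def ext_def)
          have "(\<exists>z\<in>tup j. (xs @ ys) @ z \<in> X) \<longleftrightarrow> E \<Phi>0 (xs @ ys)"
          proof
            assume "\<exists>z\<in>tup j. (xs @ ys) @ z \<in> X"
            then obtain z where z: "z \<in> tup j" "(xs @ ys) @ z \<in> X" by blast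
            let ?l = "(xs @ ys) @ z"
            have len: "length ?l = Suc m + j" and sub: "set ?l \<subseteq> carrier MM"
              using z xs y by (auto simp: tuples_def m_def ext_def)
            define v where "v i = (if i < length ?l then ?l ! i else y)" for i
            have "range v \<subseteq> carrier MM"
              using y(2) subsetD[OF sub nth_mem] unfolding v_def by (fastforce simp del: append_assoc)
            moreover have "\<forall>i<length (xs @ ys). v i = (xs @ ys) ! i"
              by (auto simp: v_def nth_append)
            moreover have "sat MM v p" if p: "p \<in> \<Phi>0" for p
            proof -
              have "sat MM ((!) ?l) p" using z(2) p by (simp add: X_def holds_def)
              also have "sat MM ((!) ?l) p \<longleftrightarrow> sat MM v p"
                by (rule sat_cong) (use j[OF p] len in \<open>auto simp: v_def\<close>)
              finally show ?thesis .
            qed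
            ultimately show "E \<Phi>0 (xs @ ys)" by (auto simp: E_def)
          next
            assume "E \<Phi>0 (xs @ ys)"
            then obtain v where v: "range v \<subseteq> carrier MM" "\<forall>i<length (xs @ ys). v i = (xs @ ys) ! i"
              "\<forall>p\<in>\<Phi>0. sat MM v p" by (auto simp: E_def)
            define z where "z = map v [Suc m..<Suc m + j]"
            have z: "z \<in> tup j" using v(1) by (auto simp: tuples_def z_def)
            have l: "(xs @ ys) @ z = map v [0..<Suc m + j]"
            proof -
              have "xs @ ys = map v [0..<Suc m]"
                using v(2) y by (intro nth_equalityI) (auto simp: m_def simp del: upt_Suc)
              moreover have "[0..<Suc m + j] = [0..<Suc m] @ [Suc m..<Suc m + j]"
                by (rule upt_add_eq_append) simp
              ultimately show ?thesis by (simp add: z_def del: upt_Suc)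
            qed
            have "holds MM p ((xs @ ys) @ z)" if p: "p \<in> \<Phi>0" for p
            proof -
              have "sat MM v p \<longleftrightarrow> sat MM ((!) (map v [0..<Suc m + j])) p"
                by (rule sat_cong) (use j[OF p] in \<open>auto simp del: upt_Suc\<close>)
              then show ?thesis using v(3) p by (simp add: holds_def l del: append_assoc)
            qed
            moreover have "(xs @ ys) @ z \<in> tup (Suc m + j)"
              using 2 z unfolding tuples_append by blast
            ultimately have "(xs @ ys) @ z \<in> X" by (simp add: X_def)
            with z show "\<exists>z\<in>tup j. (xs @ ys) @ z \<in> X" by blast
          qed
          then show ?thesis using 2 by (simp only: mem_Collect_eq 1 simp_thms)
        qed
        then show ?thesis unfolding Z_def by blast
      qed
      finally show ?thesis by simp
    qed
    have "\<exists>a\<in>tup 1. \<forall>\<Phi>0\<in>?I. a \<in> Z \<Phi>0"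
    proof (rule ccontr)
      assume no: "\<not> (\<exists>a\<in>tup 1. \<forall>\<Phi>0\<in>?I. a \<in> Z \<Phi>0)"
      obtain \<Phi>0 where \<Phi>0: "\<Phi>0 \<in> ?I" "\<And>a. a \<in> tup 1 \<Longrightarrow> a \<in> Z \<Phi>0 \<Longrightarrow> a \<in> {}"
      proof (rule compactness[of "set xs" 1 "tup 1" ?I Z "{}"])
        show "small (set xs)" using xs by (intro small_finite) (auto simp: ext_def)
        show "type_definable L MM (set xs) 1 (tup 1)"
          by (intro definable_type_definable definable_tuples carrier_nonempty)
        show "?I \<noteq> {}" by blast
        show "definable L MM (set xs) 1 {}" by (intro definable_empty carrier_nonempty)
        show "\<exists>l\<in>?I. Z l \<subseteq> Z i \<inter> Z j" if "i \<in> ?I" "j \<in> ?I" for i j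
        proof -
          have "E i ys" "E j ys" if "E (i \<union> j) ys" for ys
            using that unfolding E_def by blast+
          then show ?thesis
            using that by (intro bexI[of _ "i \<union> j"]) (auto simp: Z_def)
        qed
        show "a \<in> {}" if "a \<in> tup 1" "\<And>i. i \<in> ?I \<Longrightarrow> a \<in> Z i" for a
          using no that by blast
      qed (use def in auto)
      from \<Phi>0(1) xs have "E \<Phi>0 xs" by (auto simp: ext_def)
      then obtain v where v: "range v \<subseteq> carrier MM" "\<forall>i<length xs. v i = xs ! i" "\<forall>p\<in>\<Phi>0. sat MM v p"
        by (auto simp: E_def)
      have "E \<Phi>0 (xs @ [v (length xs)])"
        unfolding E_def by (rule exI[of _ v]) (use v in \<open>auto simp: nth_append less_Suc_eq\<close>)
      moreover have "[v (length xs)] \<in> tup 1" using v(1) by (auto simp: tuples_def)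
      ultimately show False using \<Phi>0(2) by (auto simp: Z_def)
    qed
    then obtain a where a: "a \<in> tup 1" "\<forall>\<Phi>0\<in>?I. a \<in> Z \<Phi>0" by blast
    then obtain y where "a = [y]" "y \<in> carrier MM" by (cases a) (auto simp: tuples_def)
    with a xs have "ext (xs @ [y])" by (auto simp: ext_def Z_def)
    then show ?thesis by blast
  qed
  have "\<exists>f. \<forall>n. (ext (f n) \<and> length (f n) = n) \<and> (\<exists>a. f (Suc n) = f n @ [a])"
  proof (rule dependent_nat_choice)
    have "E \<Phi>0 []" if "\<Phi>0 \<in> ?I" for \<Phi>0 using fip[of \<Phi>0] that by (simp add: E_def)
    then show "\<exists>xs. ext xs \<and> length xs = 0" by (auto simp: ext_def)
    show "\<exists>ys. (ext ys \<and> length ys = Suc n) \<and> (\<exists>a. ys = xs @ [a])" if xs: "ext xs \<and> length xs = n" for xs n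
    proof -
      obtain a where "ext (xs @ [a])" using step[of xs] xs by blast
      with xs show ?thesis by (intro exI[of _ "xs @ [a]"]) auto
    qed
  qed
  then obtain f where f: "\<And>n. ext (f n)" "\<And>n. length (f n) = n" "\<And>n. \<exists>a. f (Suc n) = f n @ [a]"
    by blast
  define v where "v n = f (Suc n) ! n" for n
  have v: "f n ! i = v i" if "i < n" for i n
    using that
  proof (induction n)
    case (Suc n)
    obtain a where "f (Suc n) = f n @ [a]" using f(3) by blast
    then show ?case
      using Suc f(2)[of n] by (cases "i = n") (auto simp: v_def nth_append)
  qed simp
  have "range v \<subseteq> carrier MM"
  proof
    fix x assume "x \<in> range v"
    then obtain n where n: "x = f (Suc n) ! n" by (auto simp: v_def)
    have "set (f (Suc n)) \<subseteq> carrier MM" using f(1) by (simp add: ext_def)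
    moreover have "x \<in> set (f (Suc n))" using f(2)[of "Suc n"] by (simp add: n)
    ultimately show "x \<in> carrier MM" by blast
  qed
  moreover have "sat MM v p" if p: "p \<in> \<Phi>" for p
  proof -
    obtain K where K: "fv p \<subseteq> {..<K}" by (metis finite_fv finite_nat_iff_bounded)
    have "{p} \<in> ?I" using p by simp
    then have "E {p} (f K)" using f(1)[of K] by (simp only: ext_def)
    then obtain w where w: "\<forall>i<K. w i = f K ! i" "sat MM w p" using f(2)[of K] by (auto simp: E_def)
    have "sat MM w p \<longleftrightarrow> sat MM v p"
      by (rule sat_cong) (use K w(1) v in auto)
    with w(2) show ?thesis by simp
  qed
  ultimately show ?thesis by blast
qed

end

section \<open>Shattering of finite grids and the independence property\<close>

lemma length_concat_map_upt: "length (concat (map (\<lambda>j. map (f j) [0..<m j]) [0..<n])) = (\<Sum>j<n. m j)"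
  by (simp add: length_concat comp_def interv_sum_list_conv_sum_set_nat atLeast0LessThan)

lemma grid_mono: "l \<le> l' \<Longrightarrow> grid n l \<subseteq> grid n l'"
  by (auto simp: grid_def)

context monster
begin

lemma conj_fm:
  assumes "finite \<Phi>" and "\<And>p. p \<in> \<Phi> \<Longrightarrow> wf_fm L p"
  obtains q where "wf_fm L q" "\<And>v. sat MM v q \<longleftrightarrow> (\<forall>p\<in>\<Phi>. sat MM v p)"
proof -
  have "\<exists>q. wf_fm L q \<and> (\<forall>v. sat MM v q \<longleftrightarrow> (\<forall>p\<in>\<Phi>. sat MM v p))"
    using assms
  proof (induction \<Phi> rule: finite_induct)
    case empty
    then show ?case
      using carrier_nonempty by (intro exI[of _ verum]) (auto simp: verum_def)
  next
    case (insert p \<Phi>)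
    then obtain q where "wf_fm L q" "\<forall>v. sat MM v q \<longleftrightarrow> (\<forall>p\<in>\<Phi>. sat MM v p)" by auto
    then show ?case
      using insert.prems by (intro exI[of _ "Conj p q"]) auto
  qed
  then show thesis using that by blast
qed

text \<open>In the next lemmas the even variables hold the tuple \<open>x\<close> of a formula \<open>p(x; y)\<close>, the odd
  ones an infinite array of parameters.\<close>

definition overwrite :: "'a list \<Rightarrow> (nat \<Rightarrow> 'a) \<Rightarrow> nat \<Rightarrow> 'a" where
  "overwrite b v x = (if even x \<and> x div 2 < length b then b ! (x div 2) else v x)"

lemma ex_block_fm:
  assumes "wf_fm L p"
  obtains q where "wf_fm L q" "\<And>v. sat MM v q \<longleftrightarrow> (\<exists>b\<in>tup k. sat MM (overwrite b v) p)"
proof -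
  have "\<exists>q. wf_fm L q \<and> (\<forall>v. sat MM v q \<longleftrightarrow> (\<exists>b\<in>tup k. sat MM (overwrite b v) p))"
    using assms
  proof (induction k arbitrary: p)
    case 0
    have "overwrite [] v = v" for v :: "nat \<Rightarrow> 'a" by (simp add: overwrite_def fun_eq_iff)
    then show ?case using 0 by (intro exI[of _ p]) (auto simp: tuples_def)
  next
    case (Suc k)
    then have "wf_fm L (Ex (2 * k) p)" by simp
    from Suc.IH[OF this] obtain q where
      q: "wf_fm L q" "\<forall>v. sat MM v q \<longleftrightarrow> (\<exists>b\<in>tup k. sat MM (overwrite b v) (Ex (2 * k) p))" by blast
    have upd: "(overwrite b v)(2 * k := a) = overwrite (b @ [a]) v" if "length b = k" for b v a
      using that by (auto simp: overwrite_def fun_eq_iff nth_append less_Suc_eq elim!: evenE)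
    have "(\<exists>b\<in>tup k. sat MM (overwrite b v) (Ex (2 * k) p)) \<longleftrightarrow> (\<exists>b\<in>tup (Suc k). sat MM (overwrite b v) p)"
      for v
    proof
      assume "\<exists>b\<in>tup k. sat MM (overwrite b v) (Ex (2 * k) p)"
      then obtain b a where "b \<in> tup k" "a \<in> carrier MM" "sat MM ((overwrite b v)(2 * k := a)) p" by auto
      then have "b @ [a] \<in> tup (Suc k)" "sat MM (overwrite (b @ [a]) v) p"
        using upd[of b v a] by (auto simp: tuples_def)
      then show "\<exists>b\<in>tup (Suc k). sat MM (overwrite b v) p" by blast
    next
      assume "\<exists>b\<in>tup (Suc k). sat MM (overwrite b v) p"
      then obtain b' where b': "b' \<in> tup (Suc k)" "sat MM (overwrite b' v) p" by blast
      then obtain b a where ba: "b' = b @ [a]" by (cases b' rule: rev_cases) (auto simp: tuples_def)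
      then have "b \<in> tup k" "a \<in> carrier MM" using b'(1) by (auto simp: tuples_def)
      moreover have "sat MM ((overwrite b v)(2 * k := a)) p"
        using b' ba upd[of b v a] \<open>b \<in> tup k\<close> by (simp add: tuples_def)
      ultimately show "\<exists>b\<in>tup k. sat MM (overwrite b v) (Ex (2 * k) p)" by auto
    qed
    with q show ?case by auto
  qed
  then show thesis using that by blast
qed

text \<open>The odd variable for entry \<open>pos\<close> of the i-th tuple in direction j of the
  array.\<close>

definition code :: "nat \<Rightarrow> nat \<Rightarrow> nat \<Rightarrow> nat" where
  "code j i pos = Suc (2 * prod_encode (j, prod_encode (i, pos)))"

lemma code_eq [simp]: "code j i pos = code j' i' pos' \<longleftrightarrow> j = j' \<and> i = i' \<and> pos = pos'"
  by (auto simp: code_def)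

definition array :: "(nat \<Rightarrow> nat) \<Rightarrow> (nat \<Rightarrow> 'a) \<Rightarrow> nat \<Rightarrow> nat \<Rightarrow> 'a list" where
  "array m v j i = map (\<lambda>pos. v (code j i pos)) [0..<m j]"

text \<open>The independence property cut down to a finite grid and a single subset S, so that one
  formula in the variables of the array can express it.\<close>

definition shatters ::
    "('f, 'r) fm \<Rightarrow> nat \<Rightarrow> nat \<Rightarrow> (nat \<Rightarrow> nat \<Rightarrow> 'a list) \<Rightarrow> nat \<Rightarrow> nat list set \<Rightarrow> bool" where
  "shatters p k n a l S \<longleftrightarrow> (\<exists>b\<in>tup k. \<forall>q\<in>grid n l.
     holds MM p (b @ concat (map (\<lambda>j. a j (q ! j)) [0..<n])) \<longleftrightarrow> q \<in> S)"

lemma shatters_fm: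
  assumes p: "p \<in> fmls L (k + (\<Sum>j<n. m j))"
  obtains q where "wf_fm L q" "\<And>v. sat MM v q \<longleftrightarrow> shatters p k n (array m v) l S"
proof -
  \<comment> \<open>The variables substituted into p at the point q: even ones for x, and those of
    the array for the tuples that q selects.\<close>
  define c where "c q = map (\<lambda>i. 2 * i) [0..<k] @ concat (map (\<lambda>j. map (code j (q ! j)) [0..<m j]) [0..<n])"
    for q :: "nat list"
  have len: "length (c q) = k + (\<Sum>j<n. m j)" for q
    by (simp add: c_def length_concat_map_upt)
  have over: "map (overwrite b v) (c q) = b @ concat (map (\<lambda>j. array m v j (q ! j)) [0..<n])"
    if "length b = k" for b v q
  proof -
    have "map (overwrite b v) (map (\<lambda>i. 2 * i) [0..<k]) = b"
      using that by (intro nth_equalityI) (auto simp: overwrite_def)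
    moreover have "overwrite b v (code j i pos) = v (code j i pos)" for j i pos
      by (simp add: overwrite_def code_def)
    ultimately show ?thesis by (simp add: c_def array_def map_concat comp_def)
  qed
  have sat: "sat MM (overwrite b v) (ren ((!) (c q)) p)
      \<longleftrightarrow> holds MM p (b @ concat (map (\<lambda>j. array m v j (q ! j)) [0..<n]))"
    if "length b = k" for b v q
  proof -
    have "sat MM (overwrite b v) (ren ((!) (c q)) p) \<longleftrightarrow> sat MM (overwrite b v \<circ> (!) (c q)) p"
      by (rule sat_ren)
    also have "\<dots> \<longleftrightarrow> sat MM ((!) (map (overwrite b v) (c q))) p"
      by (rule sat_cong) (use p len[of q] in \<open>auto simp: fmls_def\<close>)
    finally show ?thesis by (simp add: holds_def over[OF that])
  qed
  define \<phi> where "\<phi> q = (if q \<in> S then ren ((!) (c q)) p else Neg (ren ((!) (c q)) p))" for q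
  have "wf_fm L (\<phi> q)" for q using p by (simp add: \<phi>_def fmls_def wf_ren)
  then obtain r where r: "wf_fm L r" "\<And>v. sat MM v r \<longleftrightarrow> (\<forall>s\<in>\<phi> ` grid n l. sat MM v s)"
    using conj_fm[of "\<phi> ` grid n l", OF finite_imageI[OF finite_grid]] by (metis imageE)
  obtain q where q: "wf_fm L q" "\<And>v. sat MM v q \<longleftrightarrow> (\<exists>b\<in>tup k. sat MM (overwrite b v) r)"
    using ex_block_fm[OF r(1)] by blast
  have "sat MM v q \<longleftrightarrow> shatters p k n (array m v) l S" for v
  proof -
    have "sat MM (overwrite b v) (\<phi> q) \<longleftrightarrow>
        (holds MM p (b @ concat (map (\<lambda>j. array m v j (q ! j)) [0..<n])) \<longleftrightarrow> q \<in> S)" if "b \<in> tup k" for b q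
      using sat[of b v q] that by (simp add: \<phi>_def tuples_def)
    then have "sat MM (overwrite b v) r \<longleftrightarrow>
        (\<forall>q\<in>grid n l. holds MM p (b @ concat (map (\<lambda>j. array m v j (q ! j)) [0..<n])) \<longleftrightarrow> q \<in> S)"
      if "b \<in> tup k" for b
      using that by (simp add: r(2))
    then show ?thesis by (simp add: q(2) shatters_def)
  qed
  with q(1) show thesis by (rule that)
qed

text \<open>Saturation is used twice: for the array, whose conditions concern finite grids only, and
  then for each subset of the infinite grid, over the countable set of entries of the array.\<close>

lemma n_independence_if_shatters:
  assumes p: "p \<in> fmls L (k + (\<Sum>j<n. m j))"
    and sh: "\<And>l. \<exists>a. (\<forall>j<n. \<forall>i<l. a j i \<in> tup (m j)) \<and> (\<forall>S\<subseteq>grid n l. shatters p k n a l S)"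
  shows "n_independence_property TYPE('a) L n T p k m"
proof -
  \<comment> \<open>Membership is by equivalence, so that no formula has to be chosen for each l and
    S.\<close>
  define \<Phi> where "\<Phi> = {q. wf_fm L q \<and> (\<exists>l. \<exists>S\<subseteq>grid n l. \<forall>v. sat MM v q \<longleftrightarrow> shatters p k n (array m v) l S)}"
  have "\<exists>v. range v \<subseteq> carrier MM \<and> (\<forall>q\<in>\<Phi>. sat MM v q)"
  proof (rule countable_saturation[of \<Phi>])
    show "wf_fm L q" if "q \<in> \<Phi>" for q using that by (simp add: \<Phi>_def)
    fix \<Phi>0 assume \<Phi>0: "finite \<Phi>0" "\<Phi>0 \<subseteq> \<Phi>"
    then have "\<forall>q\<in>\<Phi>0. \<exists>l. \<exists>S\<subseteq>grid n l. \<forall>v. sat MM v q \<longleftrightarrow> shatters p k n (array m v) l S"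
      by (auto simp: \<Phi>_def)
    from bchoice[OF this] obtain l where
      l: "\<forall>q\<in>\<Phi>0. \<exists>S\<subseteq>grid n (l q). \<forall>v. sat MM v q \<longleftrightarrow> shatters p k n (array m v) (l q) S"
      by (elim exE)
    \<comment> \<open>One grid large enough for all the conditions; shattering it includes
      shattering the smaller ones.\<close>
    define l0 where "l0 = Max (insert 0 (l ` \<Phi>0))"
    have l0: "l q \<le> l0" if "q \<in> \<Phi>0" for q
      using that \<Phi>0(1) by (simp add: l0_def)
    obtain a where a: "\<And>j i. j < n \<Longrightarrow> i < l0 \<Longrightarrow> a j i \<in> tup (m j)"
      "\<And>S. S \<subseteq> grid n l0 \<Longrightarrow> shatters p k n a l0 S"
      using sh[of l0] by blast
    obtain c where c: "c \<in> carrier MM" using carrier_nonempty by blast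
    define v where "v x = (case prod_decode (x div 2) of (j, y) \<Rightarrow> case prod_decode y of (i, pos) \<Rightarrow>
        if j < n \<and> i < l0 \<and> pos < m j then a j i ! pos else c)" for x
    have v_code: "v (code j i pos) = (if j < n \<and> i < l0 \<and> pos < m j then a j i ! pos else c)" for j i pos
      by (simp add: v_def code_def)
    have nth: "a j i ! pos \<in> carrier MM" if "j < n \<and> i < l0 \<and> pos < m j" for j i pos
      using a(1)[of j i] that by (auto simp: tuples_def)
    have "range v \<subseteq> carrier MM"
      using nth c by (auto simp: v_def split: prod.splits)
    moreover have arr: "array m v j i = a j i" if "j < n" "i < l0" for j i
      using a(1)[OF that] that by (intro nth_equalityI) (auto simp: array_def v_code tuples_def)
    have "sat MM v q" if q: "q \<in> \<Phi>0" for q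
    proof -
      obtain S where S: "S \<subseteq> grid n (l q)" "\<forall>v. sat MM v q \<longleftrightarrow> shatters p k n (array m v) (l q) S"
        using l q by blast
      have sub: "grid n (l q) \<subseteq> grid n l0" using grid_mono[OF l0[OF q]] .
      with a(2)[of S] S(1) obtain b where b: "b \<in> tup k"
        "\<forall>q\<in>grid n l0. holds MM p (b @ concat (map (\<lambda>j. a j (q ! j)) [0..<n])) \<longleftrightarrow> q \<in> S"
        unfolding shatters_def by blast
      have "holds MM p (b @ concat (map (\<lambda>j. array m v j (r ! j)) [0..<n])) \<longleftrightarrow> r \<in> S"
        if r: "r \<in> grid n (l q)" for r
      proof -
        have r': "r \<in> grid n l0" using r sub by blast
        have eq: "map (\<lambda>j. array m v j (r ! j)) [0..<n] = map (\<lambda>j. a j (r ! j)) [0..<n]"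
          using gridD(2)[OF r'] by (auto simp: arr)
        show ?thesis unfolding eq using b(2) r' by blast
      qed
      with b(1) S(2) show ?thesis by (auto simp: shatters_def)
    qed
    ultimately show "\<exists>v. range v \<subseteq> carrier MM \<and> (\<forall>p\<in>\<Phi>0. sat MM v p)" by blast
  qed
  then obtain v where v: "range v \<subseteq> carrier MM" "\<And>q. q \<in> \<Phi> \<Longrightarrow> sat MM v q" by blast
  have shv: "shatters p k n (array m v) l S" if S: "S \<subseteq> grid n l" for l S
  proof -
    obtain q where q: "wf_fm L q" "\<And>v. sat MM v q \<longleftrightarrow> shatters p k n (array m v) l S"
      using shatters_fm[OF p] by blast
    then have "q \<in> \<Phi>" using S by (auto simp: \<Phi>_def)
    with v(2) q(2) show ?thesis by blast
  qed
  define d where "d q = concat (map (\<lambda>j. array m v j (q ! j)) [0..<n])" for q :: "nat list"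
  have d: "d q \<in> lists (range v)" "length (d q) = (\<Sum>j<n. m j)" for q
    by (auto simp: d_def array_def length_concat_map_upt)
  have small: "small (range v)"
  proof -
    have "|range v| \<le>o natLeq"
      by (meson card_of_image card_of_nat ordLeq_ordIso_trans)
    moreover have "natLeq <o \<kappa>" using monster by (simp add: monster_model_def strongly_inaccessible_def)
    ultimately show ?thesis using v(1) by (simp add: small_def ordLeq_ordLess_trans)
  qed
  have "\<exists>b\<in>tup k. \<forall>is. length is = n \<longrightarrow> (holds MM p (b @ d is) \<longleftrightarrow> is \<in> s)"
    if s: "s \<subseteq> {is. length is = n}" for s
  proof -
    define Z where "Z q = (if q \<in> s then {b\<in>tup k. holds MM p (b @ d q)}
        else tup k - {b\<in>tup k. holds MM p (b @ d q)})" for q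
    have "\<exists>b\<in>tup k. \<forall>X\<in>Z ` {q. length q = n}. b \<in> X"
    proof (rule saturation[OF small])
      show "definable L MM (range v) k X" if "X \<in> Z ` {q. length q = n}" for X
        using that p d by (auto simp: Z_def intro!: definable_compl definableI)
      fix F assume F: "finite F" "F \<subseteq> Z ` {q. length q = n}"
      from finite_subset_image[OF this] obtain J where J: "J \<subseteq> {q. length q = n}" "finite J" "F = Z ` J"
        by (elim exE conjE)
      have "finite (\<Union>q\<in>J. set q)" using J(2) by blast
      then obtain l where "(\<Union>q\<in>J. set q) \<subseteq> {..<l}" by (metis finite_nat_iff_bounded)
      then have Jl: "J \<subseteq> grid n l" using J(1) by (auto simp: grid_def)
      from shv[of "s \<inter> grid n l" l] obtain b where b: "b \<in> tup k"
        "\<forall>q\<in>grid n l. holds MM p (b @ d q) \<longleftrightarrow> q \<in> s \<inter> grid n l"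
        unfolding shatters_def d_def by blast
      have "b \<in> Z q" if "q \<in> J" for q
        using b that Jl by (auto simp: Z_def)
      with b(1) J(3) show "\<exists>b\<in>tup k. \<forall>X\<in>F. b \<in> X" by auto
    qed
    then obtain b where b: "b \<in> tup k" "\<forall>X\<in>Z ` {q. length q = n}. b \<in> X" by (rule bexE)
    have "holds MM p (b @ d q) \<longleftrightarrow> q \<in> s" if "length q = n" for q
    proof -
      have "b \<in> Z q" using b(2) that by blast
      then show ?thesis by (auto simp: Z_def split: if_splits)
    qed
    with b(1) show ?thesis by blast
  qed
  moreover have "array m v j i \<in> tup (m j)" for j i
    using v(1) by (auto simp: array_def tuples_def)
  moreover have "models L MM T" using monster by (simp add: monster_model_def)
  ultimately show ?thesis
    unfolding n_independence_property_def d_def by blast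
qed

end

section \<open>Filtrations defined by formulas\<close>

text \<open>The coordinates of a grid point are infinite sequences, since the parameters from M come
  as a sequence. A finite tuple is continued by a constant, which has to be fixed by the
  automorphisms in use (\<open>comp_pad\<close>).\<close>

definition pad :: "'a \<Rightarrow> 'a list \<Rightarrow> nat \<Rightarrow> 'a" where
  "pad c xs i = (if i < length xs then xs ! i else c)"

lemma range_pad: "range (pad c xs) \<subseteq> insert c (set xs)"
  by (auto simp: pad_def)

lemma map_pad [simp]: "map (pad c xs) [0..<length xs] = xs"
  by (intro nth_equalityI) (auto simp: pad_def)

lemma comp_pad: "f c = c \<Longrightarrow> f \<circ> pad c xs = pad c (map f xs)"
  by (auto simp: pad_def fun_eq_iff)

context monster_group
begin

definition params :: "nat \<Rightarrow> (nat \<Rightarrow> nat) \<Rightarrow> (nat \<Rightarrow> 'a) list \<Rightarrow> 'a list" where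
  "params n m x = concat (map (\<lambda>j. map (x ! j) [0..<m j]) [0..<n])"

text \<open>\<open>w r j\<close> is the number of terms of the j-th sequence that enter the formula
  of level r.\<close>

definition layer ::
    "nat \<Rightarrow> (nat \<Rightarrow> nat \<Rightarrow> nat) \<Rightarrow> (nat \<Rightarrow> ('f, 'r) fm) \<Rightarrow> nat \<Rightarrow> (nat \<Rightarrow> 'a) list \<Rightarrow> 'a list set" where
  "layer n w F r x = {g \<in> carrier G. holds MM (F r) (g @ params n (w r) x)}"

definition core ::
    "nat \<Rightarrow> (nat \<Rightarrow> nat \<Rightarrow> nat) \<Rightarrow> (nat \<Rightarrow> ('f, 'r) fm) \<Rightarrow> (nat \<Rightarrow> 'a) list \<Rightarrow> 'a list set" where
  "core n w F x = (\<Inter>r. layer n w F r x)"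

text \<open>The conditions of the locale \<open>filtered_group\<close>, spelled out for the layers
  at x. They are invariant under automorphisms fixing A, so they pass from the chain to the whole
  grid.\<close>

definition filtering ::
    "nat \<Rightarrow> (nat \<Rightarrow> nat \<Rightarrow> nat) \<Rightarrow> (nat \<Rightarrow> ('f, 'r) fm) \<Rightarrow> (nat \<Rightarrow> nat) \<Rightarrow> (nat \<Rightarrow> 'a) list set" where
  "filtering n w F N = {x. length x = n \<and> (\<forall>e\<in>set x. range e \<subseteq> carrier MM) \<and>
     (\<forall>r. F r \<in> fmls L (k + (\<Sum>j<n. w r j))) \<and>
     (\<forall>r. \<one> \<in> layer n w F r x) \<and>
     (\<forall>r. \<forall>g\<in>layer n w F (Suc r) x. \<forall>h\<in>layer n w F (Suc r) x. g \<otimes> inv h \<in> layer n w F r x) \<and>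
     (\<forall>r f. (\<forall>i<N r. f i \<in> carrier G) \<longrightarrow> (\<exists>i j. i < j \<and> j < N r \<and> f i \<otimes> inv (f j) \<in> layer n w F r x))}"

definition good ::
    "nat \<Rightarrow> (nat \<Rightarrow> nat \<Rightarrow> nat) \<Rightarrow> (nat \<Rightarrow> ('f, 'r) fm) \<Rightarrow> (nat \<Rightarrow> nat) \<Rightarrow> (nat \<Rightarrow> 'a) list set" where
  "good n w F N = {x \<in> filtering n w F N. bounded_index \<kappa> G (core n w F x)}"

lemma filtered_group: "filtered_group G (layer n w F) N (filtering n w F N)"
  by unfold_locales (auto simp: filtering_def layer_def)

lemma core_subset: "core n w F x \<subseteq> layer n w F r x"
  by (auto simp: core_def)

lemma core_carrier: "core n w F x \<subseteq> carrier G"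
  by (auto simp: core_def layer_def)

lemma core_subgroup:
  assumes x: "x \<in> filtering n w F N"
  shows "subgroup (core n w F x) G"
proof -
  interpret filtered_group G "layer n w F" N "filtering n w F N" by (rule filtered_group)
  show ?thesis
  proof (rule subgroupI)
    show "core n w F x \<subseteq> carrier G" by (rule core_carrier)
    show "core n w F x \<noteq> {}" using U_one[OF x] by (auto simp: core_def)
    show "inv a \<in> core n w F x" if "a \<in> core n w F x" for a
      using that U_inv[OF x] by (auto simp: core_def)
    show "a \<otimes> b \<in> core n w F x" if "a \<in> core n w F x" "b \<in> core n w F x" for a b
      using that U_mult[OF x] by (auto simp: core_def)
  qed
qed

lemma length_params: "length (params n m x) = (\<Sum>j<n. m j)"
  by (simp add: params_def length_concat_map_upt)

lemma set_params: "set (params n m x) = (\<Union>j<n. (x ! j) ` {..<m j})"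
  by (auto simp: params_def)

lemma core_type_definable:
  assumes x: "x \<in> filtering n w F N" and B: "A \<subseteq> B" "\<And>r. set (params n (w r) x) \<subseteq> B"
  shows "type_definable L MM B k (core n w F x)"
proof -
  let ?V = "\<lambda>r. {g\<in>tup k. holds MM (F r) (g @ params n (w r) x)}"
  have "definable L MM B k (?V r)" for r
    using x B(2)[of r] by (intro definableI) (auto simp: filtering_def length_params)
  then have "type_definable L MM B k {g\<in>tup k. \<forall>r\<in>UNIV. g \<in> ?V r}"
    by (intro type_definable_INT definable_type_definable)
  then have "type_definable L MM B k (carrier G \<inter> {g\<in>tup k. \<forall>r\<in>UNIV. g \<in> ?V r})"
    by (rule type_definable_Int[OF type_definable_carrier[OF B(1)]])
  also have "carrier G \<inter> {g\<in>tup k. \<forall>r\<in>UNIV. g \<in> ?V r} = core n w F x"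
    using carrier_tup by (auto simp: core_def layer_def)
  finally show ?thesis .
qed

text \<open>Applied in two ways: to a set B that omits one of the tuples, which places the generic
  part in every group not mentioning that tuple, and to C with all tuples, for the groups of the
  longest chains.\<close>

lemma G00_subset_core:
  assumes x: "x \<in> good n w F N" and B: "A \<subseteq> B" "\<And>r. set (params n (w r) x) \<subseteq> B"
  shows "G00 L MM \<kappa> k G B \<subseteq> core n w F x"
proof -
  have f: "x \<in> filtering n w F N" using x by (simp add: good_def)
  then show ?thesis
    using core_subgroup[OF f] core_type_definable[OF f B] x by (auto simp: G00_def good_def)
qed

text \<open>G and its graph are type-definable over A, and type-definable sets are invariant under
  automorphisms fixing their parameters.\<close>

lemma automorphism_group:
  assumes \<sigma>: "automorphism L MM \<sigma>" "\<forall>x\<in>A. \<sigma> x = x"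
  shows "g \<in> carrier G \<Longrightarrow> map \<sigma> g \<in> carrier G"
    and "g \<in> carrier G \<Longrightarrow> h \<in> carrier G \<Longrightarrow> map \<sigma> (g \<otimes> h) = map \<sigma> g \<otimes> map \<sigma> h"
proof -
  have A: "A \<subseteq> carrier MM" using small_A by (simp add: small_def)
  show cl: "map \<sigma> g \<in> carrier G" if "g \<in> carrier G" for g
    using type_definable_automorphism[OF type_definable_carrier[OF subset_refl] \<sigma>(1) is_struct \<sigma>(2) A]
      that carrier_tup by blast
  show "map \<sigma> (g \<otimes> h) = map \<sigma> g \<otimes> map \<sigma> h" if gh: "g \<in> carrier G" "h \<in> carrier G"
  proof -
    have "g @ h @ (g \<otimes> h) \<in> tup (3 * k)"
      unfolding tuples3 using gh carrier_tup m_closed by blast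
    moreover have "g @ h @ (g \<otimes> h) \<in> graph" using gh by (auto simp: graph_def)
    ultimately have "map \<sigma> (g @ h @ (g \<otimes> h)) \<in> graph"
      using type_definable_automorphism[OF type_definable_graph[OF subset_refl] \<sigma>(1) is_struct \<sigma>(2) A]
      by blast
    then have "map \<sigma> g @ map \<sigma> h @ map \<sigma> (g \<otimes> h) \<in> graph" by simp
    moreover have "map \<sigma> g \<in> tup k" "map \<sigma> h \<in> tup k" "map \<sigma> (g \<otimes> h) \<in> tup k"
      using gh cl carrier_tup by (meson m_closed subsetD)+
    ultimately show ?thesis using graph_iff by simp
  qed
qed

lemma automorphism_div:
  assumes \<sigma>: "automorphism L MM \<sigma>" "\<forall>x\<in>A. \<sigma> x = x" and gh: "g \<in> carrier G" "h \<in> carrier G"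
  shows "map \<sigma> (g \<otimes> inv h) = map \<sigma> g \<otimes> inv (map \<sigma> h)"
proof -
  have "map \<sigma> (g \<otimes> inv h) \<otimes> map \<sigma> h = map \<sigma> g"
    using automorphism_group(2)[OF \<sigma>, of "g \<otimes> inv h" h] gh by (simp add: m_assoc)
  then show ?thesis
    using automorphism_group(1)[OF \<sigma>] gh by (metis inv_closed inv_solve_right m_closed)
qed

lemma params_comp: "length x = n \<Longrightarrow> params n m (map ((\<circ>) \<sigma>) x) = map \<sigma> (params n m x)"
  by (auto simp: params_def map_concat intro!: arg_cong[where f = concat])

lemma set_params_carrier:
  "length x = n \<Longrightarrow> \<forall>e\<in>set x. range e \<subseteq> carrier MM \<Longrightarrow> set (params n m x) \<subseteq> carrier MM"
  by (fastforce simp: set_params)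

lemma layer_automorphism:
  assumes \<sigma>: "automorphism L MM \<sigma>" "\<forall>x\<in>A. \<sigma> x = x"
    and x: "length x = n" "\<forall>e\<in>set x. range e \<subseteq> carrier MM" "F r \<in> fmls L (k + (\<Sum>j<n. w r j))"
    and g: "g \<in> carrier G"
  shows "map \<sigma> g \<in> layer n w F r (map ((\<circ>) \<sigma>) x) \<longleftrightarrow> g \<in> layer n w F r x"
proof -
  have "holds MM (F r) (map \<sigma> (g @ params n (w r) x)) \<longleftrightarrow> holds MM (F r) (g @ params n (w r) x)"
  proof (rule automorphism_holds[OF \<sigma>(1) is_struct])
    show "F r \<in> fmls L (length (g @ params n (w r) x))"
      using x(3) g by (simp add: length_params carrier_length)
    have "g \<in> tup k" using g carrier_tup by (rule subsetD[rotated])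
    then show "set (g @ params n (w r) x) \<subseteq> carrier MM"
      using set_params_carrier[OF x(1,2)] by (simp add: tuples_def)
  qed
  then show ?thesis
    using g automorphism_group(1)[OF \<sigma> g] by (simp add: layer_def params_comp[OF x(1)])
qed

lemma core_automorphism:
  assumes \<sigma>: "automorphism L MM \<sigma>" "\<forall>x\<in>A. \<sigma> x = x" and x: "x \<in> filtering n w F N" and g: "g \<in> carrier G"
  shows "map \<sigma> g \<in> core n w F (map ((\<circ>) \<sigma>) x) \<longleftrightarrow> g \<in> core n w F x"
  using layer_automorphism[OF \<sigma> _ _ _ g] x by (simp add: core_def filtering_def)

lemma automorphism_group_surj:
  assumes \<sigma>: "automorphism L MM \<sigma>" "\<forall>x\<in>A. \<sigma> x = x" and g: "g \<in> carrier G"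
  obtains h where "h \<in> carrier G" "map \<sigma> h = g"
proof -
  let ?\<tau> = "inv_into (carrier MM) \<sigma>"
  have bij: "bij_betw \<sigma> (carrier MM) (carrier MM)" using \<sigma>(1) by (simp add: automorphism_def)
  have \<tau>: "automorphism L MM ?\<tau>" by (rule automorphism_inv[OF \<sigma>(1) is_struct])
  have "\<forall>x\<in>A. ?\<tau> x = x"
    using \<sigma>(2) small_A bij by (metis bij_betw_inv_into_left small_def subsetD)
  then have "map ?\<tau> g \<in> carrier G" by (rule automorphism_group(1)[OF \<tau> _ g])
  moreover have "map \<sigma> (map ?\<tau> g) = g"
    using g carrier_tup bij
    by (auto simp: tuples_def subset_iff bij_betw_def f_inv_into_f intro!: map_idI)
  ultimately show thesis by (rule that)
qed

text \<open>Elements of G are pulled back by \<open>automorphism_group_surj\<close>, the conditions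
  at x are applied, and the result is mapped forward. Representatives for the core are mapped
  forward as well.\<close>

lemma good_automorphism:
  assumes \<sigma>: "automorphism L MM \<sigma>" "\<forall>x\<in>A. \<sigma> x = x" and x: "x \<in> good n w F N"
  shows "map ((\<circ>) \<sigma>) x \<in> good n w F N"
proof -
  let ?x = "map ((\<circ>) \<sigma>) x"
  have x': "length x = n" "\<forall>e\<in>set x. range e \<subseteq> carrier MM" "\<And>r. F r \<in> fmls L (k + (\<Sum>j<n. w r j))"
    and xf: "x \<in> filtering n w F N"
    using x by (auto simp: good_def filtering_def)
  interpret filtered_group G "layer n w F" N "filtering n w F N" by (rule filtered_group)
  have lay: "map \<sigma> g \<in> layer n w F r ?x \<longleftrightarrow> g \<in> layer n w F r x" if "g \<in> carrier G" for g r
    by (rule layer_automorphism[OF \<sigma> x' that])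
  note cl = automorphism_group(1)[OF \<sigma>]
  have "map \<sigma> \<one> = \<one>"
    using automorphism_div[OF \<sigma> one_closed one_closed] cl[OF one_closed] by simp
  then have 1: "\<one> \<in> layer n w F r ?x" for r
    using lay[OF one_closed, of r] U_one[OF xf] by simp
  have 2: "g \<otimes> inv h \<in> layer n w F r ?x"
    if gh: "g \<in> layer n w F (Suc r) ?x" "h \<in> layer n w F (Suc r) ?x" for g h r
  proof -
    obtain g' where g': "g' \<in> carrier G" "map \<sigma> g' = g"
      using automorphism_group_surj[OF \<sigma>, of g] gh(1) by (auto simp: layer_def)
    obtain h' where h': "h' \<in> carrier G" "map \<sigma> h' = h"
      using automorphism_group_surj[OF \<sigma>, of h] gh(2) by (auto simp: layer_def)
    have "g' \<otimes> inv h' \<in> layer n w F r x"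
      using gh lay[OF g'(1), of "Suc r"] lay[OF h'(1), of "Suc r"] g'(2) h'(2) by (intro U_div[OF xf]) auto
    then show ?thesis
      using lay[of "g' \<otimes> inv h'" r] automorphism_div[OF \<sigma> g'(1) h'(1)] g' h' by simp
  qed
  have 3: "\<exists>i j. i < j \<and> j < N r \<and> f i \<otimes> inv (f j) \<in> layer n w F r ?x"
    if f: "\<forall>i<N r. f i \<in> carrier G" for r f
  proof -
    have "\<forall>i\<in>{..<N r}. \<exists>h. h \<in> carrier G \<and> map \<sigma> h = f i"
      using f automorphism_group_surj[OF \<sigma>] by (metis lessThan_iff)
    from bchoice[OF this] obtain h where h: "\<forall>i\<in>{..<N r}. h i \<in> carrier G \<and> map \<sigma> (h i) = f i" by (elim exE)
    then have "\<exists>i j. i < j \<and> j < N r \<and> h i \<otimes> inv (h j) \<in> layer n w F r x"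
      by (intro U_cover[OF xf]) auto
    then obtain i j where ij: "i < j" "j < N r" "h i \<otimes> inv (h j) \<in> layer n w F r x" by blast
    then have "map \<sigma> (h i \<otimes> inv (h j)) \<in> layer n w F r ?x"
      using lay[of "h i \<otimes> inv (h j)" r] h by auto
    then have "f i \<otimes> inv (f j) \<in> layer n w F r ?x"
      using automorphism_div[OF \<sigma>, of "h i" "h j"] h ij by auto
    with ij show ?thesis by blast
  qed
  have "\<forall>e\<in>set ?x. range e \<subseteq> carrier MM"
    using x'(2) automorphism_closed[OF \<sigma>(1)] by (fastforce simp: comp_def)
  then have f: "?x \<in> filtering n w F N"
    using x' 1 2 3 by (simp add: filtering_def)
  obtain X where X: "X \<subseteq> carrier G" "|X| <o \<kappa>" "\<forall>g\<in>carrier G. \<exists>y\<in>X. g \<otimes> inv y \<in> core n w F x"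
  proof -
    have "bounded_index \<kappa> G (core n w F x)" using x by (simp add: good_def)
    from this[unfolded bounded_index_iff[OF core_subgroup[OF xf]]] show thesis
      by (elim exE conjE) (rule that)
  qed
  have "\<exists>X'\<subseteq>carrier G. |X'| <o \<kappa> \<and> (\<forall>g\<in>carrier G. \<exists>y\<in>X'. g \<otimes> inv y \<in> core n w F ?x)"
  proof (intro exI conjI ballI)
    show "map \<sigma> ` X \<subseteq> carrier G" using X(1) cl by blast
    show "|map \<sigma> ` X| <o \<kappa>" using card_of_image X(2) by (rule ordLeq_ordLess_trans)
    fix g assume "g \<in> carrier G"
    then obtain g' where g': "g' \<in> carrier G" "map \<sigma> g' = g" by (rule automorphism_group_surj[OF \<sigma>])
    with X obtain y where y: "y \<in> X" "g' \<otimes> inv y \<in> core n w F x" by blast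
    then have yG: "y \<in> carrier G" using X(1) by blast
    then have "map \<sigma> (g' \<otimes> inv y) \<in> core n w F ?x"
      using core_automorphism[OF \<sigma> xf, of "g' \<otimes> inv y"] y g' by simp
    then have "g \<otimes> inv (map \<sigma> y) \<in> core n w F ?x"
      using automorphism_div[OF \<sigma> g'(1) yG] g'(2) by simp
    with y(1) show "\<exists>y\<in>map \<sigma> ` X. g \<otimes> inv y \<in> core n w F ?x" by blast
  qed
  then have "bounded_index \<kappa> G (core n w F ?x)"
    using bounded_index_iff[OF core_subgroup[OF f]] by blast
  with f show ?thesis by (simp add: good_def)
qed

text \<open>Coordinate 0 is reserved for the parameters from M, which vary along a chain; the others
  hold the fixed tuples \<open>b j\<close>.\<close>

definition point_of :: "nat \<Rightarrow> 'a \<Rightarrow> (nat \<Rightarrow> 'a list) \<Rightarrow> (nat \<Rightarrow> 'a) \<Rightarrow> (nat \<Rightarrow> 'a) list" where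
  "point_of n c b D = map (\<lambda>j. if j = 0 then D else pad c (b j)) [0..<n]"

text \<open>The filtration of H involves countably many formulas with parameters from M and the
  tuples \<open>b j\<close>. All the parameters from M are listed in one sequence D, so that level r
  needs an initial segment of it, of length \<open>e r\<close>; the tuples are available in full at
  every level.\<close>

lemma good_exists:
  assumes M: "small M" "A \<subseteq> M" "c \<in> M" and b: "\<forall>j\<in>{1..<n}. set (b j) \<subseteq> carrier MM" and "n \<ge> 1"
    and H: "subgroup H G" "type_definable L MM (M \<union> (\<Union>j\<in>{1..<n}. set (b j))) k H" "bounded_index \<kappa> G H"
    and g: "g \<in> carrier G" "g \<notin> H"
  shows "\<exists>F e N D. range D \<subseteq> M \<and>
    point_of n c b D \<in> good n (\<lambda>r j. if j = 0 then e r else length (b j)) F N \<and>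
    g \<notin> layer n (\<lambda>r j. if j = 0 then e r else length (b j)) F 0 (point_of n c b D)"
proof -
  let ?B = "M \<union> (\<Union>j\<in>{1..<n}. set (b j))"
  have B: "small ?B" "A \<subseteq> ?B"
  proof -
    have "small (\<Union>j\<in>{1..<n}. set (b j))" using b by (intro small_finite) auto
    then show "small ?B" using M(1) by (rule small_Un[rotated])
    show "A \<subseteq> ?B" using M(2) by blast
  qed
  obtain V N where V: "\<And>r. definable L MM ?B k (V r)" "\<And>r. H \<subseteq> V r" "g \<notin> V 0"
    "\<And>r x y. x \<in> carrier G \<Longrightarrow> y \<in> carrier G \<Longrightarrow> x \<in> V (Suc r) \<Longrightarrow> y \<in> V (Suc r) \<Longrightarrow> x \<otimes> inv y \<in> V r"
    and N: "\<And>r f. (\<And>i. i < N r \<Longrightarrow> f i \<in> carrier G) \<Longrightarrow> \<exists>i j. i < j \<and> j < (N r :: nat) \<and> f i \<otimes> inv (f j) \<in> V r"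
    using filtration[OF B H g] by metis
  have "\<forall>r. \<exists>c. c \<in> lists ?B \<and> (\<exists>p\<in>fmls L (k + length c). V r = {a\<in>tup k. holds MM p (a @ c)})"
    using V(1) unfolding definable_def by blast
  from choice[OF this] obtain d where
    d: "\<forall>r. d r \<in> lists ?B \<and> (\<exists>p\<in>fmls L (k + length (d r)). V r = {a\<in>tup k. holds MM p (a @ d r)})"
    by (elim exE)
  \<comment> \<open>Adding c makes W nonempty, so that it is the range of a sequence.\<close>
  define W where "W = insert c (\<Union>r. set (d r) \<inter> M)"
  define D where "D = from_nat_into W"
  have "countable W" unfolding W_def by (auto intro: countable_finite)
  then have rangeD: "range D = W" unfolding D_def by (intro range_from_nat_into) (auto simp: W_def)
  have "\<exists>e. set (d r) \<inter> M \<subseteq> D ` {..<e}" for r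
  proof -
    have "finite (set (d r) \<inter> M)" "set (d r) \<inter> M \<subseteq> D ` UNIV"
      unfolding rangeD by (auto simp: W_def)
    from finite_subset_image[OF this] obtain I where I: "finite I" "set (d r) \<inter> M = D ` I" by (elim exE conjE)
    then obtain e where "I \<subseteq> {..<e}" by (metis finite_nat_iff_bounded)
    with I(2) show ?thesis by (intro exI[of _ e]) auto
  qed
  then obtain e where e: "\<And>r. set (d r) \<inter> M \<subseteq> D ` {..<e r}" by metis
  define w where "w r j = (if j = 0 then e r else length (b j))" for r j
  define x where "x = map (\<lambda>j. if j = 0 then D else pad c (b j)) [0..<n]"
  have sub: "set (d r) \<subseteq> set (params n (w r) x)" for r
  proof
    fix z assume z: "z \<in> set (d r)"
    then have "z \<in> ?B" using d by blast
    then consider "z \<in> M" | j where "j \<in> {1..<n}" "z \<in> set (b j)" by blast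
    then show "z \<in> set (params n (w r) x)"
    proof cases
      case 1
      then have "z \<in> D ` {..<e r}" using z e[of r] by blast
      then show ?thesis using \<open>n \<ge> 1\<close> unfolding set_params
        by (intro UN_I[of 0]) (auto simp: x_def w_def)
    next
      case 2
      then obtain i where "i < length (b j)" "z = b j ! i" by (auto simp: in_set_conv_nth)
      then have "z \<in> (x ! j) ` {..<w r j}" using 2(1)
        by (auto simp: x_def w_def pad_def intro!: image_eqI[of _ _ i])
      with 2(1) show ?thesis unfolding set_params by auto
    qed
  qed
  have "\<forall>r. \<exists>q. q \<in> fmls L (k + (\<Sum>j<n. w r j)) \<and>
      (\<forall>a\<in>tup k. holds MM q (a @ params n (w r) x) \<longleftrightarrow> a \<in> V r)"
  proof
    fix r
    obtain p where p: "p \<in> fmls L (k + length (d r))" "V r = {a\<in>tup k. holds MM p (a @ d r)}"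
      using d by blast
    obtain q where q: "q \<in> fmls L (k + length (params n (w r) x))"
      "\<And>a. length a = k \<Longrightarrow> holds MM q (a @ params n (w r) x) \<longleftrightarrow> holds MM p (a @ d r)"
      using definable_reparam[OF p(1) sub, of MM] by blast
    have "\<forall>a\<in>tup k. holds MM q (a @ params n (w r) x) \<longleftrightarrow> a \<in> V r"
      using q(2) by (simp add: p(2) tuples_def)
    with q(1) show "\<exists>q. q \<in> fmls L (k + (\<Sum>j<n. w r j)) \<and>
        (\<forall>a\<in>tup k. holds MM q (a @ params n (w r) x) \<longleftrightarrow> a \<in> V r)"
      by (simp only: length_params) blast
  qed
  from choice[OF this] obtain F where F: "\<And>r. F r \<in> fmls L (k + (\<Sum>j<n. w r j))"
    "\<And>r a. a \<in> tup k \<Longrightarrow> holds MM (F r) (a @ params n (w r) x) \<longleftrightarrow> a \<in> V r" by blast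
  have layer: "layer n w F r x = carrier G \<inter> V r" for r
    using F(2)[of _ r] carrier_tup by (auto simp: layer_def)
  have Mc: "M \<subseteq> carrier MM" using M(1) by (simp add: small_def)
  have W: "W \<subseteq> M" using M(3) by (auto simp: W_def)
  have "range e \<subseteq> carrier MM" if e: "e \<in> set x" for e
  proof -
    from e obtain j where j: "j < n" "e = (if j = 0 then D else pad c (b j))" by (auto simp: x_def)
    show ?thesis
    proof (cases "j = 0")
      case True
      then show ?thesis using j rangeD W Mc by simp
    next
      case False
      then have "range e \<subseteq> insert c (set (b j))" using j range_pad[of c "b j"] by simp
      also have "\<dots> \<subseteq> carrier MM" using b False j(1) M(3) Mc by auto
      finally show ?thesis .
    qed
  qed
  moreover have "\<one> \<in> V r" for r
    using subgroup.one_closed[OF H(1)] V(2) by blast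
  moreover have "\<exists>i j. i < j \<and> j < N r \<and> f i \<otimes> inv (f j) \<in> carrier G \<inter> V r"
    if f: "\<forall>i<N r. f i \<in> carrier G" for r f
  proof -
    obtain i j where "i < j" "j < N r" "f i \<otimes> inv (f j) \<in> V r" using N[of r f] f by blast
    then show ?thesis using f by (intro exI[of _ i] exI[of _ j]) simp
  qed
  moreover have "length x = n" by (simp add: x_def)
  ultimately have xf: "x \<in> filtering n w F N"
    unfolding filtering_def mem_Collect_eq layer using F(1) V(4) by simp
  have "H \<subseteq> core n w F x"
    using V(2) subgroup.subset[OF H(1)] by (auto simp: core_def layer)
  then have "x \<in> good n w F N"
    using bounded_index_mono[OF H(1) core_subgroup[OF xf] _ H(3)] xf by (simp add: good_def)
  moreover have "g \<notin> layer n w F 0 x" using V(3) by (simp add: layer)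
  moreover have "range D \<subseteq> M" using rangeD W by simp
  moreover have w_eq: "w = (\<lambda>r j. if j = 0 then e r else length (b j))"
    by (simp add: w_def fun_eq_iff)
  ultimately show ?thesis
    unfolding point_of_def by (intro exI[of _ F] exI[of _ e] exI[of _ N] exI[of _ D]) (simp add: x_def)
qed

end

section \<open>Grids from chains\<close>

lemma increasing_subset:
  assumes "\<And>i. i < m \<Longrightarrow> X i \<subseteq> X (Suc i)" and "i \<le> j" "j \<le> m"
  shows "X i \<subseteq> X j"
  using assms(2,3)
proof (induction j rule: dec_induct)
  case (step j)
  then show ?case using assms(1)[of j] by force
qed simp

context monster_group
begin

text \<open>The part of the right-hand side of the theorem that does not involve C.\<close>

definition generic_part :: "nat \<Rightarrow> 'a set \<Rightarrow> (nat \<Rightarrow> 'a list) \<Rightarrow> 'a list set" where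
  "generic_part n M b = carrier G \<inter>
     (\<Inter>i\<in>{1..<n}. G00 L MM \<kappa> k G (M \<union> (\<Union>j\<in>{1..<n} - {i}. set (b j))))"

text \<open>Failure is asked for at level 0 and not just outside the core, so that a fixed formula
  witnesses it along the whole chain. This is the level at which the cleaning starts.\<close>

definition chain ::
    "nat \<Rightarrow> 'a set \<Rightarrow> 'a \<Rightarrow> (nat \<Rightarrow> 'a list) \<Rightarrow> (nat \<Rightarrow> nat \<Rightarrow> nat) \<Rightarrow> (nat \<Rightarrow> ('f, 'r) fm) \<Rightarrow> (nat \<Rightarrow> nat) \<Rightarrow>
      nat \<Rightarrow> (nat \<Rightarrow> nat \<Rightarrow> 'a) \<Rightarrow> (nat \<Rightarrow> 'a list) \<Rightarrow> bool" where
  "chain n M c b w F N l D g \<longleftrightarrow>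
     (\<forall>i<l. range (D i) \<subseteq> M \<and> point_of n c b (D i) \<in> good n w F N \<and>
        g i \<in> generic_part n M b \<and> g i \<notin> layer n w F 0 (point_of n c b (D i))) \<and>
     (\<forall>i j. i < j \<longrightarrow> j < l \<longrightarrow> g j \<in> core n w F (point_of n c b (D i)))"

text \<open>Moving a single \<open>b j\<close> to a grid tuple is done by an automorphism that
  exists by equality of types. These moves can be composed because each of them fixes what the
  others have placed or still have to move.\<close>

lemma generic_grid:
  assumes Ms: "\<And>i. i < n - 1 \<Longrightarrow> Ms i \<subseteq> Ms (Suc i)" "Ms (n - 1) = M"
    and M: "small M" "S \<subseteq> M"
    and b: "\<And>i. i \<in> {1..<n} \<Longrightarrow> set (b i) \<subseteq> carrier MM"
    and S: "countable (S - Ms 0)"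
    and coh: "\<And>i C. i \<in> {1..<n} \<Longrightarrow> C \<subseteq> (\<Union>j\<in>{1..<i}. set (b j)) \<union> M \<Longrightarrow> countable (C - Ms (i - 1)) \<Longrightarrow>
      \<exists>a\<in>tuples (Ms i) (length (b i)). realizes MM a (tp L MM (b i) C)"
  obtains B :: "nat \<Rightarrow> nat \<Rightarrow> 'a list"
    where "\<And>j i. j \<in> {1..<n} \<Longrightarrow> i < l \<Longrightarrow> B j i \<in> tuples M (length (b j))"
      and "\<And>p. p \<in> grid n l \<Longrightarrow> \<exists>\<sigma>. automorphism L MM \<sigma> \<and> (\<forall>x\<in>S. \<sigma> x = x) \<and>
        (\<forall>j\<in>{1..<n}. map \<sigma> (b j) = B j (p ! j) \<and> (\<forall>i<p ! j. map \<sigma> (B j i) = B j i))"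
proof -
  have Ms_mono: "Ms i \<subseteq> Ms j" if "i \<le> j" "j \<le> n - 1" for i j
    using Ms(1) that by (rule increasing_subset)
  have MsM: "Ms i \<subseteq> M" if "i \<le> n - 1" for i using Ms_mono[OF that] Ms(2) by simp
  \<comment> \<open>The tuple with index (j, i) will realize the type of \<open>b j\<close> over
    this set. Tuples of higher direction are chosen before it; those of lower direction are chosen
    later but lie in \<open>Ms (j - 1)\<close>, which is included in their stead.\<close>
  define Cs where "Cs f ji = (case ji of (j, i) \<Rightarrow> S \<union> Ms (j - 1) \<union> (\<Union>j'\<in>{1..<j}. set (b j')) \<union>
      (\<Union>j'\<in>{j<..<n}. \<Union>i'<l. set (f (j', i'))) \<union> (\<Union>i'<i. set (f (j, i'))))"
    for f :: "nat \<times> nat \<Rightarrow> 'a list" and ji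
  \<comment> \<open>The order of choice: directions downwards, and indices upwards within a
    direction.\<close>
  let ?R = "{((j' :: nat, i' :: nat), (j, i)). (j < j' \<and> j' < n) \<or> (j' = j \<and> i' < i)}"
  let ?P = "\<lambda>f (j, i) a. j \<in> {1..<n} \<longrightarrow> a \<in> tuples (Ms j) (length (b j)) \<and>
      realizes MM a (tp L MM (b j) (Cs f (j, i)))"
  have "\<exists>f. \<forall>x. ?P f x (f x)"
  proof (rule dependent_wf_choice[of ?R])
    have "?R \<subseteq> inv_image (less_than <*lex*> less_than) (\<lambda>(j, i). (n - j, i))" by auto
    then show "wf ?R" by (rule wf_subset[rotated]) (intro wf_inv_image wf_lex_prod wf_less_than)
  next
    fix f g :: "nat \<times> nat \<Rightarrow> 'a list" and x r
    assume eq: "\<And>z. (z, x) \<in> ?R \<Longrightarrow> f z = g z"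
    obtain j i where x: "x = (j, i)" by (cases x)
    have "(\<Union>j'\<in>{j<..<n}. \<Union>i'<l. set (f (j', i'))) = (\<Union>j'\<in>{j<..<n}. \<Union>i'<l. set (g (j', i')))"
      using eq by (simp add: x)
    moreover have "(\<Union>i'<i. set (f (j, i'))) = (\<Union>i'<i. set (g (j, i')))"
      using eq by (simp add: x)
    ultimately have "Cs f x = Cs g x" by (simp add: Cs_def x)
    then show "?P f x r = ?P g x r" by (simp add: x)
  next
    fix x and f :: "nat \<times> nat \<Rightarrow> 'a list"
    assume IH: "\<And>y. (y, x) \<in> ?R \<Longrightarrow> ?P f y (f y)"
    obtain j i where x: "x = (j, i)" by (cases x)
    have "\<exists>a\<in>tuples (Ms j) (length (b j)). realizes MM a (tp L MM (b j) (Cs f (j, i)))"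
      if j: "j \<in> {1..<n}"
    proof (rule coh[OF j])
      have fM: "set (f (j', i')) \<subseteq> M" if "((j', i'), (j, i)) \<in> ?R" for j' i'
      proof -
        have j': "j' \<in> {1..<n}" using that j by auto
        then have "f (j', i') \<in> tuples (Ms j') (length (b j'))" using IH[of "(j', i')"] that x by auto
        moreover have "Ms j' \<subseteq> M" using j' by (intro MsM) auto
        ultimately show ?thesis by (auto simp: tuples_def)
      qed
      have "Ms (j - 1) \<subseteq> M" using j by (intro MsM) auto
      moreover have "(\<Union>j'\<in>{j<..<n}. \<Union>i'<l. set (f (j', i'))) \<subseteq> M" "(\<Union>i'<i. set (f (j, i'))) \<subseteq> M"
        by (intro UN_least fM; simp)+
      ultimately show "Cs f (j, i) \<subseteq> (\<Union>j\<in>{1..<j}. set (b j)) \<union> M"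
        using M(2) unfolding Cs_def prod.case by (intro Un_least) (simp_all only: le_supI1 le_supI2 Un_upper1)
      have "Ms 0 \<subseteq> Ms (j - 1)" using j by (intro Ms_mono) auto
      \<comment> \<open>S is countable outside the smallest model, so only countably many elements
        remain outside \<open>Ms (j - 1)\<close>, as the coheir condition demands.\<close>
      then have "Cs f (j, i) - Ms (j - 1) \<subseteq> (S - Ms 0) \<union> (\<Union>j'\<in>{1..<j}. set (b j')) \<union>
          (\<Union>j'\<in>{j<..<n}. \<Union>i'<l. set (f (j', i'))) \<union> (\<Union>i'<i. set (f (j, i')))"
        unfolding Cs_def prod.case by blast
      moreover have "countable \<dots>" using S by (auto intro!: countable_finite)
      ultimately show "countable (Cs f (j, i) - Ms (j - 1))" by (rule countable_subset)
    qed
    then show "\<exists>r. ?P f x r" by (auto simp: x)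
  qed
  then obtain f where f: "\<And>j i. j \<in> {1..<n} \<Longrightarrow> f (j, i) \<in> tuples (Ms j) (length (b j))"
    "\<And>j i. j \<in> {1..<n} \<Longrightarrow> realizes MM (f (j, i)) (tp L MM (b j) (Cs f (j, i)))"
    by auto
  define B where "B j i = f (j, i)" for j i
  have BM: "B j i \<in> tuples M (length (b j))" "set (B j i) \<subseteq> Ms j" if "j \<in> {1..<n}" for j i
  proof -
    have "Ms j \<subseteq> M" using that by (intro MsM) auto
    then show "B j i \<in> tuples M (length (b j))" "set (B j i) \<subseteq> Ms j"
      using f(1)[OF that, of i] by (auto simp: B_def tuples_def)
  qed
  have carrier: "M \<subseteq> carrier MM" using M(1) by (simp add: small_def)
  have "\<exists>\<sigma>. automorphism L MM \<sigma> \<and> (\<forall>x\<in>Cs f (j, i). \<sigma> x = x) \<and> map \<sigma> (b j) = B j i"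
    if j: "j \<in> {1..<n}" and i: "i < l" for j i
  proof -
    have "Cs f (j, i) \<subseteq> M \<union> (\<Union>j\<in>{1..<n}. set (b j))"
    proof -
      have "Ms (j - 1) \<subseteq> M" using j by (intro MsM) auto
      moreover have "set (f (j', i')) \<subseteq> M" if "j' \<in> {1..<n}" for j' i'
        using BM(1)[OF that, of i'] by (simp add: B_def tuples_def)
      then have "(\<Union>j'\<in>{j<..<n}. \<Union>i'<l. set (f (j', i'))) \<subseteq> M" "(\<Union>i'<i. set (f (j, i'))) \<subseteq> M"
        using j by (intro UN_least; simp)+
      moreover have "(\<Union>j'\<in>{1..<j}. set (b j')) \<subseteq> (\<Union>j\<in>{1..<n}. set (b j))"
        using j by (intro UN_mono) auto
      ultimately show ?thesis
        using M(2) unfolding Cs_def prod.case by (intro Un_least) (simp_all only: le_supI1 le_supI2)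
    qed
    moreover have "small (\<Union>j\<in>{1..<n}. set (b j))" by (intro small_finite UN_least b) auto
    ultimately have "small (Cs f (j, i))" using small_mono small_Un M(1) by blast
    moreover have "b j \<in> tup (length (b j))" using b[OF j] by (simp add: tuples_def)
    moreover have "B j i \<in> tup (length (b j))" using BM(1)[OF j, of i] carrier by (auto simp: tuples_def)
    ultimately show ?thesis
      using f(2)[OF j, of i] conjugate_if_same_type unfolding B_def by metis
  qed
  then have "\<exists>\<tau>. \<forall>j i. j \<in> {1..<n} \<longrightarrow> i < l \<longrightarrow>
      automorphism L MM (\<tau> j i) \<and> (\<forall>x\<in>Cs f (j, i). \<tau> j i x = x) \<and> map (\<tau> j i) (b j) = B j i"
    by metis
  then obtain \<tau> where \<tau>: "\<And>j i. j \<in> {1..<n} \<Longrightarrow> i < l \<Longrightarrow> automorphism L MM (\<tau> j i)"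
    "\<And>j i x. j \<in> {1..<n} \<Longrightarrow> i < l \<Longrightarrow> x \<in> Cs f (j, i) \<Longrightarrow> \<tau> j i x = x"
    "\<And>j i. j \<in> {1..<n} \<Longrightarrow> i < l \<Longrightarrow> map (\<tau> j i) (b j) = B j i"
    by blast
  \<comment> \<open>Induction on the number of directions treated. The grid tuples of all directions
    above t are still fixed, so a further factor, applied first, may move \<open>b (Suc t)\<close>
    to one of them.\<close>
  have "\<exists>\<sigma>. automorphism L MM \<sigma> \<and> (\<forall>x\<in>S. \<sigma> x = x) \<and>
      (\<forall>j i. t < j \<longrightarrow> j < n \<longrightarrow> i < l \<longrightarrow> map \<sigma> (B j i) = B j i) \<and>
      (\<forall>j\<in>{1..t}. map \<sigma> (b j) = B j (p ! j) \<and> (\<forall>i<p ! j. map \<sigma> (B j i) = B j i))"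
    if p: "p \<in> grid n l" and "t \<le> n - 1" for p t
    using \<open>t \<le> n - 1\<close>
  proof (induction t)
    case 0
    show ?case by (rule exI[of _ id]) (simp add: automorphism_id[unfolded id_def] id_def)
  next
    case (Suc t)
    then obtain \<sigma> where \<sigma>: "automorphism L MM \<sigma>" "\<forall>x\<in>S. \<sigma> x = x"
      "\<And>j i. t < j \<Longrightarrow> j < n \<Longrightarrow> i < l \<Longrightarrow> map \<sigma> (B j i) = B j i"
      "\<And>j. j \<in> {1..t} \<Longrightarrow> map \<sigma> (b j) = B j (p ! j)"
      "\<And>j i. j \<in> {1..t} \<Longrightarrow> i < p ! j \<Longrightarrow> map \<sigma> (B j i) = B j i"
      by auto
    have t: "Suc t \<in> {1..<n}" and pt: "p ! Suc t < l" using Suc.prems gridD(2)[OF p, of "Suc t"] by auto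
    define \<tau>' where "\<tau>' = \<tau> (Suc t) (p ! Suc t)"
    have \<tau>': "automorphism L MM \<tau>'" "map \<tau>' (b (Suc t)) = B (Suc t) (p ! Suc t)"
      "\<And>x. x \<in> Cs f (Suc t, p ! Suc t) \<Longrightarrow> \<tau>' x = x"
      using \<tau>[OF t pt] by (auto simp: \<tau>'_def)
    have fixes_list: "map \<tau>' xs = xs" if "set xs \<subseteq> Cs f (Suc t, p ! Suc t)" for xs
      using that \<tau>'(3) by (intro map_idI) auto
    have fixS: "\<tau>' x = x" if "x \<in> S" for x using that by (intro \<tau>'(3)) (simp add: Cs_def)
    have fixb: "map \<tau>' (b j) = b j" if "j \<in> {1..t}" for j
      using that by (intro fixes_list) (auto simp: Cs_def)
    have fixB1: "map \<tau>' (B j i) = B j i" if "Suc t < j" "j < n" "i < l" for j i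
      using that by (intro fixes_list) (auto simp: Cs_def B_def)
    have fixB2: "map \<tau>' (B (Suc t) i) = B (Suc t) i" if "i < p ! Suc t" for i
      using that by (intro fixes_list) (auto simp: Cs_def B_def)
    have fixB3: "map \<tau>' (B j i) = B j i" if "j \<in> {1..t}" for j i
    proof (rule fixes_list)
      have "set (B j i) \<subseteq> Ms j" using that Suc.prems by (intro BM(2)) auto
      also have "\<dots> \<subseteq> Ms t" using that Suc.prems by (intro Ms_mono) auto
      finally show "set (B j i) \<subseteq> Cs f (Suc t, p ! Suc t)" by (auto simp: Cs_def)
    qed
    have comp: "map (\<sigma> \<circ> \<tau>') xs = map \<sigma> (map \<tau>' xs)" for xs by simp
    show ?case
    proof (intro exI conjI allI impI ballI)
      show "automorphism L MM (\<sigma> \<circ> \<tau>')" by (rule automorphism_comp[OF \<sigma>(1) \<tau>'(1)])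
      show "(\<sigma> \<circ> \<tau>') x = x" if "x \<in> S" for x using that \<sigma>(2) fixS by simp
      show "map (\<sigma> \<circ> \<tau>') (B j i) = B j i" if "Suc t < j" "j < n" "i < l" for j i
        unfolding comp fixB1[OF that] using that by (intro \<sigma>(3)) auto
      fix j assume j: "j \<in> {1..Suc t}"
      show "map (\<sigma> \<circ> \<tau>') (b j) = B j (p ! j)"
      proof (cases "j = Suc t")
        case True
        show ?thesis unfolding comp True \<tau>'(2) using t pt by (intro \<sigma>(3)) auto
      next
        case False
        then have "j \<in> {1..t}" using j by auto
        then show ?thesis unfolding comp fixb[OF \<open>j \<in> {1..t}\<close>] by (rule \<sigma>(4))
      qed
      show "map (\<sigma> \<circ> \<tau>') (B j i) = B j i" if i: "i < p ! j" for i
      proof (cases "j = Suc t")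
        case True
        show ?thesis unfolding comp True fixB2[OF i[unfolded True]]
          using t pt i True by (intro \<sigma>(3)) auto
      next
        case False
        then have "j \<in> {1..t}" using j by auto
        then show ?thesis unfolding comp fixB3[OF \<open>j \<in> {1..t}\<close>] using i by (rule \<sigma>(5))
      qed
    qed
  qed
  note ex = this[OF _ order_refl]
  have "\<exists>\<sigma>. automorphism L MM \<sigma> \<and> (\<forall>x\<in>S. \<sigma> x = x) \<and>
        (\<forall>j\<in>{1..<n}. map \<sigma> (b j) = B j (p ! j) \<and> (\<forall>i<p ! j. map \<sigma> (B j i) = B j i))"
    if p: "p \<in> grid n l" for p
  proof -
    have "{1..<n} = {1..n - 1}" by auto
    then show ?thesis using ex[OF p] by metis
  qed
  with BM(1) show thesis by (rule that)
qed

text \<open>The element at p is the image of a chain element under the automorphism of p, so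
  membership at q is tested by pulling the point q back. If p and q differ in some direction
  \<open>j \<ge> 1\<close>, the tuple \<open>b j\<close> is missing from the parameters of the
  pulled-back point, and membership follows from the generic part. Otherwise the pulled-back point
  belongs to the chain, p exceeds q in coordinate 0, and the chain condition applies.\<close>

lemma grid_if_chain:
  assumes "n \<ge> 1"
    and Ms: "\<And>i. i < n - 1 \<Longrightarrow> Ms i \<subseteq> Ms (Suc i)" "Ms (n - 1) = M"
    and M: "small M" "A \<subseteq> Ms 0" "c \<in> M"
    and b: "\<And>i. i \<in> {1..<n} \<Longrightarrow> set (b i) \<subseteq> carrier MM"
    and coh: "\<And>i C. i \<in> {1..<n} \<Longrightarrow> C \<subseteq> (\<Union>j\<in>{1..<i}. set (b j)) \<union> M \<Longrightarrow> countable (C - Ms (i - 1)) \<Longrightarrow>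
      \<exists>a\<in>tuples (Ms i) (length (b i)). realizes MM a (tp L MM (b i) C)"
    and ch: "chain n M c b w F N l D g"
  obtains a h where "\<And>p. p \<in> grid n l \<Longrightarrow>
      point n a p \<in> good n w F N \<and> h p \<in> carrier G \<and> h p \<notin> layer n w F 0 (point n a p)"
    and "\<And>p q. p \<in> grid n l \<Longrightarrow> q \<in> grid n l \<Longrightarrow> p \<noteq> q \<Longrightarrow> \<forall>i<n. q ! i \<le> p ! i \<Longrightarrow> h p \<in> core n w F (point n a q)"
proof -
  have AM: "A \<subseteq> M"
  proof -
    have "Ms 0 \<subseteq> Ms (n - 1)" using Ms(1) by (rule increasing_subset) auto
    then show ?thesis using M(2) Ms(2) by blast
  qed
  have chD: "range (D i) \<subseteq> M" "point_of n c b (D i) \<in> good n w F N" "g i \<in> generic_part n M b"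
    "g i \<notin> layer n w F 0 (point_of n c b (D i))" if "i < l" for i
    using ch that by (auto simp: chain_def)
  have chg: "g j \<in> core n w F (point_of n c b (D i))" if "i < j" "j < l" for i j
    using ch that by (auto simp: chain_def)
  \<comment> \<open>The padding constant c is included so that padded tuples are mapped to padded
    tuples.\<close>
  define S where "S = insert c (A \<union> (\<Union>i<l. range (D i)))"
  have S: "S \<subseteq> M" "A \<subseteq> S" using M(3) AM chD(1) by (auto simp: S_def)
  have "S - Ms 0 \<subseteq> insert c (\<Union>i<l. range (D i))" using M(2) by (auto simp: S_def)
  moreover have "countable (insert c (\<Union>i<l. range (D i)))" by auto
  ultimately have Sc: "countable (S - Ms 0)" by (rule countable_subset)
  obtain B where B: "\<And>j i. j \<in> {1..<n} \<Longrightarrow> i < l \<Longrightarrow> B j i \<in> tuples M (length (b j))"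
    and ex: "\<And>p. p \<in> grid n l \<Longrightarrow> \<exists>\<sigma>. automorphism L MM \<sigma> \<and> (\<forall>x\<in>S. \<sigma> x = x) \<and>
        (\<forall>j\<in>{1..<n}. map \<sigma> (b j) = B j (p ! j) \<and> (\<forall>i<p ! j. map \<sigma> (B j i) = B j i))"
    using generic_grid[where Ms = Ms and l = l, OF Ms M(1) S(1) b Sc coh] by blast
  have "\<exists>\<sigma>. \<forall>p\<in>grid n l. automorphism L MM (\<sigma> p) \<and> (\<forall>x\<in>S. \<sigma> p x = x) \<and>
        (\<forall>j\<in>{1..<n}. map (\<sigma> p) (b j) = B j (p ! j) \<and> (\<forall>i<p ! j. map (\<sigma> p) (B j i) = B j i))"
    by (rule bchoice) (use ex in blast)
  then obtain \<sigma> where \<sigma>0: "\<forall>p\<in>grid n l. automorphism L MM (\<sigma> p) \<and> (\<forall>x\<in>S. \<sigma> p x = x) \<and>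
        (\<forall>j\<in>{1..<n}. map (\<sigma> p) (b j) = B j (p ! j) \<and> (\<forall>i<p ! j. map (\<sigma> p) (B j i) = B j i))"
    by (rule exE)
  have \<sigma>: "automorphism L MM (\<sigma> p)" "\<And>x. x \<in> S \<Longrightarrow> \<sigma> p x = x"
    "\<And>j. j \<in> {1..<n} \<Longrightarrow> map (\<sigma> p) (b j) = B j (p ! j)"
    "\<And>j i. j \<in> {1..<n} \<Longrightarrow> i < p ! j \<Longrightarrow> map (\<sigma> p) (B j i) = B j i" if "p \<in> grid n l" for p
    using bspec[OF \<sigma>0 that] by blast+
  have \<sigma>A: "\<forall>x\<in>A. \<sigma> p x = x" if "p \<in> grid n l" for p using \<sigma>(2)[OF that] S(2) by blast
  have \<sigma>c: "\<sigma> p c = c" if "p \<in> grid n l" for p using \<sigma>(2)[OF that] by (simp add: S_def)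
  have \<sigma>D: "\<sigma> p \<circ> D i = D i" if "p \<in> grid n l" "i < l" for p i
  proof
    fix x
    have "D i x \<in> S" using that(2) by (auto simp: S_def)
    then show "(\<sigma> p \<circ> D i) x = D i x" using \<sigma>(2)[OF that(1)] by simp
  qed
  define a where "a j i = (if j = 0 then D i else pad c (B j i))" for j i
  define h where "h p = map (\<sigma> p) (g (p ! 0))" for p
  have p0: "p ! 0 < l" if "p \<in> grid n l" for p using gridD(2)[OF that, of 0] \<open>n \<ge> 1\<close> by simp
  have pt: "point n a p = map ((\<circ>) (\<sigma> p)) (point_of n c b (D (p ! 0)))" if p: "p \<in> grid n l" for p
    unfolding point_def point_of_def a_def map_map
    by (rule map_cong) (use \<sigma>D[OF p p0[OF p]] \<sigma>(3)[OF p] in \<open>auto simp: comp_pad \<sigma>c[OF p]\<close>)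
  have good: "point n a p \<in> good n w F N" if p: "p \<in> grid n l" for p
    unfolding pt[OF p] by (rule good_automorphism[OF \<sigma>(1)[OF p] \<sigma>A[OF p] chD(2)[OF p0[OF p]]])
  have gG: "g i \<in> carrier G" if "i < l" for i using chD(3)[OF that] by (simp add: generic_part_def)
  have carr: "M \<subseteq> carrier MM" using M(1) by (simp add: small_def)
  have filt: "x \<in> filtering n w F N" if "x \<in> good n w F N" for x using that by (simp add: good_def)
  have "h p \<in> core n w F (point n a q)"
    if p: "p \<in> grid n l" and q: "q \<in> grid n l" and "p \<noteq> q" and le: "\<forall>i<n. q ! i \<le> p ! i" for p q
  proof -
    \<comment> \<open>The preimage of the point q: the automorphism of p moves \<open>b j\<close> to
      \<open>B j (p ! j)\<close> and fixes \<open>B j i\<close> for i below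
      \<open>p ! j\<close>.\<close>
    define y where "y = map (\<lambda>j. if j = 0 then D (q ! 0) else if q ! j = p ! j then pad c (b j)
        else pad c (B j (q ! j))) [0..<n]"
    have \<sigma>y: "map ((\<circ>) (\<sigma> p)) y = point n a q"
      unfolding y_def point_def a_def map_map
    proof (rule map_cong)
      fix j assume "j \<in> set [0..<n]"
      then have j: "j < n" by simp
      show "((\<circ>) (\<sigma> p) \<circ> (\<lambda>j. if j = 0 then D (q ! 0) else if q ! j = p ! j then pad c (b j)
        else pad c (B j (q ! j)))) j = (if j = 0 then D (q ! j) else pad c (B j (q ! j)))"
      proof (cases "j = 0")
        case True
        then show ?thesis using \<sigma>D[OF p p0[OF q]] by simp
      next
        case False
        then have j1: "j \<in> {1..<n}" using j by simp
        show ?thesis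
        proof (cases "q ! j = p ! j")
          case True
          then show ?thesis using False \<sigma>(3)[OF p j1] by (simp add: comp_pad \<sigma>c[OF p])
        next
          case neq: False
          then have "q ! j < p ! j" using le j by (simp add: order_less_le)
          then show ?thesis using False neq \<sigma>(4)[OF p j1] by (simp add: comp_pad \<sigma>c[OF p])
        qed
      qed
    qed simp
    have "g (p ! 0) \<in> core n w F y \<and> y \<in> filtering n w F N"
    proof (cases "\<exists>j\<in>{1..<n}. q ! j \<noteq> p ! j")
      case False
      then have y: "y = point_of n c b (D (q ! 0))"
        by (auto simp: y_def point_of_def)
      have "q ! 0 \<noteq> p ! 0"
      proof
        assume eq: "q ! 0 = p ! 0"
        have "q ! j = p ! j" if "j < n" for j using eq False that by (cases "j = 0") auto
        then have "q = p" using gridD(1)[OF p] gridD(1)[OF q] by (intro nth_equalityI) auto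
        with \<open>p \<noteq> q\<close> show False by simp
      qed
      then have "q ! 0 < p ! 0" using le \<open>n \<ge> 1\<close> by (simp add: order_less_le)
      then show ?thesis using chg[OF _ p0[OF p]] filt[OF chD(2)[OF p0[OF q]]] by (simp add: y)
    next
      case True
      then obtain j0 where j0: "j0 \<in> {1..<n}" "q ! j0 \<noteq> p ! j0" by blast
      have bij: "bij_betw (\<sigma> p) (carrier MM) (carrier MM)" using \<sigma>(1)[OF p] by (simp add: automorphism_def)
      let ?\<tau> = "inv_into (carrier MM) (\<sigma> p)"
      have \<tau>: "automorphism L MM ?\<tau>" by (rule automorphism_inv[OF \<sigma>(1)[OF p] is_struct])
      have inv: "?\<tau> (\<sigma> p x) = x" if "x \<in> carrier MM" for x
        using bij that by (rule bij_betw_inv_into_left)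
      have \<tau>A: "\<forall>x\<in>A. ?\<tau> x = x" using inv \<sigma>A[OF p] small_A by (metis small_def subsetD)
      define Y where "Y = M \<union> (\<Union>j\<in>{1..<n} - {j0}. set (b j))"
      have range_y: "range e \<subseteq> Y" if e: "e \<in> set y" for e
      proof -
        from e obtain j where j: "j < n" "e = (if j = 0 then D (q ! 0) else if q ! j = p ! j then pad c (b j)
          else pad c (B j (q ! j)))" by (auto simp: y_def)
        consider "j = 0" | "j \<in> {1..<n} - {j0}" "e = pad c (b j)" | "j \<in> {1..<n}" "e = pad c (B j (q ! j))"
          using j j0 by (cases "j = 0"; cases "q ! j = p ! j") auto
        then show ?thesis
        proof cases
          case 1
          then show ?thesis using j chD(1)[OF p0[OF q]] by (auto simp: Y_def)
        next
          case 2
          have "range e \<subseteq> insert c (set (b j))" unfolding 2(2) by (rule range_pad)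
          also have "\<dots> \<subseteq> Y" using 2(1) M(3) by (auto simp: Y_def)
          finally show ?thesis .
        next
          case 3
          have "range e \<subseteq> insert c (set (B j (q ! j)))" unfolding 3(2) by (rule range_pad)
          also have "\<dots> \<subseteq> M" using M(3) B[OF 3(1) gridD(2)[OF q]] 3(1) by (auto simp: tuples_def)
          finally show ?thesis by (auto simp: Y_def)
        qed
      qed
      have Yc: "Y \<subseteq> carrier MM" using carr b by (fastforce simp: Y_def)
      have "map ((\<circ>) ?\<tau>) (point n a q) = y"
        unfolding \<sigma>y[symmetric] map_map
      proof (rule map_idI)
        fix e assume "e \<in> set y"
        then have "e x \<in> carrier MM" for x using range_y Yc by blast
        then show "((\<circ>) ?\<tau> \<circ> (\<circ>) (\<sigma> p)) e = e" using inv by (simp add: fun_eq_iff)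
      qed
      \<comment> \<open>y need not be a point of the chain; it inherits goodness from the point at q
        through the inverse automorphism.\<close>
      then have y: "y \<in> good n w F N"
        using good_automorphism[OF \<tau> \<tau>A good[OF q]] by simp
      have "set (params n (w r) y) \<subseteq> Y" for r
      proof -
        have "range (y ! j) \<subseteq> Y" if "j < n" for j
          using that by (intro range_y nth_mem) (simp add: y_def)
        then show ?thesis unfolding set_params by blast
      qed
      then have "G00 L MM \<kappa> k G Y \<subseteq> core n w F y"
        by (intro G00_subset_core[OF y]) (use AM in \<open>auto simp: Y_def\<close>)
      moreover have "g (p ! 0) \<in> G00 L MM \<kappa> k G Y"
        using chD(3)[OF p0[OF p]] j0(1) by (simp add: generic_part_def Y_def)
      ultimately show ?thesis using filt[OF y] by blast
    qed
    then show ?thesis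
      using core_automorphism[OF \<sigma>(1)[OF p] \<sigma>A[OF p] _ gG[OF p0[OF p]], of y n w F N]
      by (simp add: \<sigma>y h_def)
  qed
  moreover have "point n a p \<in> good n w F N \<and> h p \<in> carrier G \<and> h p \<notin> layer n w F 0 (point n a p)"
    if p: "p \<in> grid n l" for p
  proof -
    have x: "length (point_of n c b (D (p ! 0))) = n" "\<forall>e\<in>set (point_of n c b (D (p ! 0))). range e \<subseteq> carrier MM"
      "\<And>r. F r \<in> fmls L (k + (\<Sum>j<n. w r j))"
      using chD(2)[OF p0[OF p]] by (auto simp: good_def filtering_def)
    have "h p \<notin> layer n w F 0 (point n a p)"
      using layer_automorphism[where F = F and w = w and r = 0,
          OF \<sigma>(1)[OF p] \<sigma>A[OF p] x(1,2) x(3) gG[OF p0[OF p]]] chD(4)[OF p0[OF p]]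
      by (simp add: pt[OF p] h_def)
    then show ?thesis
      using good[OF p] automorphism_group(1)[OF \<sigma>(1)[OF p] \<sigma>A[OF p] gG[OF p0[OF p]]] by (simp add: h_def)
  qed
  ultimately show thesis using that by blast
qed

end

section \<open>Cardinality of the language\<close>

lemma countable_ordLeq_natLeq:
  assumes "countable S"
  shows "|S| \<le>o natLeq"
proof -
  from assms obtain f :: "_ \<Rightarrow> nat" where "inj_on f S" by (rule countableE)
  then have "|S| \<le>o |UNIV :: nat set|" by (rule card_of_ordLeqI) simp
  then show ?thesis using card_of_nat by (rule ordLeq_ordIso_trans)
qed

context monster
begin

lemma infinite_theory: "infinite T"
proof -
  have "Ex i (Equal (Var i) (Var i)) \<in> T" for i
  proof (rule ccontr)
    let ?p = "Ex i (Equal (Var i) (Var i)) :: ('f, 'r) fm"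
    assume "?p \<notin> T"
    moreover have "?p \<in> fmls L 0" by (auto simp: fmls_def)
    ultimately have "Neg ?p \<in> T" using complete unfolding complete_theory_def by blast
    then have "holds MM (Neg ?p) []" using monster by (auto simp: monster_model_def models_def)
    then show False using carrier_nonempty by (auto simp: holds_def)
  qed
  then have "range (\<lambda>i. Ex i (Equal (Var i) (Var i))) \<subseteq> T" by blast
  moreover have "inj (\<lambda>i. Ex i (Equal (Var i) (Var i)) :: ('f, 'r) fm)" by (auto intro: injI)
  ultimately show ?thesis by (meson infinite_UNIV_nat range_inj_infinite infinite_super)
qed

text \<open>Quantifying the variables away maps formulas injectively to sentences. By completeness
  each sentence or its negation is in T, and T is infinite.\<close>

lemma card_fmls: "|fmls L m| \<le>o |T|"
proof -
  have 0: "|fmls L 0| \<le>o |T|"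
  proof -
    let ?N = "{p. Neg p \<in> T}"
    have "fmls L 0 \<subseteq> T \<union> ?N" using complete by (auto simp: complete_theory_def)
    moreover have "|?N| \<le>o |T|"
      by (rule card_of_ordLeqI[of Neg]) (auto intro: inj_onI)
    then have "|T \<union> ?N| \<le>o |T|"
      using infinite_theory by (intro card_of_Un_ordLeq_infinite_Field)
        (simp_all add: Field_card_of card_of_card_order_on card_of_mono1)
    ultimately show ?thesis by (meson card_of_mono1 ordLeq_transitive)
  qed
  have fv: "fv (foldr Ex xs p) = fv p - set xs" "wf_fm L (foldr Ex xs p) = wf_fm L p"
    "foldr Ex xs p = foldr Ex xs q \<Longrightarrow> p = q" for xs and p q :: "('f, 'r) fm"
    by (induction xs) auto
  have "|fmls L m| \<le>o |fmls L 0|"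
    by (rule card_of_ordLeqI[of "foldr Ex [0..<m]"])
      (auto intro!: inj_onI dest: fv(3) simp: fmls_def fv(1,2))
  with 0 show ?thesis by (rule ordLeq_transitive[rotated])
qed

lemma card_wf_fm: "|{p. wf_fm L p}| \<le>o |T|"
proof -
  have "p \<in> (\<Union>m. fmls L m)" if "wf_fm L p" for p
  proof -
    obtain m where "fv p \<subseteq> {..<m}" by (metis finite_fv finite_nat_iff_bounded)
    then show ?thesis using that by (auto simp: fmls_def)
  qed
  then have "{p. wf_fm L p} \<subseteq> (\<Union>m. fmls L m)" by blast
  moreover have "|\<Union>m. fmls L m| \<le>o |T|"
    using infinite_theory card_fmls by (intro card_of_UNION_ordLeq_infinite) (auto simp: infinite_iff_card_of_nat)
  ultimately show ?thesis by (meson card_of_mono1 ordLeq_transitive)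
qed

text \<open>A sequence is determined by its graph, so the bound is the number of subsets of
  \<open>\<nat> \<times> T \<times> \<nat> \<times> \<nat>\<close>.\<close>

lemma card_schemes:
  "|{(F, e, N). \<forall>r. wf_fm L (F r)} :: ((nat \<Rightarrow> ('f, 'r) fm) \<times> (nat \<Rightarrow> nat) \<times> (nat \<Rightarrow> nat)) set| \<le>o |Pow T|"
proof -
  let ?P = "(UNIV :: nat set) \<times> {p. wf_fm L p} \<times> (UNIV :: nat set) \<times> (UNIV :: nat set)"
  have nat: "|UNIV :: nat set| \<le>o |T|" using infinite_theory by (simp add: infinite_iff_card_of_nat)
  have "|?P| \<le>o |T|"
    using infinite_theory nat card_wf_fm
    by (intro card_of_Times_ordLeq_infinite_Field) (simp_all add: Field_card_of card_of_card_order_on)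
  then obtain f where f: "inj_on f ?P" "f ` ?P \<subseteq> T" by (auto simp: card_of_ordLeq[symmetric])
  show ?thesis
  proof (rule card_of_ordLeqI)
    show "inj_on (\<lambda>(F, e, N). f ` {(r, F r, e r, N r) | r. True}) {(F, e, N). \<forall>r. wf_fm L (F r)}"
    proof (rule inj_onI)
      fix s s' :: "(nat \<Rightarrow> ('f, 'r) fm) \<times> (nat \<Rightarrow> nat) \<times> (nat \<Rightarrow> nat)"
      assume in_S: "s \<in> {(F, e, N). \<forall>r. wf_fm L (F r)}" "s' \<in> {(F, e, N). \<forall>r. wf_fm L (F r)}"
        and image: "(case s of (F, e, N) \<Rightarrow> f ` {(r, F r, e r, N r) | r. True})
          = (case s' of (F, e, N) \<Rightarrow> f ` {(r, F r, e r, N r) | r. True})"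
      obtain F e N F' e' N' where s: "s = (F, e, N)" "s' = (F', e', N')" by (cases s, cases s')
      have wf: "\<forall>r. wf_fm L (F r)" "\<forall>r. wf_fm L (F' r)"
        and eq: "f ` {(r, F r, e r, N r) | r. True} = f ` {(r, F' r, e' r, N' r) | r. True}"
        using in_S image by (simp_all add: s)
      have "{(r, F r, e r, N r) | r. True} = {(r, F' r, e' r, N' r) | r. True}"
        by (rule inj_on_image_eq_iff[OF f(1), THEN iffD1, OF _ _ eq]) (use wf in auto)
      then have "(r, F r, e r, N r) \<in> {(r, F' r, e' r, N' r) | r. True}" for r by blast
      then show "s = s'" by (auto simp: s fun_eq_iff)
    qed
    show "(case s of (F, e, N) \<Rightarrow> f ` {(r, F r, e r, N r) | r. True}) \<in> Pow T"
      if "s \<in> {(F, e, N). \<forall>r. wf_fm L (F r)}" for s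
      using that f(2) by (auto simp: image_subset_iff)
  qed
qed

end

lemma card_Pow_ordLeq_cexp:
  assumes "|A| \<le>o r" and r: "Card_order r"
  shows "|Pow A| \<le>o ctwo ^c r"
proof -
  have "|A| \<le>o |Field r|"
    using assms by (meson card_of_Field_ordIso ordIso_symmetric ordLeq_ordIso_trans)
  then obtain f where f: "inj_on f A" "f ` A \<subseteq> Field r" by (auto simp: card_of_ordLeq[symmetric])
  have "|Pow A| \<le>o |Pow (Field r)|"
    by (rule card_of_ordLeqI[of "image f"]) (use f in \<open>auto simp: inj_on_image_Pow\<close>)
  also have "|Pow (Field r)| =o ctwo ^c r"
    by (simp add: card_of_Pow_Func cexp_def ctwo_def Field_card_of)
  finally show ?thesis .
qed

text \<open>With an enumeration of X as parameters, a formula says that some element differs from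
  all of them. This settles finite models in generic position, where the regular cardinals may be
  countable.\<close>

lemma finite_elem_substruct:
  fixes L :: "('f, 'r) lang" and MM :: "('a, 'f, 'r) struct"
  assumes el: "elem_substruct L (induced MM X) (induced MM Y)" and "finite X"
  shows "Y = X"
proof (rule ccontr)
  assume "Y \<noteq> X"
  have XY: "X \<subseteq> Y" using el by (simp add: elem_substruct_def induced_def)
  with \<open>Y \<noteq> X\<close> obtain y where y: "y \<in> Y" "y \<notin> X" by blast
  obtain xs where xs: "set xs = X" using \<open>finite X\<close> finite_list by blast
  define m where "m = length xs"
  define p :: "nat list \<Rightarrow> ('f, 'r) fm" where
    "p is = foldr (\<lambda>i q. Conj (Neg (Equal (Var m) (Var i))) q) is verum" for "is"
  have wf: "wf_fm L (p is)" "fv (p is) \<subseteq> insert m (set is)" for "is"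
    by (induction "is") (auto simp: p_def verum_def)
  have sat: "sat (induced MM Z) v (p is) \<longleftrightarrow> (\<forall>i\<in>set is. v m \<noteq> v i)" if "Z \<noteq> {}" for Z v "is"
    using that by (induction "is") (auto simp: p_def verum_def induced_def)
  let ?q = "Ex m (p [0..<m])"
  have q: "?q \<in> fmls L (length xs)" using wf[of "[0..<m]"] by (auto simp: fmls_def m_def)
  have h: "holds (induced MM Z) ?q xs \<longleftrightarrow> (\<exists>z\<in>Z. z \<notin> X)" if "Z \<noteq> {}" for Z
  proof -
    have "(\<forall>i\<in>set [0..<m]. z \<noteq> xs ! i) \<longleftrightarrow> z \<notin> X" for z
      by (auto simp: xs[symmetric] m_def in_set_conv_nth)
    moreover have "carrier (induced MM Z) = Z" by (simp add: induced_def)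
    moreover have "(\<forall>i\<in>set [0..<m]. (((!) xs)(m := z)) m \<noteq> (((!) xs)(m := z)) i) \<longleftrightarrow>
        (\<forall>i\<in>set [0..<m]. z \<noteq> xs ! i)" for z by auto
    ultimately show ?thesis by (simp only: holds_def sat.simps(5) sat[OF that])
  qed
  have "X \<noteq> {}" using el by (auto simp: elem_substruct_def is_struct_def induced_def)
  moreover have "holds (induced MM X) ?q xs \<longleftrightarrow> holds (induced MM Y) ?q xs"
    using el q xs unfolding elem_substruct_def by (auto simp: induced_def)
  ultimately show False using h[of X] h[of Y] y by auto
qed

section \<open>Boundedness of chains and the small base\<close>

context monster_group
begin

text \<open>A grid obtained from a chain fails at level 0, and after cleaning all n coordinates at
  level n. By \<open>cleaned_shatters\<close> the formula of level n + 4 is therefore the one with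
  the independence property.\<close>

lemma chains_bounded:
  assumes n_dep: "n_dependent TYPE('a) L n T" and "n \<ge> 1"
    and grids: "\<And>l D g. chain n M c b w F N l D g \<Longrightarrow> \<exists>a h. (\<forall>p\<in>grid n l.
        point n a p \<in> good n w F N \<and> h p \<in> carrier G \<and> h p \<notin> layer n w F 0 (point n a p)) \<and>
      (\<forall>p\<in>grid n l. \<forall>q\<in>grid n l. p \<noteq> q \<longrightarrow> (\<forall>i<n. q ! i \<le> p ! i) \<longrightarrow> h p \<in> core n w F (point n a q))"
  shows "\<exists>l. \<forall>D g. \<not> chain n M c b w F N l D g"
proof (rule ccontr)
  assume no: "\<not> (\<exists>l. \<forall>D g. \<not> chain n M c b w F N l D g)"
  interpret filtered_group G "layer n w F" N "filtering n w F N" by (rule filtered_group)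
  let ?m = "w (n + 4)" and ?p = "F (n + 4)"
  have sh: "\<exists>a. (\<forall>j<n. \<forall>i<l. a j i \<in> tup (?m j)) \<and> (\<forall>S\<subseteq>grid n l. shatters ?p k n a l S)" for l
  proof -
    define R where "R = n + 6 + 2 * card (grid n l)"
    obtain l' where l': "\<forall>a h. cleaned n 0 l' 0 (R + n) a h \<longrightarrow> (\<exists>a' h'. cleaned n n l n R a' h')"
      using cleaned_exists[of n R n l] by (auto simp: R_def)
    obtain D g where "chain n M c b w F N l' D g" using no by blast
    from grids[OF this] obtain a h where
      ah: "\<forall>p\<in>grid n l'. point n a p \<in> good n w F N \<and> h p \<in> carrier G \<and> h p \<notin> layer n w F 0 (point n a p)"
        "\<forall>p\<in>grid n l'. \<forall>q\<in>grid n l'. p \<noteq> q \<longrightarrow> (\<forall>i<n. q ! i \<le> p ! i) \<longrightarrow> h p \<in> core n w F (point n a q)"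
      by (elim exE conjE)
    have "cleaned n 0 l' 0 (R + n) a h"
      using ah core_subset unfolding cleaned_def good_def by (auto simp: subset_iff)
    then obtain a' h' where C: "cleaned n n l n R a' h'" using l' by blast
    define a'' where "a'' j i = map (a' j i) [0..<?m j]" for j i
    have params: "params n ?m (point n a' q) = concat (map (\<lambda>j. a'' j (q ! j)) [0..<n])" for q
      by (auto simp: params_def point_def a''_def intro!: arg_cong[where f = concat])
    have "a'' j i \<in> tup (?m j)" if "j < n" "i < l" for j i
    proof -
      \<comment> \<open>The constant point uses the i-th sequence in every direction, so it shows
        that \<open>a' j i\<close> takes its values in the monster model.\<close>
      have "replicate n i \<in> grid n l" using that by (auto simp: grid_def)
      then have "point n a' (replicate n i) \<in> filtering n w F N" using C by (simp add: cleaned_def)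
      moreover have "a' j i \<in> set (point n a' (replicate n i))"
        using that by (auto simp: point_def image_iff intro!: bexI[of _ j])
      ultimately have "range (a' j i) \<subseteq> carrier MM" by (auto simp: filtering_def)
      then show ?thesis by (auto simp: a''_def tuples_def)
    qed
    moreover have "shatters ?p k n a'' l S" if S: "S \<subseteq> grid n l" for S
    proof -
      \<comment> \<open>The set given to \<open>cleaned_shatters\<close> is the one kept out of the
        layer, so the complement of S is taken.\<close>
      obtain g where g: "g \<in> carrier G"
        "\<forall>q\<in>grid n l. g \<in> layer n w F (n + 4) (point n a' q) \<longleftrightarrow> q \<notin> grid n l - S"
        using cleaned_shatters[OF C, of "grid n l - S"] by (auto simp: R_def)
      have "holds MM ?p (g @ concat (map (\<lambda>j. a'' j (q ! j)) [0..<n])) \<longleftrightarrow> q \<in> S"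
        if q: "q \<in> grid n l" for q
        using bspec[OF g(2) q] q g(1) by (simp add: layer_def params)
      moreover have "g \<in> tup k" using g(1) carrier_tup by blast
      ultimately show ?thesis unfolding shatters_def by blast
    qed
    ultimately show ?thesis by blast
  qed
  \<comment> \<open>Length 1 and not 0: it takes a point of a chain to certify that the formula has
    the right variables.\<close>
  obtain D g where "chain n M c b w F N 1 D g" using no by blast
  then have "?p \<in> fmls L (k + (\<Sum>j<n. ?m j))"
    by (simp add: chain_def good_def filtering_def)
  then show False
    using n_dep n_independence_if_shatters[OF _ sh] unfolding n_dependent_def by blast
qed

lemma G00_antimono: "B \<subseteq> B' \<Longrightarrow> G00 L MM \<kappa> k G B' \<subseteq> G00 L MM \<kappa> k G B"
  unfolding G00_def by (auto intro: type_definable_mono)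

lemma small_base_exists:
  assumes n_dep: "n_dependent TYPE('a) L n T" and "n \<ge> 1"
    and Ms: "\<And>i. i < n - 1 \<Longrightarrow> Ms i \<subseteq> Ms (Suc i)" "Ms (n - 1) = M"
    and M: "small M" "A \<subseteq> Ms 0" "M \<noteq> {}"
    and b: "\<And>i. i \<in> {1..<n} \<Longrightarrow> set (b i) \<subseteq> carrier MM"
    and coh: "\<And>i C. i \<in> {1..<n} \<Longrightarrow> C \<subseteq> (\<Union>j\<in>{1..<i}. set (b j)) \<union> M \<Longrightarrow> countable (C - Ms (i - 1)) \<Longrightarrow>
      \<exists>a\<in>tuples (Ms i) (length (b i)). realizes MM a (tp L MM (b i) C)"
  shows "\<exists>C\<subseteq>M. |C| \<le>o beth2 ( |T| +c |A| ) \<and>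
    generic_part n M b \<inter> G00 L MM \<kappa> k G (C \<union> (\<Union>j\<in>{1..<n}. set (b j)))
      \<subseteq> G00 L MM \<kappa> k G (M \<union> (\<Union>j\<in>{1..<n}. set (b j)))"
proof -
  obtain c where c: "c \<in> M" using M(3) by blast
  have AM: "A \<subseteq> M"
  proof -
    have "Ms 0 \<subseteq> Ms (n - 1)" using Ms(1) by (rule increasing_subset) auto
    then show ?thesis using M(2) Ms(2) by blast
  qed
  let ?w = "\<lambda>e r j. if j = 0 then e r else length (b j)"
  let ?S = "{(F, e, N). \<forall>r. wf_fm L (F r)} :: ((nat \<Rightarrow> ('f, 'r) fm) \<times> (nat \<Rightarrow> nat) \<times> (nat \<Rightarrow> nat)) set"
  let ?ch = "\<lambda>(F, e, N) l D g. chain n M c b (?w e) F N l D g"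
  \<comment> \<open>Only the sequences D are recorded; the elements of the chain contribute nothing
    to C.\<close>
  define longest where "longest s l D \<longleftrightarrow> (\<exists>g. ?ch s l D g) \<and> (\<forall>D g. \<not> ?ch s (Suc l) D g)" for s l D
  have "\<exists>l D. longest s l D" for s
  proof -
    obtain F e N where s: "s = (F, e, N)" by (cases s)
    have bound: "\<exists>l. \<forall>D g. \<not> ?ch s l D g"
      unfolding s prod.case
    proof (rule chains_bounded[OF n_dep \<open>n \<ge> 1\<close>])
      fix l D g assume "chain n M c b (?w e) F N l D g"
      from grid_if_chain[OF \<open>n \<ge> 1\<close> Ms M(1,2) c b coh this]
      show "\<exists>a h. (\<forall>p\<in>grid n l.
          point n a p \<in> good n (?w e) F N \<and> h p \<in> carrier G \<and> h p \<notin> layer n (?w e) F 0 (point n a p)) \<and>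
        (\<forall>p\<in>grid n l. \<forall>q\<in>grid n l. p \<noteq> q \<longrightarrow> (\<forall>i<n. q ! i \<le> p ! i) \<longrightarrow>
          h p \<in> core n (?w e) F (point n a q))"
        by (smt (verit))
    qed
    define m where "m = (LEAST l. \<forall>D g. \<not> ?ch s l D g)"
    have m: "\<forall>D g. \<not> ?ch s m D g" unfolding m_def using bound by (rule LeastI_ex)
    \<comment> \<open>The empty chain always exists, so the least excluded length has a predecessor;
      a scheme without chains of length 1 gets length 0.\<close>
    have "?ch s 0 (\<lambda>_ _. c) (\<lambda>_. [])" by (simp add: s chain_def)
    then have "m \<noteq> 0" using m by metis
    then obtain l where l: "m = Suc l" by (cases m) auto
    have "\<not> (\<forall>D g. \<not> ?ch s l D g)"
      using not_less_Least[of l "\<lambda>l. \<forall>D g. \<not> ?ch s l D g"] l unfolding m_def by simp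
    then show ?thesis using m unfolding l longest_def by blast
  qed
  then obtain l D where "\<And>s. longest s (l s) (D s)" by metis
  then have lD: "\<exists>g. ?ch s (l s) (D s) g" "\<not> ?ch s (Suc (l s)) D' g'" for s D' g'
    unfolding longest_def by blast+
  define C where "C = A \<union> (\<Union>s\<in>?S. \<Union>i<l s. range (D s i))"
  have CM: "C \<subseteq> M"
  proof -
    have "range (D s i) \<subseteq> M" if "i < l s" for s i
      using lD(1)[of s] that by (auto simp: chain_def split: prod.splits)
    then have "(\<Union>s\<in>?S. \<Union>i<l s. range (D s i)) \<subseteq> M" by (intro UN_least) simp
    then show ?thesis using AM unfolding C_def by (rule Un_least[rotated])
  qed
  have "|C| \<le>o beth2 ( |T| +c |A| )"
  proof -
    let ?r = "|T| +c |A|"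
    have r: "Card_order ?r" by (rule Card_order_csum)
    have T: "|T| \<le>o ?r" by (rule ordLeq_csum1[OF card_of_Card_order])
    have A: "|A| \<le>o ?r" by (rule ordLeq_csum2[OF card_of_Card_order])
    have le: "?r \<le>o ctwo ^c ?r" "ctwo ^c ?r \<le>o beth2 ?r"
      unfolding beth2_def using r Card_order_cexp ordLess_ctwo_cexp ordLess_imp_ordLeq by blast+
    \<comment> \<open>Infinity comes from T. It keeps a union of at most \<open>beth2 ?r\<close>
      countable sets within \<open>beth2 ?r\<close>.\<close>
    have inf: "\<not> finite (Field (beth2 ?r))"
    proof -
      have "|T| \<le>o beth2 ?r" by (rule ordLeq_transitive[OF T ordLeq_transitive[OF le]])
      moreover have "cinfinite |T|" using infinite_theory by (simp add: cinfinite_def Field_card_of)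
      ultimately show ?thesis using cinfinite_mono unfolding cinfinite_def by blast
    qed
    have card: "Card_order (beth2 ?r)" unfolding beth2_def by (rule Card_order_cexp)
    have "|Pow T| \<le>o ctwo ^c ?r" using T r by (rule card_Pow_ordLeq_cexp)
    then have S: "|?S| \<le>o beth2 ?r"
      by (rule ordLeq_transitive[OF card_schemes ordLeq_transitive[OF _ le(2)]])
    have "|\<Union>i<l s. range (D s i)| \<le>o beth2 ?r" for s
    proof -
      have "countable (\<Union>i<l s. range (D s i))" by auto
      then have "|\<Union>i<l s. range (D s i)| \<le>o natLeq" by (simp add: countable_ordLeq_natLeq)
      moreover have "natLeq \<le>o beth2 ?r"
        using inf card by (simp add: cinfinite_def natLeq_ordLeq_cinfinite)
      ultimately show ?thesis by (rule ordLeq_transitive)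
    qed
    then have "|\<Union>s\<in>?S. \<Union>i<l s. range (D s i)| \<le>o beth2 ?r"
      by (intro card_of_UNION_ordLeq_infinite_Field[OF inf card S]) blast
    moreover have "|A| \<le>o beth2 ?r" by (rule ordLeq_transitive[OF A ordLeq_transitive[OF le]])
    ultimately show ?thesis
      unfolding C_def by (intro card_of_Un_ordLeq_infinite_Field[OF inf _ _ card])
  qed
  moreover have "generic_part n M b \<inter> G00 L MM \<kappa> k G (C \<union> (\<Union>j\<in>{1..<n}. set (b j)))
      \<subseteq> G00 L MM \<kappa> k G (M \<union> (\<Union>j\<in>{1..<n}. set (b j)))"
  proof (intro subsetI, elim IntE, rule ccontr)
    fix g assume gK: "g \<in> generic_part n M b"
      and gC: "g \<in> G00 L MM \<kappa> k G (C \<union> (\<Union>j\<in>{1..<n}. set (b j)))"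
      and gM: "g \<notin> G00 L MM \<kappa> k G (M \<union> (\<Union>j\<in>{1..<n}. set (b j)))"
    have g: "g \<in> carrier G" using gK by (simp add: generic_part_def)
    then obtain H where H: "subgroup H G"
      "type_definable L MM (M \<union> (\<Union>j\<in>{1..<n}. set (b j))) k H" "bounded_index \<kappa> G H" "g \<notin> H"
      using gM by (auto simp: G00_def)
    have bn: "\<forall>j\<in>{1..<n}. set (b j) \<subseteq> carrier MM" using b by (rule ballI)
    obtain F e N D0 where D0: "range D0 \<subseteq> M" "point_of n c b D0 \<in> good n (?w e) F N"
      "g \<notin> layer n (?w e) F 0 (point_of n c b D0)"
      using good_exists[OF M(1) AM c bn \<open>n \<ge> 1\<close> H(1-3) g H(4)] by (elim exE conjE)
    define s where "s = (F, e, N)"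
    \<comment> \<open>\<open>filtering\<close> includes that all \<open>F r\<close> are well formed,
      so the scheme found for H is among those that were used in forming C.\<close>
    have sS: "s \<in> ?S" using D0(2) by (auto simp: s_def good_def filtering_def fmls_def)
    obtain h where h: "chain n M c b (?w e) F N (l s) (D s) h" using lD(1)[of s] by (auto simp: s_def)
    have "g \<in> core n (?w e) F (point_of n c b (D s i))" if i: "i < l s" for i
    proof -
      let ?x = "point_of n c b (D s i)"
      have x: "?x \<in> good n (?w e) F N" using h i by (simp add: chain_def)
      have "set (params n (?w e r) ?x) \<subseteq> C \<union> (\<Union>j\<in>{1..<n}. set (b j))" for r
      proof -
        have "(?x ! j) ` {..<?w e r j} \<subseteq> C \<union> (\<Union>j\<in>{1..<n}. set (b j))" if j: "j < n" for j
        proof (cases "j = 0")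
          case True
          have "range (D s i) \<subseteq> C" using sS i unfolding C_def by blast
          then show ?thesis using True j by (auto simp: point_of_def)
        next
          case False
          then have "(?x ! j) ` {..<?w e r j} \<subseteq> set (b j)" using j by (auto simp: point_of_def pad_def)
          then show ?thesis using False j by auto
        qed
        then show ?thesis unfolding set_params by blast
      qed
      from G00_subset_core[OF x _ this] gC show ?thesis by (auto simp: C_def)
    qed
    \<comment> \<open>The chain is extended by D0 and g: g lies in all earlier groups and in the
      generic part, and the new group omits it at level 0.\<close>
    then have "?ch s (Suc (l s)) ((D s)(l s := D0)) (h(l s := g))"
      using h D0 gK unfolding s_def by (auto simp: chain_def less_Suc_eq)
    then show False using lD(2) by blast
  qed
  ultimately show ?thesis using CM by blast
qed

end

section \<open>From generic position to the theorem\<close>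

lemma coheir_realized:
  assumes ch: "coheir L MM \<kappa> N a B" and \<kappa>: "infinite_regular \<kappa>" and big: "cardSuc (beth2 |X| ) \<le>o \<kappa>"
    and C: "C \<subseteq> B \<union> N" "countable (C - X)" and fin: "finite X \<Longrightarrow> finite C"
  shows "\<exists>a'\<in>tuples N (length a). realizes MM a' (tp L MM a C)"
proof -
  have card: "Card_order \<kappa>" "\<not> finite (Field \<kappa>)" using \<kappa> by (auto simp: infinite_regular_def cinfinite_def)
  have "|C| <o \<kappa>"
  \<comment> \<open>For infinite X, the set C is no larger than X and hence below
    \<open>beth2 |X|\<close> and \<kappa>. For finite X the cardinal \<kappa> may be countable, so C
    has to be finite.\<close>
  proof (cases "finite X")
    case True
    then show ?thesis using fin card by (intro finite_ordLess_Card_order)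
  next
    case False
    have "|C - X| \<le>o |X|"
    proof -
      have "|C - X| \<le>o natLeq" using C(2) by (simp add: countable_ordLeq_natLeq)
      moreover have "natLeq \<le>o |X|" using False ordIso_ordLeq_trans[OF ordIso_symmetric[OF card_of_nat]]
        by (simp add: infinite_iff_card_of_nat)
      ultimately show ?thesis by (rule ordLeq_transitive)
    qed
    then have "|X \<union> (C - X)| \<le>o |X|"
      using False by (intro card_of_Un_ordLeq_infinite_Field)
        (simp_all add: Field_card_of card_of_card_order_on card_of_mono1)
    moreover have "|C| \<le>o |X \<union> (C - X)|" by (rule card_of_mono1) blast
    ultimately have "|C| \<le>o |X|" by (rule ordLeq_transitive[rotated])
    also have "|X| <o ctwo ^c |X|" by (rule ordLess_ctwo_cexp[OF card_of_Card_order])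
    also have "ctwo ^c |X| <o beth2 |X|" unfolding beth2_def by (rule ordLess_ctwo_cexp[OF Card_order_cexp])
    also have "beth2 |X| <o cardSuc (beth2 |X| )"
      by (rule cardSuc_greater) (simp add: beth2_def Card_order_cexp)
    also note big
    finally show ?thesis .
  qed
  with ch C(1) show ?thesis by (simp add: coheir_def)
qed

theorem corollary4p10:
  fixes L :: "('f, 'r) lang" and T :: "('f, 'r) fm set"
    and MM :: "('a, 'f, 'r) struct" and \<kappa> :: "'k rel"
    and G :: "('a list, 'z) monoid_scheme"
    and n k :: nat and A M :: "'a set" and b :: "nat \<Rightarrow> 'a list"
  assumes "n \<ge> 1"
    and "complete_theory L T" and "n_dependent TYPE('a) L n T"
    and "monster_model L T MM \<kappa>"
    and "A \<subseteq> carrier MM" and "|A| <o \<kappa>"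
    and "type_definable_group L MM A k G"
    and "elem_substruct L (induced MM M) MM" and "|M| <o \<kappa>" and "A \<subseteq> M"
    and "\<forall>i\<in>{1..n-1}. set (b i) \<subseteq> carrier MM"
    and "generic_position TYPE('c) L MM n M A b"
  shows "\<exists>C \<subseteq> M. |C| \<le>o beth2 ( |T| +c |A| ) \<and>
    G00 L MM \<kappa> k G (M \<union> (\<Union>j\<in>{1..n-1}. set (b j))) =
      carrier G \<inter> (\<Inter>i\<in>{1..n-1}. G00 L MM \<kappa> k G (M \<union> (\<Union>j\<in>{1..n-1} - {i}. set (b j)))) \<inter>
      G00 L MM \<kappa> k G (C \<union> (\<Union>j\<in>{1..n-1}. set (b j)))"
proof -
  interpret monster L T MM \<kappa> by unfold_locales (use assms in auto)
  interpret monster_group L T MM \<kappa> A k G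
    by unfold_locales (use assms in \<open>auto simp: small_def\<close>)
  have n: "{1..n - 1} = {1..<n}" using assms(1) by auto
  obtain \<iota> :: "nat \<Rightarrow> 'c rel" and Ms where
    reg': "\<forall>i\<in>{1..<n}. infinite_regular (\<iota> i)" and
    el': "\<forall>i<n - 1. elem_substruct L (induced MM (Ms i)) (induced MM (Ms (Suc i)))" and
    last: "Ms (n - 1) = M" and A0: "A \<subseteq> Ms 0" and
    big': "\<forall>i<n - 1. cardSuc (beth2 |Ms i| ) \<le>o \<iota> (Suc i)" and
    coh': "\<forall>i\<in>{1..<n}. coheir L MM (\<iota> i) (Ms i) (b i) ((\<Union>j\<in>{1..<i}. set (b j)) \<union> M)"
    using assms(12) unfolding generic_position_def n by (elim exE conjE)
  note reg = bspec[OF reg'] and el = el'[rule_format] and big = big'[rule_format] and coh = bspec[OF coh']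
  have MsS: "Ms i \<subseteq> Ms (Suc i)" if "i < n - 1" for i
    using el[OF that] by (simp add: elem_substruct_def induced_def)
  have MM: "M \<subseteq> carrier MM" "M \<noteq> {}"
    using assms(8) by (auto simp: elem_substruct_def is_struct_def induced_def)
  have b: "set (b i) \<subseteq> carrier MM" if "i \<in> {1..<n}" for i using assms(11) that unfolding n by (rule bspec)
  \<comment> \<open>Finiteness of one model spreads upwards, because a finite model has no proper
    elementary extension. Then M is finite, and so is every C considered below.\<close>
  have fin: "finite M" if "finite (Ms i)" "i \<le> n - 1" for i
  proof -
    have "finite (Ms j)" if "i \<le> j" "j \<le> n - 1" for j
      using that
    proof (induction j rule: dec_induct)
      case (step j)
      then show ?case using finite_elem_substruct[OF el[of j]] by simp
    qed (use \<open>finite (Ms i)\<close> in simp)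
    then show ?thesis using that(2) last by blast
  qed
  have "\<exists>a\<in>tuples (Ms i) (length (b i)). realizes MM a (tp L MM (b i) C)"
    if i: "i \<in> {1..<n}" and C: "C \<subseteq> (\<Union>j\<in>{1..<i}. set (b j)) \<union> M" "countable (C - Ms (i - 1))" for i C
  proof (rule coheir_realized[OF coh[OF i] reg[OF i]])
    show "cardSuc (beth2 |Ms (i - 1)| ) \<le>o \<iota> i" using big[of "i - 1"] i by auto
    show "C \<subseteq> ((\<Union>j\<in>{1..<i}. set (b j)) \<union> M) \<union> Ms i" using C(1) by blast
    show "finite C" if "finite (Ms (i - 1))"
      using fin[OF that] i by (intro finite_subset[OF C(1)]) auto
  qed (rule C(2))
  then obtain C where C: "C \<subseteq> M" "|C| \<le>o beth2 ( |T| +c |A| )"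
    "generic_part n M b \<inter> G00 L MM \<kappa> k G (C \<union> (\<Union>j\<in>{1..<n}. set (b j)))
      \<subseteq> G00 L MM \<kappa> k G (M \<union> (\<Union>j\<in>{1..<n}. set (b j)))"
    using small_base_exists[of n Ms M b] assms(1,3,9) MsS last A0 MM b by (auto simp: small_def)
  \<comment> \<open>The easy inclusion: more parameters give a smaller component.\<close>
  moreover have "G00 L MM \<kappa> k G (M \<union> (\<Union>j\<in>{1..<n}. set (b j)))
      \<subseteq> generic_part n M b \<inter> G00 L MM \<kappa> k G (C \<union> (\<Union>j\<in>{1..<n}. set (b j)))"
  proof (rule Int_greatest)
    show "G00 L MM \<kappa> k G (M \<union> (\<Union>j\<in>{1..<n}. set (b j))) \<subseteq> generic_part n M b"
      unfolding generic_part_def by (intro Int_greatest INT_greatest G00_antimono) (auto simp: G00_def)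
    show "G00 L MM \<kappa> k G (M \<union> (\<Union>j\<in>{1..<n}. set (b j))) \<subseteq> G00 L MM \<kappa> k G (C \<union> (\<Union>j\<in>{1..<n}. set (b j)))"
      using C(1) by (intro G00_antimono) auto
  qed
  ultimately show ?thesis unfolding n generic_part_def by (intro exI[of _ C]) blast
qed

end
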